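(* Let $M$ be a 2-dimensional manifold with boundary $\partial M$, and let $\mathbf{R}:M\to\mathbb{R}^3$ be a smooth immersion, the surface being parametrized by curvature line coordinates $(\alpha,\beta)$. Let $\mathbf{V}=\boldsymbol{\eta}+v_n\mathbf{N}$ be a variation vector of the surface, with tangential component $\boldsymbol{\eta}$ and normal component $v_n\mathbf{N}$, $v_n=\mathbf{V}\cdot\mathbf{N}$. Then the first variation of the area $A=\int_M dA$ under the deformation $\mathbf{r}=\mathbf{R}+t\mathbf{V}$ is given by $$\delta\int_M dA=-2\int_M\mathcal{H}\,(\mathbf{V}\cdot\mathbf{N})\,dA+\int_{\partial M}\boldsymbol{\eta}\cdot\mathbf{t}\,ds,$$ where $\mathbf{t}$ is the outward-pointing unit conormal vector and $ds$ is the line element of the boundary $\partial M$.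
   Context: Coordinates $(\alpha,\beta)$ are curvature line coordinates if the first and second fundamental forms of the surface are both diagonal in them. Subscripts denote partial derivatives, and $\mathbf{N}$ is the unit normal vector on the surface, with $\mathbf{R}_\alpha\times\mathbf{R}_\beta=\|\mathbf{R}_\alpha\times\mathbf{R}_\beta\|\,\mathbf{N}$. The principal curvatures $\kappa_1,\kappa_2$ are given by $\mathbf{N}_\alpha=-\kappa_1\mathbf{R}_\alpha$ and $\mathbf{N}_\beta=-\kappa_2\mathbf{R}_\beta$, and $\mathcal{H}=\frac12(\kappa_1+\kappa_2)$ is the mean curvature of $\mathbf{R}$. The area element is $dA=\|\mathbf{R}_\alpha\times\mathbf{R}_\beta\|\,d\alpha\,d\beta$ in the local coordinates. The parameter $t$ is the deformation parameter, $|t|\ll1$, and $\delta$ denotes the derivative $\frac{d}{dt}\big|_{t=0}$ of the quantity evaluated on the deformed surface $\mathbf{r}=\mathbf{R}+t\mathbf{V}$. The conormal $\mathbf{t}$ is tangent to the surface and orthogonal to the boundary curve.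
   Formalization: The surface is assumed to have finite area and the variation V to be smooth with compact support in M (automatic support condition and finite area if M is compact); otherwise the formula fails, e.g. for the open planar disc with radial V. *)

theory Defs
  imports "HOL-Analysis.Analysis"
begin

text \<open>
  On an open set \<open>S\<close> of a finite-dimensional space, \<open>times_cont_diff k f S\<close> says that \<open>f\<close> is of
  class \<open>C\<^sup>k\<close>; in finite dimension it suffices to differentiate in each fixed direction \<open>v\<close>.
\<close>

primrec times_cont_diff ::
    "nat \<Rightarrow> ('a::euclidean_space \<Rightarrow> 'b::real_normed_vector) \<Rightarrow> 'a set \<Rightarrow> bool" where
  "times_cont_diff 0 f S \<longleftrightarrow> continuous_on S f"
| "times_cont_diff (Suc k) f S \<longleftrightarrow>
     (\<forall>x\<in>S. f differentiable (at x)) \<and>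
     (\<forall>v. times_cont_diff k (\<lambda>x. frechet_derivative f (at x) v) S)"

text \<open>
  On an arbitrary set (for instance a relatively open part of a closed half-plane), smoothness means
  that there are local smooth extensions to open sets.
\<close>

definition smooth_on :: "'a::euclidean_space set \<Rightarrow> ('a \<Rightarrow> 'b::real_normed_vector) \<Rightarrow> bool" where
  "smooth_on D f \<longleftrightarrow>
     (\<forall>x\<in>D. \<exists>S g. open S \<and> x \<in> S \<and> (\<forall>k. times_cont_diff k g S) \<and> (\<forall>y\<in>S \<inter> D. g y = f y))"

definition half_plane :: "(real^2) set" where
  "half_plane = {x. 0 \<le> x $ 2}"

text \<open>
  A chart is a pair \<open>(U, \<phi>)\<close> of a subset of \<open>M\<close> and a map that is only relevant on \<open>U\<close>. The Hausdorff
  and second countability axioms are imposed through the type classes.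
\<close>

type_synonym 'a chart = "'a set \<times> ('a \<Rightarrow> real^2)"

definition surface_with_boundary ::
    "'a::{t2_space,second_countable_topology} set \<Rightarrow> 'a chart set \<Rightarrow> bool" where
  "surface_with_boundary M A \<longleftrightarrow>
     (\<forall>(U, \<phi>)\<in>A. openin (top_of_set M) U \<and> openin (top_of_set half_plane) (\<phi> ` U) \<and>
        homeomorphism U (\<phi> ` U) \<phi> (inv_into U \<phi>)) \<and>
     (\<Union>(U, \<phi>)\<in>A. U) = M \<and>
     (\<forall>(U, \<phi>)\<in>A. \<forall>(W, \<psi>)\<in>A. smooth_on (\<phi> ` (U \<inter> W)) (\<psi> \<circ> inv_into U \<phi>))"

definition manifold_boundary :: "'a chart set \<Rightarrow> 'a set" where
  "manifold_boundary A = {p. \<exists>(U, \<phi>)\<in>A. p \<in> U \<and> \<phi> p $ 2 = 0}"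

text \<open>
  General local coordinates on an open subset \<open>U\<close> of \<open>M\<close>. In contrast to the charts of the atlas, they
  need not map the boundary into a straight line: curvature line coordinates have no reason to do so.
\<close>

definition local_coordinates ::
    "'a::{t2_space,second_countable_topology} set \<Rightarrow> 'a chart set \<Rightarrow> 'a set \<Rightarrow> ('a \<Rightarrow> real^2) \<Rightarrow> bool"
where
  "local_coordinates M A U c \<longleftrightarrow>
     openin (top_of_set M) U \<and> homeomorphism U (c ` U) c (inv_into U c) \<and>
     (\<forall>(W, \<psi>)\<in>A. smooth_on (\<psi> ` (U \<inter> W)) (c \<circ> inv_into W \<psi>) \<and>
                  smooth_on (c ` (U \<inter> W)) (\<psi> \<circ> inv_into U c))"

definition smooth_map :: "'a chart set \<Rightarrow> ('a \<Rightarrow> 'b::real_normed_vector) \<Rightarrow> bool" where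
  "smooth_map A f \<longleftrightarrow> (\<forall>(U, \<phi>)\<in>A. smooth_on (\<phi> ` U) (f \<circ> inv_into U \<phi>))"

text \<open>
  The differential at \<open>p\<close> in the coordinates \<open>c\<close>. It is taken within \<open>c ` U\<close> because \<open>c p\<close> may be a
  boundary point of this set; for smooth \<open>f\<close> and local coordinates \<open>c\<close> it is uniquely determined.
\<close>

definition coord_differential ::
    "'a set \<Rightarrow> ('a \<Rightarrow> real^2) \<Rightarrow> ('a \<Rightarrow> 'b::real_normed_vector) \<Rightarrow> 'a \<Rightarrow> real^2 \<Rightarrow> 'b" where
  "coord_differential U c f p w =
     frechet_derivative (f \<circ> inv_into U c) (at (c p) within c ` U) w"

definition coord_deriv ::
    "'a set \<Rightarrow> ('a \<Rightarrow> real^2) \<Rightarrow> 2 \<Rightarrow> ('a \<Rightarrow> 'b::real_normed_vector) \<Rightarrow> 'a \<Rightarrow> 'b" where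
  "coord_deriv U c i f p = coord_differential U c f p (axis i 1)"

definition smooth_immersion :: "'a chart set \<Rightarrow> ('a \<Rightarrow> real^3) \<Rightarrow> bool" where
  "smooth_immersion A R \<longleftrightarrow>
     smooth_map A R \<and> (\<forall>(U, \<phi>)\<in>A. \<forall>p\<in>U. inj (coord_differential U \<phi> R p))"

definition first_form ::
    "'a set \<Rightarrow> ('a \<Rightarrow> real^2) \<Rightarrow> ('a \<Rightarrow> real^3) \<Rightarrow> 2 \<Rightarrow> 2 \<Rightarrow> 'a \<Rightarrow> real" where
  "first_form U c R i j p = coord_deriv U c i R p \<bullet> coord_deriv U c j R p"

definition second_form ::
    "'a set \<Rightarrow> ('a \<Rightarrow> real^2) \<Rightarrow> ('a \<Rightarrow> real^3) \<Rightarrow> ('a \<Rightarrow> real^3) \<Rightarrow> 2 \<Rightarrow> 2 \<Rightarrow> 'a \<Rightarrow> real" where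
  "second_form U c R N i j p = coord_deriv U c j (coord_deriv U c i R) p \<bullet> N p"

definition curvature_line_coordinates ::
    "'a::{t2_space,second_countable_topology} set \<Rightarrow> 'a chart set \<Rightarrow> ('a \<Rightarrow> real^3) \<Rightarrow> ('a \<Rightarrow> real^3) \<Rightarrow>
     'a set \<Rightarrow> ('a \<Rightarrow> real^2) \<Rightarrow> bool" where
  "curvature_line_coordinates M A R N U c \<longleftrightarrow>
     local_coordinates M A U c \<and>
     (\<forall>p\<in>U. \<forall>i j. i \<noteq> j \<longrightarrow> first_form U c R i j p = 0 \<and> second_form U c R N i j p = 0)"

definition area_density :: "'a set \<Rightarrow> ('a \<Rightarrow> real^2) \<Rightarrow> ('a \<Rightarrow> real^3) \<Rightarrow> 'a \<Rightarrow> real" where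
  "area_density U c r p = norm (cross3 (coord_deriv U c 1 r p) (coord_deriv U c 2 r p))"

definition unit_normal_in ::
    "'a set \<Rightarrow> ('a \<Rightarrow> real^2) \<Rightarrow> ('a \<Rightarrow> real^3) \<Rightarrow> ('a \<Rightarrow> real^3) \<Rightarrow> bool" where
  "unit_normal_in U c R N \<longleftrightarrow>
     (\<forall>p\<in>U. norm (N p) = 1 \<and>
        cross3 (coord_deriv U c 1 R p) (coord_deriv U c 2 R p) = area_density U c R p *\<^sub>R N p)"

text \<open>
  The value does not depend on the curvature line coordinates around \<open>p\<close>, since it is half the trace of
  the shape operator with respect to \<open>N\<close>.
\<close>

definition mean_curvature ::
    "'a::{t2_space,second_countable_topology} set \<Rightarrow> 'a chart set \<Rightarrow> ('a \<Rightarrow> real^3) \<Rightarrow> ('a \<Rightarrow> real^3) \<Rightarrow>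
     'a \<Rightarrow> real" where
  "mean_curvature M A R N p =
     (THE h. \<exists>U c k1 k2. p \<in> U \<and> curvature_line_coordinates M A R N U c \<and>
        coord_deriv U c 1 N p = - k1 *\<^sub>R coord_deriv U c 1 R p \<and>
        coord_deriv U c 2 N p = - k2 *\<^sub>R coord_deriv U c 2 R p \<and>
        h = (k1 + k2) / 2)"

text \<open>
  The measure \<open>dA\<close> of a smooth map \<open>r\<close>: the unique Borel measure on \<open>M\<close> with
  \<open>dA = \<parallel>r\<^sub>1 \<times> r\<^sub>2\<parallel> dx\<^sub>1 dx\<^sub>2\<close> in all local coordinates. The map \<open>r\<close> need not be an immersion.
\<close>

definition area_measure ::
    "'a::{t2_space,second_countable_topology} set \<Rightarrow> 'a chart set \<Rightarrow> ('a \<Rightarrow> real^3) \<Rightarrow> 'a measure" where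
  "area_measure M A r =
     (THE \<mu>. sets \<mu> = sets (restrict_space borel M) \<and>
        (\<forall>U c. local_coordinates M A U c \<longrightarrow>
           (\<forall>E\<in>sets \<mu>. E \<subseteq> U \<longrightarrow>
              emeasure \<mu> E =
                (\<integral>\<^sup>+ x\<in>c ` E. ennreal (area_density U c r (inv_into U c x)) \<partial>lborel))))"

text \<open>
  The measure \<open>ds\<close> on the boundary. In a chart of the atlas the boundary is the curve
  \<open>s \<mapsto> (s, 0)\<close>, and \<open>(s, 0)\<close> is written \<open>axis 1 s\<close>; the line element is \<open>\<parallel>R\<^sub>1\<parallel> ds\<close>.
\<close>

definition boundary_measure ::
    "'a::{t2_space,second_countable_topology} chart set \<Rightarrow> ('a \<Rightarrow> real^3) \<Rightarrow> 'a measure" where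
  "boundary_measure A R =
     (THE \<sigma>. sets \<sigma> = sets (restrict_space borel (manifold_boundary A)) \<and>
        (\<forall>(U, \<phi>)\<in>A. \<forall>E\<in>sets \<sigma>. E \<subseteq> U \<longrightarrow>
           emeasure \<sigma> E =
             (\<integral>\<^sup>+ s\<in>{s. axis 1 s \<in> \<phi> ` E}.
                ennreal (norm (coord_deriv U \<phi> 1 R (inv_into U \<phi> (axis 1 s)))) \<partial>lborel)))"

text \<open>
  At a boundary point, \<open>R\<^sub>1\<close> spans the tangent line of the boundary curve, and a tangent vector is
  outward-pointing if it is the image of a vector \<open>w\<close> pointing out of the half-plane.
\<close>

definition outward_conormal :: "'a chart set \<Rightarrow> ('a \<Rightarrow> real^3) \<Rightarrow> 'a \<Rightarrow> real^3" where
  "outward_conormal A R p =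
     (THE \<tau>. \<exists>(U, \<phi>)\<in>A. p \<in> U \<and>
        (\<exists>w. w $ 2 < 0 \<and> \<tau> = coord_differential U \<phi> R p w) \<and>
        norm \<tau> = 1 \<and> \<tau> \<bullet> coord_deriv U \<phi> 1 R p = 0)"

end

theory Submission
  imports Defs
begin

text \<open>
  Everything is expressed through the alternating form
  \<open>X(f, g) = f\<^sub>1 \<times> g\<^sub>2 - f\<^sub>2 \<times> g\<^sub>1\<close> of two maps into space, which is multiplied by the Jacobian
  determinant under a change of coordinates. Thus \<open>X(R, R) = 2 R\<^sub>1 \<times> R\<^sub>2\<close> is a multiple of \<open>N\<close>, the
  equation \<open>X(R, N) = - H X(R, R)\<close> holds in all coordinates because it holds in curvature line
  coordinates, and, as \<open>X(R + tV, R + tV) = X(R, R) + 2t X(R, V) + t\<^sup>2 X(V, V)\<close>, the derivative of the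
  area is the integral of \<open>N \<bullet> X(R, V)\<close> in oriented coordinates. The vector field with components
  \<open>N \<bullet> (V \<times> R\<^sub>2)\<close> and \<open>N \<bullet> (R\<^sub>1 \<times> V)\<close> has divergence \<open>N \<bullet> X(R, V) + H V \<bullet> X(R, R)\<close>, and its flux
  through the boundary is that of the tangential part of \<open>V\<close>. A partition of unity reduces the
  divergence theorem to rectangles in charts.
\<close>

subsection \<open>Gluing measures and pulling back integrals\<close>

text \<open>Area measure, length measure, mean curvature and conormal are all defined by
  \<open>THE\<close>, so nothing can be computed with them until existence and uniqueness are
  proved; this shapes much of the development. Two obstacles are local. Curvature line coordinates
  may map a neighbourhood of a boundary point onto an odd region of the plane, so uniqueness of
  derivatives and measurability of images are imported from charts, where the half-plane is
  available. And the charts carry no common orientation: \<open>N\<close> orients the surface, and a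
  chart enters through the sign of \<open>N \<bullet> X(R, R)\<close>, which is constant on a
  connected box and appears equally in the interior and the boundary integral. Dividing X by
  \<open>N \<bullet> X(R, R)\<close> turns local forms into global functions, and the deformed areas
  become integrals against the one measure \<open>dA\<close>. As \<open>V\<close> is zero off a
  compact set and the area is finite, the Taylor remainder is uniformly O(t^2). Vector fields are
  only asked to be C^1, so cut-off functions built from the square of \<open>max 0\<close> are
  enough.\<close>

lemma suminf_swap_ennreal:
  fixes f :: "nat \<Rightarrow> nat \<Rightarrow> ennreal"
  shows "(\<Sum>i. \<Sum>j. f i j) = (\<Sum>j. \<Sum>i. f i j)"
proof -
  have "(\<Sum>i. \<Sum>j. f i j) = (\<Sum>i. \<integral>\<^sup>+j. f i j \<partial>count_space UNIV)"
    by (simp add: nn_integral_count_space_nat)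
  also have "\<dots> = (\<integral>\<^sup>+j. (\<Sum>i. f i j) \<partial>count_space UNIV)"
    by (rule nn_integral_suminf[symmetric]) simp
  finally show ?thesis
    by (simp add: nn_integral_count_space_nat)
qed

text \<open>Makes sense of the \<open>THE\<close> in the area and length measures. Lindelof reduces
  the cover to countably many patches; made disjoint as \<open>D i\<close>, they cut any Borel set
  \<open>E\<close> into pieces, and the measure of \<open>E\<close> must be the sum of the local
  values. Compatibility shows that this sum agrees with every patch, also with those outside the
  countable subcover.\<close>

lemma ex1_measure_gluing:
  fixes X :: "'a::second_countable_topology set" and \<C> :: "('a set \<times> ('a set \<Rightarrow> ennreal)) set"
  assumes op: "\<And>U m. (U, m) \<in> \<C> \<Longrightarrow> openin (top_of_set X) U"
    and emp: "\<And>U m. (U, m) \<in> \<C> \<Longrightarrow> m {} = 0"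
    and add: "\<And>U m F. (U, m) \<in> \<C> \<Longrightarrow> range F \<subseteq> sets (restrict_space borel X) \<Longrightarrow>
               \<Union>(range F) \<subseteq> U \<Longrightarrow> disjoint_family F \<Longrightarrow> (\<Sum>i::nat. m (F i)) = m (\<Union>(range F))"
    and compat: "\<And>U m U' m' E. (U, m) \<in> \<C> \<Longrightarrow> (U', m') \<in> \<C> \<Longrightarrow>
               E \<in> sets (restrict_space borel X) \<Longrightarrow> E \<subseteq> U \<inter> U' \<Longrightarrow> m E = m' E"
    and cover: "X \<subseteq> (\<Union>(U, m)\<in>\<C>. U)"
  shows "\<exists>!\<mu>. sets \<mu> = sets (restrict_space borel X) \<and>
           (\<forall>(U, m)\<in>\<C>. \<forall>E\<in>sets \<mu>. E \<subseteq> U \<longrightarrow> emeasure \<mu> E = m E)"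
proof -
  let ?B = "restrict_space borel X"
  \<comment> \<open>The empty patch keeps the countable family nonempty, so that it can be
    enumerated by \<open>nat\<close> even when \<open>X\<close> is empty.\<close>
  define \<D> where "\<D> = insert ({}, \<lambda>_. 0) \<C>"
  have opD: "openin (top_of_set X) U" if "(U, m) \<in> \<D>" for U m
    using that op by (auto simp: \<D>_def)
  have empD: "m {} = 0" if "(U, m) \<in> \<D>" for U m
    using that emp by (auto simp: \<D>_def)
  have addD: "(\<Sum>i::nat. m (F i)) = m (\<Union>(range F))"
    if "(U, m) \<in> \<D>" "range F \<subseteq> sets ?B" "\<Union>(range F) \<subseteq> U" "disjoint_family F" for U m F
    using that add by (auto simp: \<D>_def)
  have compatD: "m E = m' E"
    if "(U, m) \<in> \<D>" "(U', m') \<in> \<D>" "E \<in> sets ?B" "E \<subseteq> U \<inter> U'" for U m U' m' E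
    using that compat[of U m U' m' E] emp by (auto simp: \<D>_def)
  have "\<exists>\<F>'\<subseteq>fst ` \<D>. countable \<F>' \<and> \<Union>\<F>' = \<Union>(fst ` \<D>)"
    using Lindelof_openin[of "fst ` \<D>" X] opD by (metis (no_types, lifting) image_iff prod.collapse)
  then obtain \<F>' where \<F>': "\<F>' \<subseteq> fst ` \<D>" "countable \<F>'" "\<Union>\<F>' = \<Union>(fst ` \<D>)" by blast
  define \<F> where "\<F> = insert {} \<F>'"
  have "X \<subseteq> \<Union>(fst ` \<D>)"
    using cover unfolding \<D>_def by force
  then have "X \<subseteq> \<Union>\<F>'" by (simp only: \<F>'(3))
  moreover have "{} \<in> fst ` \<D>" by (simp add: \<D>_def)
  ultimately have \<F>: "\<F> \<subseteq> fst ` \<D>" "countable \<F>" "\<F> \<noteq> {}" "X \<subseteq> \<Union>\<F>"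
    using \<F>'(1,2) unfolding \<F>_def by blast+
  define U where "U = from_nat_into \<F>"
  have rangeU: "range U = \<F>"
    unfolding U_def by (rule range_from_nat_into) (use \<F> in auto)
  have "\<exists>m. (U i, m) \<in> \<D>" for i
  proof -
    have "U i \<in> fst ` \<D>" using rangeU \<F>(1) by blast
    then show ?thesis by force
  qed
  then obtain m where Um: "\<And>i. (U i, m i) \<in> \<D>" by metis
  define D where "D = disjointed U"
  have UB: "U' \<in> sets ?B" if "openin (top_of_set X) U'" for U'
    using that by (auto simp: openin_open sets_restrict_space)
  have Usets: "range U \<subseteq> sets ?B"
    using opD[OF Um] UB by blast
  have Dsets: "D i \<in> sets ?B" for i
    unfolding D_def using sets.range_disjointed_sets[OF Usets] by blast
  have DU: "D i \<subseteq> U i" for i by (simp add: D_def disjointed_subset)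
  have disjD: "disjoint_family D" by (simp add: D_def disjoint_family_disjointed)
  have UD: "X \<subseteq> (\<Union>i. D i)"
    unfolding D_def UN_disjointed_eq using rangeU \<F>(4) by simp
  have BX: "E \<subseteq> X" if "E \<in> sets ?B" for E
    using sets.sets_into_space[OF that] by (simp add: space_restrict_space)
  define f where "f = (\<lambda>E. \<Sum>i. m i (E \<inter> D i))"
  define \<mu> where "\<mu> = measure_of X (sets ?B) f"
  have sigB: "sigma_algebra X (sets ?B)"
    using sets.sigma_algebra_axioms[of ?B] by (simp add: space_restrict_space)
  have pos: "positive (sets ?B) f"
    by (simp add: positive_def f_def empD[OF Um])
  have ca: "countably_additive (sets ?B) f"
    unfolding countably_additive_def
  proof (intro allI impI)
    fix F :: "nat \<Rightarrow> 'a set"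
    assume F: "range F \<subseteq> sets ?B" "disjoint_family F" "\<Union>(range F) \<in> sets ?B"
    have "(\<Sum>n. f (F n)) = (\<Sum>i. \<Sum>n. m i (F n \<inter> D i))"
      unfolding f_def by (rule suminf_swap_ennreal)
    also have "\<dots> = (\<Sum>i. m i (\<Union>(range F) \<inter> D i))"
    proof (rule suminf_cong)
      fix i
      have "(\<Sum>n. m i (F n \<inter> D i)) = m i (\<Union>(range (\<lambda>n. F n \<inter> D i)))"
      proof (rule addD[OF Um])
        show "range (\<lambda>n. F n \<inter> D i) \<subseteq> sets ?B" using F(1) Dsets by auto
        show "\<Union> (range (\<lambda>n. F n \<inter> D i)) \<subseteq> U i" using DU by auto
        show "disjoint_family (\<lambda>n. F n \<inter> D i)"
          using F(2) by (auto simp: disjoint_family_on_def)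
      qed
      then show "(\<Sum>n. m i (F n \<inter> D i)) = m i (\<Union>(range F) \<inter> D i)"
        by (simp add: Int_UN_distrib2)
    qed
    finally show "(\<Sum>n. f (F n)) = f (\<Union>(range F))" by (simp add: f_def)
  qed
  have sets\<mu>: "sets \<mu> = sets ?B"
    unfolding \<mu>_def using sigB by (simp add: sigma_algebra.sets_measure_of_eq)
  have em: "emeasure \<mu> E = f E" if "E \<in> sets ?B" for E
    unfolding \<mu>_def by (rule emeasure_measure_of_sigma[OF sigB pos ca that])
  show ?thesis
  proof (rule ex1I[of _ \<mu>], intro conjI ballI, goal_cases)
    case 1
    show ?case by (rule sets\<mu>)
  next
    case (2 c)
    obtain W w where c: "c = (W, w)" by (cases c)
    show ?case unfolding c
    proof (clarify)
      fix E assume E: "E \<in> sets \<mu>" "E \<subseteq> W"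
      have Ww: "(W, w) \<in> \<D>" using 2 c by (simp add: \<D>_def)
      have EB: "E \<in> sets ?B" using E sets\<mu> by simp
      have "emeasure \<mu> E = (\<Sum>i. m i (E \<inter> D i))" using em[OF EB] by (simp add: f_def)
      \<comment> \<open>On a piece that lies in both patches the local values agree, so the patch
        \<open>W\<close> takes over all summands and its own additivity reassembles
        \<open>E\<close>.\<close>
      also have "\<dots> = (\<Sum>i. w (E \<inter> D i))"
        using EB Dsets DU E(2) by (intro suminf_cong compatD[OF Um Ww]) blast+
      also have "\<dots> = w (\<Union>(range (\<lambda>i. E \<inter> D i)))"
      proof (rule addD[OF Ww])
        show "disjoint_family (\<lambda>n. E \<inter> D n)"
          using disjD by (auto simp: disjoint_family_on_def)
      qed (use EB Dsets E(2) in auto)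
      also have "\<Union>(range (\<lambda>i. E \<inter> D i)) = E" using UD BX[OF EB] by blast
      finally show "emeasure \<mu> E = w E" .
    qed
  next
    case (3 \<nu>)
    then have sets\<nu>: "sets \<nu> = sets ?B" by simp
    have em\<nu>: "emeasure \<nu> E = w E" if "(W, w) \<in> \<D>" "E \<in> sets ?B" "E \<subseteq> W" for W w E
      using 3 that by (auto simp: \<D>_def)
    show "\<nu> = \<mu>"
    proof (rule measure_eqI)
      show "sets \<nu> = sets \<mu>" using sets\<nu> sets\<mu> by simp
      fix E assume "E \<in> sets \<nu>"
      then have EB: "E \<in> sets ?B" using sets\<nu> by simp
      have "emeasure \<nu> (\<Union>(range (\<lambda>i. E \<inter> D i))) = (\<Sum>i. emeasure \<nu> (E \<inter> D i))"
        using EB Dsets disjD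
        by (intro suminf_emeasure[symmetric]) (auto simp: sets\<nu> disjoint_family_on_def)
      moreover have "\<Union>(range (\<lambda>i. E \<inter> D i)) = E" using UD BX[OF EB] by blast
      moreover have "(\<Sum>i. emeasure \<nu> (E \<inter> D i)) = (\<Sum>i. m i (E \<inter> D i))"
        using EB Dsets DU by (intro suminf_cong em\<nu>[OF Um]) blast+
      ultimately show "emeasure \<nu> E = emeasure \<mu> E" using em[OF EB] by (simp add: f_def)
    qed
  qed
qed

text \<open>The hypothesis \<open>em\<close> is the form in which area and length are given in
  coordinates, with \<open>h\<close> the parametrization and \<open>w\<close> the density. Read as
  an equality of measures it says that on \<open>U\<close> the measure is the image under
  \<open>h\<close> of a density, and integrals can then be transported by the rules for
  \<open>distr\<close> and \<open>density\<close>.\<close>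

lemma restrict_space_eq_distr_density:
  fixes w :: "'b \<Rightarrow> real"
  assumes U: "U \<in> sets \<mu>" and T: "T \<in> sets \<nu>"
    and h: "h \<in> measurable (restrict_space \<nu> T) (restrict_space \<mu> U)"
    and w: "w \<in> borel_measurable (restrict_space \<nu> T)"
    and em: "\<And>E. E \<in> sets \<mu> \<Longrightarrow> E \<subseteq> U \<Longrightarrow>
              emeasure \<mu> E = (\<integral>\<^sup>+x. ennreal (w x) * indicator {x\<in>T. h x \<in> E} x \<partial>\<nu>)"
  shows "restrict_space \<mu> U = distr (density (restrict_space \<nu> T) (\<lambda>x. ennreal (w x))) (restrict_space \<mu> U) h"
proof -
  let ?D = "density (restrict_space \<nu> T) (\<lambda>x. ennreal (w x))"
  have [measurable]: "h \<in> measurable ?D (restrict_space \<mu> U)" using h by simp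
  have UM: "U \<subseteq> space \<mu>" and TN: "T \<subseteq> space \<nu>" using U T sets.sets_into_space by auto
  show ?thesis
  proof (rule measure_eqI)
    fix E assume E: "E \<in> sets (restrict_space \<mu> U)"
    have E': "E \<in> sets \<mu>" "E \<subseteq> U"
      using E U by (auto simp: sets_restrict_space_iff)
    have m: "h -` E \<inter> space ?D \<in> sets (restrict_space \<nu> T)"
      using measurable_sets[OF h E] by simp
    have sp: "space (restrict_space \<nu> T) = T" using TN by (auto simp: space_restrict_space)
    have "emeasure (distr ?D (restrict_space \<mu> U) h) E = emeasure ?D (h -` E \<inter> space ?D)"
      using E by (intro emeasure_distr) auto
    also have "\<dots> = (\<integral>\<^sup>+x. ennreal (w x) * indicator (h -` E \<inter> space ?D) x \<partial>restrict_space \<nu> T)"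
      using w m by (intro emeasure_density) auto
    also have "\<dots> = (\<integral>\<^sup>+x. ennreal (w x) * indicator (h -` E \<inter> space ?D) x * indicator T x \<partial>\<nu>)"
      using T by (intro nn_integral_restrict_space) auto
    also have "\<dots> = (\<integral>\<^sup>+x. ennreal (w x) * indicator {x\<in>T. h x \<in> E} x \<partial>\<nu>)"
      by (intro nn_integral_cong) (auto simp: indicator_def sp)
    also have "\<dots> = emeasure \<mu> E" using em[OF E'] by simp
    also have "\<dots> = emeasure (restrict_space \<mu> U) E"
      using U E' by (simp add: emeasure_restrict_space)
    finally show "emeasure (restrict_space \<mu> U) E = emeasure (distr ?D (restrict_space \<mu> U) h) E" ..
  qed simp
qed

lemma nn_integral_pullback:
  fixes w :: "'b \<Rightarrow> real" and f :: "'a \<Rightarrow> ennreal"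
  assumes U: "U \<in> sets \<mu>" and T: "T \<in> sets \<nu>"
    and h: "h \<in> measurable (restrict_space \<nu> T) (restrict_space \<mu> U)"
    and w: "w \<in> borel_measurable (restrict_space \<nu> T)"
    and em: "\<And>E. E \<in> sets \<mu> \<Longrightarrow> E \<subseteq> U \<Longrightarrow>
              emeasure \<mu> E = (\<integral>\<^sup>+x. ennreal (w x) * indicator {x\<in>T. h x \<in> E} x \<partial>\<nu>)"
    and f: "f \<in> borel_measurable \<mu>" and f0: "\<And>p. p \<in> space \<mu> - U \<Longrightarrow> f p = 0"
  shows "(\<integral>\<^sup>+p. f p \<partial>\<mu>) = (\<integral>\<^sup>+x. ennreal (w x) * f (h x) * indicator T x \<partial>\<nu>)"
proof -
  let ?D = "density (restrict_space \<nu> T) (\<lambda>x. ennreal (w x))"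
  note eq = restrict_space_eq_distr_density[OF U T h w em]
  have fU: "f \<in> borel_measurable (restrict_space \<mu> U)" using f by (rule measurable_restrict_space1)
  have fh: "(\<lambda>x. f (h x)) \<in> borel_measurable (restrict_space \<nu> T)"
    using measurable_comp[OF h fU] by (simp add: comp_def)
  have "(\<integral>\<^sup>+p. f p \<partial>\<mu>) = (\<integral>\<^sup>+p. f p * indicator U p \<partial>\<mu>)"
    using f0 by (intro nn_integral_cong) (auto simp: indicator_def)
  also have "\<dots> = (\<integral>\<^sup>+p. f p \<partial>restrict_space \<mu> U)"
    using U by (subst nn_integral_restrict_space) auto
  also have "\<dots> = (\<integral>\<^sup>+p. f p \<partial>distr ?D (restrict_space \<mu> U) h)" using eq by simp
  also have "\<dots> = (\<integral>\<^sup>+x. f (h x) \<partial>?D)"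
    by (rule nn_integral_distr) (use h fU in auto)
  also have "\<dots> = (\<integral>\<^sup>+x. ennreal (w x) * f (h x) \<partial>restrict_space \<nu> T)"
    using w by (intro nn_integral_density fh) auto
  also have "\<dots> = (\<integral>\<^sup>+x. ennreal (w x) * f (h x) * indicator T x \<partial>\<nu>)"
    using T by (subst nn_integral_restrict_space) auto
  finally show ?thesis .
qed

text \<open>Integrability is carried along with the integral because the boundary length need not be
  finite, so there integrability has to be checked in a chart.\<close>

lemma
  fixes w :: "'b \<Rightarrow> real" and f :: "'a \<Rightarrow> real"
  assumes U: "U \<in> sets \<mu>" and T: "T \<in> sets \<nu>"
    and h: "h \<in> measurable (restrict_space \<nu> T) (restrict_space \<mu> U)"
    and w: "w \<in> borel_measurable (restrict_space \<nu> T)"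
    and w0: "\<And>x. x \<in> T \<Longrightarrow> 0 \<le> w x"
    and em: "\<And>E. E \<in> sets \<mu> \<Longrightarrow> E \<subseteq> U \<Longrightarrow>
              emeasure \<mu> E = (\<integral>\<^sup>+x. ennreal (w x) * indicator {x\<in>T. h x \<in> E} x \<partial>\<nu>)"
    and f: "f \<in> borel_measurable \<mu>" and f0: "\<And>p. p \<in> space \<mu> - U \<Longrightarrow> f p = 0"
  shows integral_pullback: "(\<integral>p. f p \<partial>\<mu>) = (\<integral>x. indicator T x * (w x * f (h x)) \<partial>\<nu>)"
    and integrable_pullback: "integrable \<mu> f \<longleftrightarrow> integrable \<nu> (\<lambda>x. indicator T x * (w x * f (h x)))"
proof -
  let ?D = "density (restrict_space \<nu> T) (\<lambda>x. ennreal (w x))"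
  note eq = restrict_space_eq_distr_density[OF U T h w em]
  have fU: "f \<in> borel_measurable (restrict_space \<mu> U)" using f by (rule measurable_restrict_space1)
  have f\<mu>: "(indicator U p *\<^sub>R f p) = f p" if "p \<in> space \<mu>" for p
    using f0[of p] that by (cases "p \<in> U") auto
  have fh: "(\<lambda>x. f (h x)) \<in> borel_measurable (restrict_space \<nu> T)"
    using measurable_comp[OF h fU] by (simp add: comp_def)
  have w0': "AE x in restrict_space \<nu> T. 0 \<le> w x"
    using w0 by (intro AE_I2) (auto simp: space_restrict_space)
  have "(\<integral>p. f p \<partial>\<mu>) = (\<integral>p. f p \<partial>restrict_space \<mu> U)"
    using U f\<mu> by (subst integral_restrict_space) (auto intro!: Bochner_Integration.integral_cong)
  also have "\<dots> = (\<integral>p. f p \<partial>distr ?D (restrict_space \<mu> U) h)" using eq by simp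
  also have "\<dots> = (\<integral>x. f (h x) \<partial>?D)"
    by (rule integral_distr) (use h fU in auto)
  also have "\<dots> = (\<integral>x. w x *\<^sub>R f (h x) \<partial>restrict_space \<nu> T)"
    by (rule integral_density[OF fh w w0'])
  also have "\<dots> = (\<integral>x. indicator T x * (w x * f (h x)) \<partial>\<nu>)"
    using T by (subst integral_restrict_space) auto
  finally show "(\<integral>p. f p \<partial>\<mu>) = (\<integral>x. indicator T x * (w x * f (h x)) \<partial>\<nu>)" .
  have "integrable \<mu> f \<longleftrightarrow> integrable (restrict_space \<mu> U) f"
    using U f\<mu> by (subst integrable_restrict_space)
      (auto intro!: Bochner_Integration.integrable_cong simp del: mult_eq_0_iff real_scaleR_def)
  also have "\<dots> \<longleftrightarrow> integrable (distr ?D (restrict_space \<mu> U) h) f" using eq by simp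
  also have "\<dots> \<longleftrightarrow> integrable ?D (\<lambda>x. f (h x))"
    by (rule integrable_distr_eq) (use h fU in auto)
  also have "\<dots> \<longleftrightarrow> integrable (restrict_space \<nu> T) (\<lambda>x. w x *\<^sub>R f (h x))"
    by (rule integrable_density[OF fh w w0'])
  also have "\<dots> \<longleftrightarrow> integrable \<nu> (\<lambda>x. indicator T x * (w x * f (h x)))"
    using T by (subst integrable_restrict_space) auto
  finally show "integrable \<mu> f \<longleftrightarrow> integrable \<nu> (\<lambda>x. indicator T x * (w x * f (h x)))" .
qed

text \<open>With \<open>s = \<parallel>a + u\<parallel>\<close> and \<open>r = \<parallel>a\<parallel>\<close> the remainder is \<open>(u \<bullet> u - (s - r)\<^sup>2) / (2 r)\<close>.\<close>

lemma norm_add_taylor: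
  fixes a u :: "'a::real_inner"
  assumes "a \<noteq> 0"
  shows "\<bar>norm (a + u) - norm a - (a \<bullet> u) / norm a\<bar> \<le> (norm u)\<^sup>2 / (2 * norm a)"
proof -
  define s r q where "s = norm (a + u)" and "r = norm a" and "q = norm u"
  have r: "r > 0" using assms by (simp add: r_def)
  have "s\<^sup>2 = r\<^sup>2 + 2 * (a \<bullet> u) + q\<^sup>2"
    by (simp add: s_def r_def q_def power2_norm_eq_inner inner_add_left inner_add_right inner_commute)
  then have au: "a \<bullet> u = (s\<^sup>2 - r\<^sup>2 - q\<^sup>2) / 2" by simp
  have eq: "s - r - (a \<bullet> u) / r = (q\<^sup>2 - (s - r)\<^sup>2) / (2 * r)"
    using r unfolding au by (simp add: field_simps power2_eq_square)
  have "\<bar>s - r\<bar> \<le> q" unfolding s_def r_def q_def by (metis norm_triangle_ineq3 add_diff_cancel_left')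
  then have "(s - r)\<^sup>2 \<le> q\<^sup>2" by (metis abs_ge_zero power2_abs power_mono)
  then have "\<bar>q\<^sup>2 - (s - r)\<^sup>2\<bar> \<le> q\<^sup>2" by simp
  then show ?thesis
    using r eq unfolding s_def[symmetric] r_def[symmetric] q_def[symmetric]
    by (simp add: abs_divide divide_right_mono)
qed

subsection \<open>Derivatives on a half-plane and changes of variables\<close>

text \<open>Uniqueness of a derivative within \<open>D\<close> only needs arbitrarily short steps
  inside \<open>D\<close> along every basis vector. In the upper half-plane a positive step along
  either basis vector is always possible, even from the boundary line.\<close>

lemma derivative_unique_within_half_plane:
  fixes f :: "real^2 \<Rightarrow> 'b::real_normed_vector"
  assumes D: "openin (top_of_set half_plane) D" and x: "x \<in> D"
    and "(f has_derivative f') (at x within D)" "(f has_derivative f'') (at x within D)"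
  shows "f' = f''"
proof (rule frechet_derivative_unique_within[OF assms(3,4)])
  fix i :: "real^2" and e :: real
  assume i: "i \<in> Basis" and e: "e > 0"
  obtain d where d: "d > 0" "ball x d \<inter> half_plane \<subseteq> D"
    using D x by (auto simp: openin_contains_ball)
  define r where "r = min d e / 2"
  have r: "0 < r" "r < d" "r < e" using d e by (auto simp: r_def)
  have "x \<in> half_plane" using D x openin_subset by fastforce
  then have "x + r *\<^sub>R i \<in> half_plane"
    using i r by (auto simp: half_plane_def Basis_vec_def axis_def)
  moreover have "x + r *\<^sub>R i \<in> ball x d" using r i by (simp add: dist_norm)
  ultimately show "\<exists>d. 0 < \<bar>d\<bar> \<and> \<bar>d\<bar> < e \<and> x + d *\<^sub>R i \<in> D"
    using d r by (intro exI[of _ r]) auto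
qed

section \<open>Symmetry of second derivatives\<close>

text \<open>Two applications of the mean value theorem: to
  \<open>t \<mapsto> f (x + v + t u) - f (x + t u)\<close>, which trades \<open>f\<close> for its
  derivative along \<open>u\<close>, and then to that derivative along \<open>v\<close>.\<close>

lemma second_difference_mean_value:
  fixes f :: "'a::real_normed_vector \<Rightarrow> real"
  assumes S: "convex S" and pts: "x \<in> S" "x + u \<in> S" "x + v \<in> S" "x + u + v \<in> S"
    and f: "\<And>y. y \<in> S \<Longrightarrow> (f has_derivative f' y) (at y)"
    and f': "\<And>y. y \<in> S \<Longrightarrow> ((\<lambda>y. f' y u) has_derivative f'' y) (at y)"
  shows "\<exists>y\<in>S. f (x + u + v) - f (x + u) - f (x + v) + f x = f'' y v"
proof -
  have seg: "y + t *\<^sub>R w \<in> S" if "y \<in> S" "y + w \<in> S" "0 \<le> t" "t \<le> 1" for y w t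
  proof -
    have "y + t *\<^sub>R w = (1 - t) *\<^sub>R y + t *\<^sub>R (y + w)" by (simp add: algebra_simps)
    then show ?thesis using S that by (metis convexD_alt)
  qed
  define k where "k = (\<lambda>t. f (x + v + t *\<^sub>R u) - f (x + t *\<^sub>R u))"
  have kd: "(k has_derivative (\<lambda>h. h * (f' (x + v + t *\<^sub>R u) u - f' (x + t *\<^sub>R u) u))) (at t)"
    if "0 \<le> t" "t \<le> 1" for t
  proof -
    have a: "x + v + t *\<^sub>R u \<in> S" "x + t *\<^sub>R u \<in> S"
      using seg[of "x + v" u t] seg[of x u t] pts that by (auto simp: algebra_simps)
    have l: "f' y (h *\<^sub>R u) = h * f' y u" if "y \<in> S" for y h
      using linear_cmul[OF has_derivative_linear[OF f[OF that]]] by simp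
    have "((\<lambda>t. f (x + v + t *\<^sub>R u)) has_derivative (\<lambda>h. f' (x + v + t *\<^sub>R u) (h *\<^sub>R u))) (at t)"
      "((\<lambda>t. f (x + t *\<^sub>R u)) has_derivative (\<lambda>h. f' (x + t *\<^sub>R u) (h *\<^sub>R u))) (at t)"
      by (rule has_derivative_compose[where g = f], auto intro!: derivative_eq_intros f a)+
    then show ?thesis unfolding k_def
      by (rule has_derivative_eq_rhs[OF has_derivative_diff]) (simp add: fun_eq_iff l[OF a(1)] l[OF a(2)] right_diff_distrib)
  qed
  have kd': "(k has_derivative (\<lambda>h. h * (f' (x + v + t *\<^sub>R u) u - f' (x + t *\<^sub>R u) u))) (at t within {0..1})"
    if "t \<in> {0..1}" for t
    using kd[of t] that by (auto intro: has_derivative_at_withinI)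
  have "\<exists>t\<in>{0<..<1}. k 1 - k 0 = (\<lambda>t h. h * (f' (x + v + t *\<^sub>R u) u - f' (x + t *\<^sub>R u) u)) t (1 - 0)"
    by (rule mvt_simple) (use kd' in auto)
  then obtain t where t: "0 < t" "t < 1" "k 1 - k 0 = f' (x + v + t *\<^sub>R u) u - f' (x + t *\<^sub>R u) u" by auto
  define z where "z = x + t *\<^sub>R u"
  have z: "z \<in> S" "z + v \<in> S"
    using seg[of x u t] seg[of "x + v" u t] pts t by (auto simp: z_def algebra_simps)
  have ld: "((\<lambda>s. f' (z + s *\<^sub>R v) u) has_derivative (\<lambda>h. h * f'' (z + s *\<^sub>R v) v)) (at s)"
    if "0 \<le> s" "s \<le> 1" for s
  proof -
    have a: "z + s *\<^sub>R v \<in> S" using seg[OF z that] .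
    have "((\<lambda>s. f' (z + s *\<^sub>R v) u) has_derivative (\<lambda>h. f'' (z + s *\<^sub>R v) (h *\<^sub>R v))) (at s)"
      by (rule has_derivative_compose[where g = "\<lambda>y. f' y u"]) (auto intro!: derivative_eq_intros f' a)
    then show ?thesis using linear_cmul[OF has_derivative_linear[OF f'[OF a]]] by simp
  qed
  have ld': "((\<lambda>s. f' (z + s *\<^sub>R v) u) has_derivative (\<lambda>h. h * f'' (z + s *\<^sub>R v) v)) (at s within {0..1})"
    if "s \<in> {0..1}" for s
    using ld[of s] that by (auto intro: has_derivative_at_withinI)
  have "\<exists>s\<in>{0<..<1}. (\<lambda>s. f' (z + s *\<^sub>R v) u) 1 - (\<lambda>s. f' (z + s *\<^sub>R v) u) 0
      = (\<lambda>s h. h * f'' (z + s *\<^sub>R v) v) s (1 - 0)"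
    by (rule mvt_simple) (use ld' in auto)
  then obtain s where s: "s \<in> {0<..<1}" "f' (z + 1 *\<^sub>R v) u - f' (z + 0 *\<^sub>R v) u = f'' (z + s *\<^sub>R v) v"
    by auto
  have "f (x + u + v) - f (x + u) - f (x + v) + f x = k 1 - k 0" by (simp add: k_def algebra_simps)
  also have "\<dots> = f'' (z + s *\<^sub>R v) v" using s t by (simp add: z_def algebra_simps)
  finally show ?thesis using seg[OF z, of s] s by (intro bexI[of _ "z + s *\<^sub>R v"]) auto
qed

text \<open>Schwarz's theorem. The second difference over the parallelogram spanned by
  \<open>h u\<close> and \<open>h v\<close> is symmetric in \<open>u\<close> and \<open>v\<close>,
  so the mean value lemma in both orders gives \<open>fu y v = fv z u\<close> at two nearby points.
  Continuity makes this incompatible with a gap at \<open>x\<close>.\<close>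

lemma mixed_derivatives_commute_real:
  fixes f :: "'a::real_normed_vector \<Rightarrow> real"
  assumes S: "open S" "x \<in> S"
    and f: "\<And>y. y \<in> S \<Longrightarrow> (f has_derivative f' y) (at y)"
    and fu: "\<And>y. y \<in> S \<Longrightarrow> ((\<lambda>y. f' y u) has_derivative fu y) (at y)"
    and fv: "\<And>y. y \<in> S \<Longrightarrow> ((\<lambda>y. f' y v) has_derivative fv y) (at y)"
    and cont: "continuous_on S (\<lambda>y. fu y v)" "continuous_on S (\<lambda>y. fv y u)"
  shows "fu x v = fv x u"
proof (rule ccontr)
  assume ne: "fu x v \<noteq> fv x u"
  \<comment> \<open>Half the gap: values closer than \<open>e\<close> to its two ends cannot
    coincide.\<close>
  define e where "e = \<bar>fu x v - fv x u\<bar> / 2"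
  have e: "e > 0" using ne by (simp add: e_def)
  have "isCont (\<lambda>y. fu y v) x" "isCont (\<lambda>y. fv y u) x"
    using cont S by (auto simp: continuous_on_eq_continuous_at)
  then have "\<forall>\<^sub>F y in at x. dist (fu y v) (fu x v) < e" "\<forall>\<^sub>F y in at x. dist (fv y u) (fv x u) < e"
    using e by (auto simp: isCont_def dest: tendstoD)
  then have "\<forall>\<^sub>F y in at x. y \<in> S \<and> dist (fu y v) (fu x v) < e \<and> dist (fv y u) (fv x u) < e"
    using S by (auto simp: eventually_conj_iff eventually_at_in_open')
  then obtain d where d: "d > 0"
    "\<And>y. y \<noteq> x \<Longrightarrow> dist y x < d \<Longrightarrow> y \<in> S \<and> dist (fu y v) (fu x v) < e \<and> dist (fv y u) (fv x u) < e"
    unfolding eventually_at by auto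
  then have d': "y \<in> S \<and> dist (fu y v) (fu x v) < e \<and> dist (fv y u) (fv x u) < e" if "y \<in> ball x d" for y
    using that S e d(2)[of y] by (cases "y = x") (simp_all add: dist_commute)
  \<comment> \<open>The summand 1 keeps \<open>q\<close> positive when \<open>u\<close> and
    \<open>v\<close> both vanish; with \<open>h * q = d / 2\<close> all corners of the parallelogram
    stay in the ball of radius \<open>d\<close>.\<close>
  define q where "q = norm u + norm v + 1"
  define h where "h = d / (2 * q)"
  have q: "q > 0" unfolding q_def by (smt (verit) norm_ge_zero)
  have h: "h > 0" using d q by (simp add: h_def)
  have "h * q < d" using d q by (simp add: h_def)
  moreover have "h * q = h * norm u + h * norm v + h" by (simp add: q_def algebra_simps)
  moreover have "0 \<le> h * norm u" "0 \<le> h * norm v" using h by simp_all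
  ultimately have sm: "h * norm u < d" "h * norm v < d" "h * norm u + h * norm v < d"
    using h by linarith+
  have inb: "x + w \<in> ball x d \<longleftrightarrow> norm w < d" for w by (simp add: dist_norm)
  have nh: "norm (h *\<^sub>R w) = h * norm w" for w :: 'a using h by simp
  have "norm (h *\<^sub>R u + h *\<^sub>R v) < d"
    using sm(3) norm_triangle_ineq[of "h *\<^sub>R u" "h *\<^sub>R v"] unfolding nh by linarith
  then have pts: "x \<in> ball x d" "x + h *\<^sub>R u \<in> ball x d" "x + h *\<^sub>R v \<in> ball x d"
    "x + h *\<^sub>R u + h *\<^sub>R v \<in> ball x d" "x + h *\<^sub>R v + h *\<^sub>R u \<in> ball x d"
    using sm d(1) unfolding inb add.assoc nh by (simp_all add: add.commute)
  have lin: "f' y (h *\<^sub>R w) = h * f' y w" if "y \<in> ball x d" for y w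
    using linear_cmul[OF has_derivative_linear[OF f]] d' that by simp
  have U: "((\<lambda>z. f' z (h *\<^sub>R u)) has_derivative (\<lambda>w. h * fu y w)) (at y)" if "y \<in> ball x d" for y
    by (rule has_derivative_transform_within_open[OF has_derivative_mult_right[OF fu] open_ball that])
       (use d' that lin in auto)
  have V: "((\<lambda>z. f' z (h *\<^sub>R v)) has_derivative (\<lambda>w. h * fv y w)) (at y)" if "y \<in> ball x d" for y
    by (rule has_derivative_transform_within_open[OF has_derivative_mult_right[OF fv] open_ball that])
       (use d' that lin in auto)
  have fB: "(f has_derivative f' y) (at y)" if "y \<in> ball x d" for y using f d' that by blast
  obtain y where y: "y \<in> ball x d"
    "f (x + h *\<^sub>R u + h *\<^sub>R v) - f (x + h *\<^sub>R u) - f (x + h *\<^sub>R v) + f x = h * fu y (h *\<^sub>R v)"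
    using second_difference_mean_value[where f = f and f' = f' and f'' = "\<lambda>y w. h * fu y w", OF convex_ball pts(1,2,3,4) fB U] by blast
  obtain z where z: "z \<in> ball x d"
    "f (x + h *\<^sub>R v + h *\<^sub>R u) - f (x + h *\<^sub>R v) - f (x + h *\<^sub>R u) + f x = h * fv z (h *\<^sub>R u)"
    using second_difference_mean_value[where f = f and f' = f' and f'' = "\<lambda>y w. h * fv y w", OF convex_ball pts(1,3,2,5) fB V] by blast
  have "fu y (h *\<^sub>R v) = h * fu y v" "fv z (h *\<^sub>R u) = h * fv z u"
    using linear_cmul[OF has_derivative_linear[OF fu]] linear_cmul[OF has_derivative_linear[OF fv]] d' y z
    by auto
  then have "fu y v = fv z u" using y z h by (simp add: algebra_simps)
  moreover have "dist (fu y v) (fu x v) < e" "dist (fv z u) (fv x u) < e" using d' y(1) z(1) by blast+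
  ultimately show False using e_def unfolding dist_real_def by argo
qed

lemma mixed_derivatives_commute:
  fixes f :: "'a::real_normed_vector \<Rightarrow> 'b::euclidean_space"
  assumes S: "open S" "x \<in> S"
    and f: "\<And>y. y \<in> S \<Longrightarrow> (f has_derivative f' y) (at y)"
    and fu: "\<And>y. y \<in> S \<Longrightarrow> ((\<lambda>y. f' y u) has_derivative fu y) (at y)"
    and fv: "\<And>y. y \<in> S \<Longrightarrow> ((\<lambda>y. f' y v) has_derivative fv y) (at y)"
    and cont: "continuous_on S (\<lambda>y. fu y v)" "continuous_on S (\<lambda>y. fv y u)"
  shows "fu x v = fv x u"
proof (rule euclidean_eqI)
  fix b :: 'b
  show "fu x v \<bullet> b = fv x u \<bullet> b"
    by (rule mixed_derivatives_commute_real[OF S, where f = "\<lambda>y. f y \<bullet> b" and f' = "\<lambda>y h. f' y h \<bullet> b"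
          and fu = "\<lambda>y h. fu y h \<bullet> b" and fv = "\<lambda>y h. fv y h \<bullet> b"])
       (auto intro!: has_derivative_inner_left f fu fv continuous_intros cont)
qed

section \<open>Change of variables for nonnegative integrals\<close>

text \<open>Change of variables theorems compare absolutely integrable functions, whereas measures
  need possibly infinite integrals. For a nonnegative measurable function the nonnegative integral
  is the usual one, or infinite exactly when the function fails to be integrable, so the equivalence
  \<open>iff\<close> decides both cases.\<close>

lemma nn_integral_eq_if_absolutely_integrable_iff:
  fixes f :: "'a::euclidean_space \<Rightarrow> real" and g :: "'b::euclidean_space \<Rightarrow> real"
  assumes iff: "\<And>b. f absolutely_integrable_on S \<and> integral S f = b \<longleftrightarrow> g absolutely_integrable_on T \<and> integral T g = b"
    and f: "(\<lambda>x. indicator S x * f x) \<in> borel_measurable lebesgue" "\<And>x. x \<in> S \<Longrightarrow> 0 \<le> f x"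
    and g: "(\<lambda>x. indicator T x * g x) \<in> borel_measurable lebesgue" "\<And>x. x \<in> T \<Longrightarrow> 0 \<le> g x"
  shows "(\<integral>\<^sup>+x\<in>S. ennreal (f x) \<partial>lborel) = (\<integral>\<^sup>+x\<in>T. ennreal (g x) \<partial>lborel)"
proof -
  have key: "if h absolutely_integrable_on W then
       (\<integral>\<^sup>+x\<in>W. ennreal (h x) \<partial>lborel) = ennreal (integral W h)
     else (\<integral>\<^sup>+x\<in>W. ennreal (h x) \<partial>lborel) = \<infinity>"
    if m: "(\<lambda>x. indicator W x * h x) \<in> borel_measurable lebesgue" and h0: "\<And>x. x \<in> W \<Longrightarrow> 0 \<le> h x"
    for h :: "'c::euclidean_space \<Rightarrow> real" and W
  proof -
    have eq: "(\<integral>\<^sup>+x\<in>W. ennreal (h x) \<partial>lborel) = (\<integral>\<^sup>+x. ennreal (indicator W x * h x) \<partial>lebesgue)"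
      unfolding nn_integral_completion by (intro nn_integral_cong) (auto simp: indicator_def)
    have nn: "0 \<le> indicator W x * h x" for x using h0 by (auto simp: indicator_def)
    show ?thesis
    proof (cases "h absolutely_integrable_on W")
      case True
      have "(\<integral>\<^sup>+x. ennreal (indicator W x * h x) \<partial>lebesgue) = ennreal (\<integral>x. indicator W x * h x \<partial>lebesgue)"
        using True nn by (intro nn_integral_eq_integral) (auto simp: set_integrable_def)
      also have "(\<integral>x. indicator W x * h x \<partial>lebesgue) = integral W h"
        using set_lebesgue_integral_eq_integral(2)[OF True] by (simp add: set_lebesgue_integral_def)
      finally show ?thesis using True eq by simp
    next
      case False
      have "\<not> integrable lebesgue (\<lambda>x. indicator W x * h x)" using False by (simp add: set_integrable_def)
      then have "\<not> (\<integral>\<^sup>+x. ennreal (indicator W x * h x) \<partial>lebesgue) < \<infinity>"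
        using m nn by (auto simp: integrable_iff_bounded)
      then show ?thesis using False eq by (auto simp: less_top[symmetric])
    qed
  qed
  show ?thesis using key[OF f] key[OF g] iff[of "integral S f"] iff[of "integral T g"]
    by (auto split: if_splits)
qed

text \<open>The underlying theorem takes vector values; scalar functions pass through it as
  functions into \<open>real^1\<close>.\<close>

lemma nn_integral_change_of_variables_vec:
  fixes f :: "real^'n::{finite,wellorder} \<Rightarrow> real"
  assumes S: "S \<in> sets lebesgue" and d: "\<And>x. x \<in> S \<Longrightarrow> (g has_derivative g' x) (at x within S)"
    and inj: "inj_on g S"
    and m: "(\<lambda>x. indicator S x * (\<bar>det (matrix (g' x))\<bar> * f (g x))) \<in> borel_measurable lebesgue"
           "(\<lambda>y. indicator (g ` S) y * f y) \<in> borel_measurable lebesgue"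
    and f0: "\<And>y. y \<in> g ` S \<Longrightarrow> 0 \<le> f y"
  shows "(\<integral>\<^sup>+x\<in>S. ennreal (\<bar>det (matrix (g' x))\<bar> * f (g x)) \<partial>lborel) = (\<integral>\<^sup>+y\<in>g ` S. ennreal (f y) \<partial>lborel)"
proof (rule nn_integral_eq_if_absolutely_integrable_iff[OF _ m(1) _ m(2) f0])
  fix b
  have "(\<lambda>x. \<bar>det (matrix (g' x))\<bar> *\<^sub>R vec (f (g x)) :: real^1) absolutely_integrable_on S \<and>
           integral S (\<lambda>x. \<bar>det (matrix (g' x))\<bar> *\<^sub>R vec (f (g x))) = (vec b :: real^1)
     \<longleftrightarrow> (\<lambda>y. vec (f y) :: real^1) absolutely_integrable_on (g ` S) \<and> integral (g ` S) (\<lambda>y. vec (f y)) = (vec b :: real^1)"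
    by (rule has_absolute_integral_change_of_variables[OF S d inj])
  then show "(\<lambda>x. \<bar>det (matrix (g' x))\<bar> * f (g x)) absolutely_integrable_on S \<and>
           integral S (\<lambda>x. \<bar>det (matrix (g' x))\<bar> * f (g x)) = b
     \<longleftrightarrow> f absolutely_integrable_on (g ` S) \<and> integral (g ` S) f = b"
    by (simp add: absolutely_integrable_on_1_iff integral_on_1_eq)
qed (use f0 in auto)

lemma nn_integral_change_of_variables_real:
  fixes f g :: "real \<Rightarrow> real"
  assumes S: "S \<in> sets lebesgue" and d: "\<And>x. x \<in> S \<Longrightarrow> (g has_field_derivative g' x) (at x within S)"
    and inj: "inj_on g S"
    and m: "(\<lambda>x. indicator S x * (\<bar>g' x\<bar> * f (g x))) \<in> borel_measurable lebesgue"
           "(\<lambda>y. indicator (g ` S) y * f y) \<in> borel_measurable lebesgue"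
    and f0: "\<And>y. y \<in> g ` S \<Longrightarrow> 0 \<le> f y"
  shows "(\<integral>\<^sup>+x\<in>S. ennreal (\<bar>g' x\<bar> * f (g x)) \<partial>lborel) = (\<integral>\<^sup>+y\<in>g ` S. ennreal (f y) \<partial>lborel)"
  by (rule nn_integral_eq_if_absolutely_integrable_iff[OF _ m(1) _ m(2) f0])
     (use has_absolute_integral_change_of_variables_1'[OF S d inj] f0 in auto)

subsection \<open>The divergence theorem on a rectangle\<close>

lemma vec2_alt: "(vector [x, y] :: real^2) = x *\<^sub>R axis 1 1 + y *\<^sub>R axis 2 1"
  by (simp add: vec_eq_iff forall_2 axis_def)

lemma measurable_vec2: "(\<lambda>(x, y). vector [x, y] :: real^2) \<in> borel_measurable (lborel \<Otimes>\<^sub>M lborel)"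
proof -
  have "continuous_on UNIV (\<lambda>p::real \<times> real. vector [fst p, snd p] :: real^2)"
    unfolding vec2_alt by (intro continuous_intros)
  then show ?thesis by (simp add: borel_measurable_continuous_onI lborel_prod split_def)
qed

text \<open>Carries Fubini's theorem from pairs of reals to \<open>real^2\<close>. Lebesgue measure
  is determined by its values on open boxes, and those are products of lengths.\<close>

lemma lborel_eq_distr_vec2: "lborel = distr (lborel \<Otimes>\<^sub>M lborel) borel (\<lambda>(x, y). vector [x, y] :: real^2)"
proof (rule lborel_eqI)
  fix l u :: "real^2"
  assume lu: "\<And>b. b \<in> Basis \<Longrightarrow> l \<bullet> b \<le> u \<bullet> b"
  have l: "l $ 1 \<le> u $ 1" "l $ 2 \<le> u $ 2"
    using lu[of "axis 1 1"] lu[of "axis 2 1"] by (auto simp: inner_axis)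
  have "emeasure (distr (lborel \<Otimes>\<^sub>M lborel) borel (\<lambda>(x, y). vector [x, y] :: real^2)) (box l u)
      = emeasure (lborel \<Otimes>\<^sub>M lborel) ({l$1<..<u$1} \<times> {l$2<..<u$2})"
    using measurable_vec2
    by (subst emeasure_distr) (auto intro!: arg_cong[where f = "emeasure _"] simp: mem_box_cart space_pair_measure forall_2)
  also have "\<dots> = ennreal ((u$1 - l$1) * (u$2 - l$2))"
    using l by (simp add: lborel.emeasure_pair_measure_Times ennreal_mult')
  also have "(u$1 - l$1) * (u$2 - l$2) = (\<Prod>b\<in>Basis. (u - l) \<bullet> b)"
  proof -
    have B: "(Basis :: (real^2) set) = {axis 1 1, axis 2 1}"
      by (auto simp: Basis_vec_def UNIV_2)
    have "axis 1 1 \<noteq> (axis 2 1 :: real^2)" by (simp add: axis_eq_axis)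
    then show ?thesis by (simp add: B inner_axis)
  qed
  finally show "emeasure (distr (lborel \<Otimes>\<^sub>M lborel) borel (\<lambda>(x, y). vector [x, y] :: real^2)) (box l u)
      = ennreal (\<Prod>b\<in>Basis. (u - l) \<bullet> b)" .
qed simp

lemma
  fixes f :: "real^2 \<Rightarrow> real"
  assumes f: "integrable lborel f"
  shows integral_vec2_fst: "(\<integral>x. f x \<partial>lborel) = (\<integral>x. (\<integral>y. f (vector [x, y]) \<partial>lborel) \<partial>lborel)"
    and integral_vec2_snd: "(\<integral>x. f x \<partial>lborel) = (\<integral>y. (\<integral>x. f (vector [x, y]) \<partial>lborel) \<partial>lborel)"
proof -
  let ?v = "\<lambda>(x, y). vector [x, y] :: real^2"
  have fm: "f \<in> borel_measurable borel" using f by (auto dest: borel_measurable_integrable)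
  have i: "integrable (lborel \<Otimes>\<^sub>M lborel) (\<lambda>p. f (?v p))"
    using f integrable_distr_eq[OF measurable_vec2 fm] lborel_eq_distr_vec2 by metis
  have e: "(\<integral>x. f x \<partial>lborel) = (\<integral>p. f (?v p) \<partial>(lborel \<Otimes>\<^sub>M lborel))"
    using integral_distr[OF measurable_vec2 fm] lborel_eq_distr_vec2 by metis
  have i': "integrable (lborel \<Otimes>\<^sub>M lborel) (\<lambda>(x, y). f (vector [x, y]))"
    using i by (simp add: split_def)
  show "(\<integral>x. f x \<partial>lborel) = (\<integral>x. (\<integral>y. f (vector [x, y]) \<partial>lborel) \<partial>lborel)"
    using lborel_pair.integral_fst[OF i'] e by (simp add: split_def)
  show "(\<integral>x. f x \<partial>lborel) = (\<integral>y. (\<integral>x. f (vector [x, y]) \<partial>lborel) \<partial>lborel)"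
    using lborel_pair.integral_snd[OF i'] e by (simp add: split_def)
qed

text \<open>Fubini and the fundamental theorem of calculus, with \<open>G1\<close> integrated over
  horizontal and \<open>G2\<close> over vertical segments. The bottom edge is the only one that
  contributes, as it is the one that may lie on the boundary of the half-plane. For the same reason
  the derivatives are taken within the closed box.\<close>

lemma divergence_theorem_box:
  fixes G1 G2 :: "real^2 \<Rightarrow> real" and a b :: "real^2"
  assumes ab: "a $ 1 \<le> b $ 1" "a $ 2 \<le> b $ 2"
    and d1: "\<And>x. x \<in> cbox a b \<Longrightarrow> (G1 has_derivative G1' x) (at x within cbox a b)"
    and d2: "\<And>x. x \<in> cbox a b \<Longrightarrow> (G2 has_derivative G2' x) (at x within cbox a b)"
    and c1: "continuous_on (cbox a b) (\<lambda>x. G1' x (axis 1 1))"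
    and c2: "continuous_on (cbox a b) (\<lambda>x. G2' x (axis 2 1))"
    and z1: "\<And>x. x \<in> cbox a b \<Longrightarrow> x $ 1 = a $ 1 \<or> x $ 1 = b $ 1 \<Longrightarrow> G1 x = 0"
    and z2: "\<And>x. x \<in> cbox a b \<Longrightarrow> x $ 2 = b $ 2 \<Longrightarrow> G2 x = 0"
  shows "(\<integral>x. indicator (cbox a b) x * (G1' x (axis 1 1) + G2' x (axis 2 1)) \<partial>lborel)
       = - (\<integral>s. indicator {a$1..b$1} s * G2 (vector [s, a$2]) \<partial>lborel)"
proof -
  let ?B = "cbox a b"
  have mem: "(vector [x, y] \<in> ?B) \<longleftrightarrow> x \<in> {a$1..b$1} \<and> y \<in> {a$2..b$2}" for x y
    by (auto simp: mem_box_cart forall_2)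
  have ind: "indicator ?B (vector [x, y]) = (indicator {a$1..b$1} x * indicator {a$2..b$2} y :: real)" for x y
    using mem[of x y] by (auto simp: indicator_def)
  have i1: "integrable lborel (\<lambda>x. indicator ?B x * G1' x (axis 1 1))"
    using borel_integrable_compact[OF compact_cbox c1] by (simp add: if_distrib indicator_def cong: if_cong)
  have i2: "integrable lborel (\<lambda>x. indicator ?B x * G2' x (axis 2 1))"
    using borel_integrable_compact[OF compact_cbox c2] by (simp add: if_distrib indicator_def cong: if_cong)
  have "(\<integral>x. indicator ?B x * G1' x (axis 1 1) \<partial>lborel)
      = (\<integral>y. (\<integral>x. indicator ?B (vector [x, y]) * G1' (vector [x, y]) (axis 1 1) \<partial>lborel) \<partial>lborel)"
    by (rule integral_vec2_snd[OF i1])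
  also have "\<dots> = (\<integral>y. 0 \<partial>(lborel :: real measure))"
  proof (rule Bochner_Integration.integral_cong[OF refl])
    fix y :: real
    show "(\<integral>x. indicator ?B (vector [x, y]) * G1' (vector [x, y]) (axis 1 1) \<partial>lborel) = 0"
    proof (cases "y \<in> {a$2..b$2}")
      case True
      have "(\<integral>x. indicator {a$1..b$1} x *\<^sub>R G1' (vector [x, y]) (axis 1 1) \<partial>lborel)
          = G1 (vector [b$1, y]) - G1 (vector [a$1, y])"
      proof (rule integral_FTC_Icc[OF ab(1)])
        fix x assume x: "a$1 \<le> x" "x \<le> b$1"
        have v: "vector [x, y] \<in> ?B" using x True mem by auto
        have "((\<lambda>x. G1 (vector [x, y])) has_derivative (\<lambda>h. G1' (vector [x, y]) (h *\<^sub>R axis 1 1))) (at x within {a$1..b$1})"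
        proof (rule has_derivative_in_compose2[where t = ?B])
          show "(\<lambda>x. vector [x, y]) ` {a$1..b$1} \<subseteq> ?B" using True mem by auto
          show "((\<lambda>x. vector [x, y] :: real^2) has_derivative (\<lambda>h. h *\<^sub>R axis 1 1)) (at x within {a$1..b$1})"
            unfolding vec2_alt by (auto intro!: derivative_eq_intros)
        qed (use d1 x in auto)
        then show "((\<lambda>x. G1 (vector [x, y])) has_vector_derivative G1' (vector [x, y]) (axis 1 1)) (at x within {a$1..b$1})"
          unfolding has_vector_derivative_def
          using linear_cmul[OF has_derivative_linear[OF d1[OF v]]] by simp
      next
        show "continuous_on {a$1..b$1} (\<lambda>x. G1' (vector [x, y]) (axis 1 1))"
          by (rule continuous_on_compose2[OF c1])
             (use True mem in \<open>auto simp: vec2_alt intro!: continuous_intros\<close>)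
      qed
      also have "\<dots> = 0" using z1 mem ab True by simp
      finally show ?thesis using True by (simp add: ind)
    qed (simp add: ind)
  qed
  finally have I1: "(\<integral>x. indicator ?B x * G1' x (axis 1 1) \<partial>lborel) = 0" by simp
  have "(\<integral>x. indicator ?B x * G2' x (axis 2 1) \<partial>lborel)
      = (\<integral>x. (\<integral>y. indicator ?B (vector [x, y]) * G2' (vector [x, y]) (axis 2 1) \<partial>lborel) \<partial>lborel)"
    by (rule integral_vec2_fst[OF i2])
  also have "\<dots> = (\<integral>s. - (indicator {a$1..b$1} s * G2 (vector [s, a$2])) \<partial>lborel)"
  proof (rule Bochner_Integration.integral_cong[OF refl])
    fix x :: real
    show "(\<integral>y. indicator ?B (vector [x, y]) * G2' (vector [x, y]) (axis 2 1) \<partial>lborel)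
        = - (indicator {a$1..b$1} x * G2 (vector [x, a$2]))"
    proof (cases "x \<in> {a$1..b$1}")
      case True
      have "(\<integral>y. indicator {a$2..b$2} y *\<^sub>R G2' (vector [x, y]) (axis 2 1) \<partial>lborel)
          = G2 (vector [x, b$2]) - G2 (vector [x, a$2])"
      proof (rule integral_FTC_Icc[OF ab(2)])
        fix y assume y: "a$2 \<le> y" "y \<le> b$2"
        have v: "vector [x, y] \<in> ?B" using y True mem by auto
        have "((\<lambda>y. G2 (vector [x, y])) has_derivative (\<lambda>h. G2' (vector [x, y]) (h *\<^sub>R axis 2 1))) (at y within {a$2..b$2})"
        proof (rule has_derivative_in_compose2[where t = ?B])
          show "(\<lambda>y. vector [x, y]) ` {a$2..b$2} \<subseteq> ?B" using True mem by auto
          show "((\<lambda>y. vector [x, y] :: real^2) has_derivative (\<lambda>h. h *\<^sub>R axis 2 1)) (at y within {a$2..b$2})"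
            unfolding vec2_alt by (auto intro!: derivative_eq_intros)
        qed (use d2 y in auto)
        then show "((\<lambda>y. G2 (vector [x, y])) has_vector_derivative G2' (vector [x, y]) (axis 2 1)) (at y within {a$2..b$2})"
          unfolding has_vector_derivative_def
          using linear_cmul[OF has_derivative_linear[OF d2[OF v]]] by simp
      next
        show "continuous_on {a$2..b$2} (\<lambda>y. G2' (vector [x, y]) (axis 2 1))"
          by (rule continuous_on_compose2[OF c2])
             (use True mem in \<open>auto simp: vec2_alt intro!: continuous_intros\<close>)
      qed
      also have "\<dots> = - G2 (vector [x, a$2])" using z2 mem ab True by simp
      finally show ?thesis using True by (simp add: ind)
    qed (simp add: ind)
  qed
  finally have I2: "(\<integral>x. indicator ?B x * G2' x (axis 2 1) \<partial>lborel)
      = - (\<integral>s. indicator {a$1..b$1} s * G2 (vector [s, a$2]) \<partial>lborel)" by simp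
  show ?thesis
    unfolding distrib_left using I1 I2 Bochner_Integration.integral_add[OF i1 i2] by simp
qed

subsection \<open>Differentials in local coordinates\<close>

lemma linear_expand_vec2:
  fixes L :: "real^2 \<Rightarrow> 'b::real_vector"
  assumes "linear L"
  shows "L w = w $ 1 *\<^sub>R L (axis 1 1) + w $ 2 *\<^sub>R L (axis 2 1)"
proof -
  have "w = w $ 1 *\<^sub>R axis 1 1 + w $ 2 *\<^sub>R axis 2 1" by (simp add: vec_eq_iff forall_2 axis_def)
  then have "L w = L (w $ 1 *\<^sub>R axis 1 1 + w $ 2 *\<^sub>R axis 2 1)" by simp
  then show ?thesis by (simp only: linear_add[OF assms] linear_cmul[OF assms])
qed

text \<open>Smoothness on \<open>D\<close> means local smooth extendability. Near a point of
  \<open>D\<close> the map \<open>f\<close> is the restriction of its extension, so the derivative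
  of the extension is one of \<open>f\<close> within \<open>D\<close>, whatever the shape of
  \<open>D\<close>.\<close>

lemma smooth_on_extension_derivative:
  assumes "smooth_on D f" "x \<in> D"
  shows "\<exists>S g. open S \<and> x \<in> S \<and> (\<forall>k. times_cont_diff k g S) \<and> (\<forall>y\<in>S \<inter> D. g y = f y) \<and>
    (\<forall>y\<in>S. (g has_derivative frechet_derivative g (at y)) (at y)) \<and>
    (\<forall>y\<in>S \<inter> D. (f has_derivative frechet_derivative g (at y)) (at y within D))"
proof -
  have "\<exists>S g. open S \<and> x \<in> S \<and> (\<forall>k. times_cont_diff k g S) \<and> (\<forall>y\<in>S \<inter> D. g y = f y)"
    using assms unfolding smooth_on_def by (rule bspec)
  then obtain S g where S': "open S" "x \<in> S" "\<forall>k. times_cont_diff k g S" "\<forall>y\<in>S \<inter> D. g y = f y"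
    by (elim exE conjE)
  then have S: "open S" "x \<in> S" "\<And>k. times_cont_diff k g S" "\<And>y. y \<in> S \<inter> D \<Longrightarrow> g y = f y"
    by simp_all
  have gd: "(g has_derivative frechet_derivative g (at y)) (at y)" if "y \<in> S" for y
    using S(3)[of "Suc 0"] that frechet_derivative_works by auto
  have "(f has_derivative frechet_derivative g (at y)) (at y within D)" if y: "y \<in> S \<inter> D" for y
  proof -
    obtain e where e: "e > 0" "ball y e \<subseteq> S" using S(1) y openE by blast
    show ?thesis
      by (rule has_derivative_transform_within[OF has_derivative_at_withinI[OF gd] e(1)])
         (use y e S(4) in \<open>auto simp: dist_commute subset_iff\<close>)
  qed
  with S' gd show ?thesis by (intro exI[of _ S] exI[of _ g]) simp
qed

lemma smooth_on_has_derivative: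
  assumes "smooth_on D f" "x \<in> D" obtains L where "(f has_derivative L) (at x within D)"
proof -
  obtain S g where S: "open S" "x \<in> S" "\<forall>k. times_cont_diff k g S" "\<forall>y\<in>S \<inter> D. g y = f y"
    "\<forall>y\<in>S. (g has_derivative frechet_derivative g (at y)) (at y)"
    "\<forall>y\<in>S \<inter> D. (f has_derivative frechet_derivative g (at y)) (at y within D)"
    using smooth_on_extension_derivative[OF assms] by (elim exE conjE)
  show ?thesis by (rule that[OF S(6)[rule_format]]) (use S(2) assms(2) in simp)
qed

lemma smooth_on_imp_continuous_on:
  assumes "smooth_on D f" shows "continuous_on D f"
  unfolding continuous_on_eq_continuous_within
proof
  fix x assume "x \<in> D"
  then obtain L where "(f has_derivative L) (at x within D)" by (rule smooth_on_has_derivative[OF assms])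
  then show "continuous (at x within D) f" by (rule has_derivative_continuous)
qed

text \<open>\<open>frechet_derivative\<close> chooses some derivative within \<open>D\<close>, which
  for a thin \<open>D\<close> need not be that of the extension. Uniqueness forces the two to agree,
  and a directional derivative of the extension then extends that of \<open>f\<close>.\<close>

lemma smooth_on_frechet_derivative:
  assumes f: "smooth_on D f"
    and uniq: "\<And>x L L'. x \<in> D \<Longrightarrow> (f has_derivative L) (at x within D) \<Longrightarrow>
                 (f has_derivative L') (at x within D) \<Longrightarrow> L = L'"
  shows "smooth_on D (\<lambda>x. frechet_derivative f (at x within D) v)"
  unfolding smooth_on_def
proof
  fix x assume "x \<in> D"
  from smooth_on_extension_derivative[OF f this] obtain S g where S: "open S" "x \<in> S" "\<forall>k. times_cont_diff k g S" "\<forall>y\<in>S \<inter> D. g y = f y"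
    "\<forall>y\<in>S. (g has_derivative frechet_derivative g (at y)) (at y)"
    "\<forall>y\<in>S \<inter> D. (f has_derivative frechet_derivative g (at y)) (at y within D)"
    by (elim exE conjE)
  have eq: "frechet_derivative g (at y) v = frechet_derivative f (at y within D) v" if y: "y \<in> S \<inter> D" for y
  proof -
    have "(f has_derivative frechet_derivative f (at y within D)) (at y within D)"
      using differentiableI[OF S(6)[rule_format, OF y]] by (simp add: frechet_derivative_works)
    then show ?thesis using uniq[OF _ S(6)[rule_format, OF y]] y by simp
  qed
  have "times_cont_diff k (\<lambda>y. frechet_derivative g (at y) v) S" for k
    using S(3)[rule_format, of "Suc k"] by simp
  then show "\<exists>S g. open S \<and> x \<in> S \<and> (\<forall>k. times_cont_diff k g S) \<and>
      (\<forall>y\<in>S \<inter> D. g y = frechet_derivative f (at y within D) v)"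
    using S(1,2) eq by (intro exI[of _ S] exI[of _ "\<lambda>y. frechet_derivative g (at y) v"]) blast
qed

definition coord_differentiable ::
    "'a set \<Rightarrow> ('a \<Rightarrow> real^2) \<Rightarrow> ('a \<Rightarrow> 'b::real_normed_vector) \<Rightarrow> 'a \<Rightarrow> bool" where
  "coord_differentiable U c f p \<longleftrightarrow> (f \<circ> inv_into U c) differentiable (at (c p) within c ` U)"

lemma coord_differential_works:
  "coord_differentiable U c f p \<Longrightarrow>
    ((f \<circ> inv_into U c) has_derivative coord_differential U c f p) (at (c p) within c ` U)"
  unfolding coord_differentiable_def coord_differential_def frechet_derivative_works by (simp add: eta_contract_eq)

lemma linear_coord_differential: "coord_differentiable U c f p \<Longrightarrow> linear (coord_differential U c f p)"
  by (rule has_derivative_linear[OF coord_differential_works])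

section \<open>Charts and coordinate changes on a surface with boundary\<close>

locale surface_atlas =
  fixes M :: "'a::{t2_space,second_countable_topology} set" and A :: "'a chart set"
  assumes surface: "surface_with_boundary M A"
begin

abbreviation LC :: "'a set \<Rightarrow> ('a \<Rightarrow> real^2) \<Rightarrow> bool" where
  "LC \<equiv> local_coordinates M A"

lemma chart_open: "(U, \<phi>) \<in> A \<Longrightarrow> openin (top_of_set M) U"
  and chart_image_open: "(U, \<phi>) \<in> A \<Longrightarrow> openin (top_of_set half_plane) (\<phi> ` U)"
  and chart_homeomorphism: "(U, \<phi>) \<in> A \<Longrightarrow> homeomorphism U (\<phi> ` U) \<phi> (inv_into U \<phi>)"
  and chart_cover: "(\<Union>(U, \<phi>)\<in>A. U) = M"
  and chart_transition:
    "(U, \<phi>) \<in> A \<Longrightarrow> (W, \<psi>) \<in> A \<Longrightarrow> smooth_on (\<phi> ` (U \<inter> W)) (\<psi> \<circ> inv_into U \<phi>)"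
  using surface unfolding surface_with_boundary_def by blast+

lemma chart_local_coordinates:
  assumes "(U, \<phi>) \<in> A" shows "LC U \<phi>"
  unfolding local_coordinates_def
proof (intro conjI ballI)
  fix x assume "x \<in> A"
  moreover obtain W \<psi> where "x = (W, \<psi>)" by (cases x)
  ultimately have "(W, \<psi>) \<in> A" "x = (W, \<psi>)" by auto
  then show "case x of (W, \<psi>) \<Rightarrow> smooth_on (\<psi> ` (U \<inter> W)) (\<phi> \<circ> inv_into W \<psi>) \<and>
      smooth_on (\<phi> ` (U \<inter> W)) (\<psi> \<circ> inv_into U \<phi>)"
    using chart_transition[OF assms, of W \<psi>] chart_transition[OF _ assms, of W \<psi>] by (simp add: Int_commute)
qed (use assms chart_open chart_homeomorphism in auto)

lemma chart_at:
  assumes "p \<in> M" obtains U \<phi> where "(U, \<phi>) \<in> A" "p \<in> U"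
  using assms chart_cover by blast

lemma
  assumes "LC U c"
  shows LC_open: "openin (top_of_set M) U" and LC_subset: "U \<subseteq> M"
    and LC_homeomorphism: "homeomorphism U (c ` U) c (inv_into U c)"
    and LC_inj: "inj_on c U" and LC_continuous: "continuous_on U c"
    and LC_continuous_inv: "continuous_on (c ` U) (inv_into U c)"
proof -
  show o: "openin (top_of_set M) U" and h: "homeomorphism U (c ` U) c (inv_into U c)"
    using assms unfolding local_coordinates_def by blast+
  show "U \<subseteq> M" using o by (rule openin_imp_subset)
  show "inj_on c U" using h by (auto simp: homeomorphism_def intro: inj_on_inverseI)
  show "continuous_on U c" "continuous_on (c ` U) (inv_into U c)" using h by (auto simp: homeomorphism_def)
qed

lemma LC_inv: "LC U c \<Longrightarrow> p \<in> U \<Longrightarrow> inv_into U c (c p) = p"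
  by (simp add: LC_inj)

lemma LC_image_open:
  assumes "LC U c" "openin (top_of_set M) X" "X \<subseteq> U"
  shows "openin (top_of_set (c ` U)) (c ` X)"
proof (rule homeomorphism_imp_open_map[OF LC_homeomorphism[OF assms(1)]])
  show "openin (top_of_set U) X"
    using assms(2,3) LC_subset[OF assms(1)] by (rule openin_subset_trans)
qed

lemma chart_subset_image_open:
  assumes "(U, \<phi>) \<in> A" "openin (top_of_set M) X" "X \<subseteq> U"
  shows "openin (top_of_set half_plane) (\<phi> ` X)"
  using LC_image_open[OF chart_local_coordinates[OF assms(1)] assms(2,3)] chart_image_open[OF assms(1)]
  by (rule openin_trans)

text \<open>The image of \<open>X\<close> is relatively open in the image of \<open>U\<close>, so
  derivatives may be computed on any smaller open piece and moved back.\<close>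

lemma LC_at_within:
  assumes "LC U c" "openin (top_of_set M) X" "X \<subseteq> U" "p \<in> X"
  shows "at (c p) within c ` X = at (c p) within c ` U"
proof -
  obtain T where T: "open T" "c ` X = c ` U \<inter> T"
    using LC_image_open[OF assms(1-3)] by (auto simp: openin_open)
  show ?thesis by (rule at_within_nhd[of _ T]) (use T assms(4) in auto)
qed

lemma transition_smooth:
  assumes "LC U c" "(W, \<psi>) \<in> A"
  shows "smooth_on (\<psi> ` (U \<inter> W)) (c \<circ> inv_into W \<psi>)" "smooth_on (c ` (U \<inter> W)) (\<psi> \<circ> inv_into U c)"
  using assms unfolding local_coordinates_def by blast+

text \<open>The image of \<open>U\<close> under \<open>c\<close> can be too irregular to test
  uniqueness there. Composition with a transition from a chart moves the question to the half-plane;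
  the derivative \<open>J\<close> of the transition is surjective, and
  \<open>L \<circ> J = L' \<circ> J\<close> then gives \<open>L = L'\<close>.\<close>

lemma derivative_unique_local_coordinates:
  assumes c: "LC U c" and p: "p \<in> U"
    and h: "(h has_derivative L) (at (c p) within c ` U)" "(h has_derivative L') (at (c p) within c ` U)"
  shows "L = L'"
proof -
  have "p \<in> M" using LC_subset[OF c] p by blast
  then obtain W \<psi> where W: "(W, \<psi>) \<in> A" "p \<in> W" by (rule chart_at)
  note \<psi> = chart_local_coordinates[OF W(1)]
  define X where "X = U \<inter> W"
  have X: "openin (top_of_set M) X" "p \<in> X" "X \<subseteq> U" "X \<subseteq> W"
    using LC_open[OF c] LC_open[OF \<psi>] p W by (auto simp: X_def)
  have im: "(c \<circ> inv_into W \<psi>) ` \<psi> ` X = c ` X"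
    unfolding image_comp by (rule image_cong) (use LC_inv[OF \<psi>] X in auto)
  obtain J where J: "((c \<circ> inv_into W \<psi>) has_derivative J) (at (\<psi> p) within \<psi> ` X)"
    by (rule smooth_on_has_derivative[OF transition_smooth(1)[OF c W(1), folded X_def] imageI[OF X(2)]])
  obtain K where K: "((\<psi> \<circ> inv_into U c) has_derivative K) (at (c p) within c ` X)"
    by (rule smooth_on_has_derivative[OF transition_smooth(2)[OF c W(1), folded X_def] imageI[OF X(2)]])
  have cp: "(c \<circ> inv_into W \<psi>) (\<psi> p) = c p" using LC_inv[OF \<psi>] X by auto
  note uniq = derivative_unique_within_half_plane[OF chart_subset_image_open[OF W(1) X(1,4)] imageI[OF X(2)]]
  have comp: "(g \<circ> (c \<circ> inv_into W \<psi>) has_derivative B \<circ> J) (at (\<psi> p) within \<psi> ` X)"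
    if "(g has_derivative B) (at (c p) within c ` X)" for g :: "real^2 \<Rightarrow> 'z::real_normed_vector" and B
    by (rule diff_chain_within[OF J]) (use that im cp in simp)
  \<comment> \<open>Both sides are derivatives of a composition that is the identity on the chart
    image, where derivatives are unique.\<close>
  have "K \<circ> J = id"
  proof (rule uniq[OF comp[OF K]])
    have "x = (\<psi> \<circ> inv_into U c \<circ> (c \<circ> inv_into W \<psi>)) x" if "x \<in> \<psi> ` X" for x
      using that X(3,4) by (auto simp: LC_inv[OF \<psi>] LC_inv[OF c] subset_iff)
    then show "(\<psi> \<circ> inv_into U c \<circ> (c \<circ> inv_into W \<psi>) has_derivative id) (at (\<psi> p) within \<psi> ` X)"
      by (intro has_derivative_transform[OF imageI[OF X(2)] _ has_derivative_id]) auto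
  qed
  then have "inj J" by (intro inj_on_imageI2[of K J UNIV]) simp
  then have surjJ: "surj J"
    using linear_injective_imp_surjective has_derivative_linear[OF J] by blast
  have h': "(h has_derivative L) (at (c p) within c ` X)" "(h has_derivative L') (at (c p) within c ` X)"
    using h LC_at_within[OF c X(1,3,2)] by simp_all
  have "L \<circ> J = L' \<circ> J" by (rule uniq[OF comp[OF h'(1)] comp[OF h'(2)]])
  show "L = L'"
  proof
    fix x
    obtain y where "x = J y" using surjJ by (rule surjE)
    then show "L x = L' x" using \<open>L \<circ> J = L' \<circ> J\<close> by (metis comp_apply)
  qed
qed

lemma coord_differential_eqI:
  assumes "LC U c" "p \<in> U" "((f \<circ> inv_into U c) has_derivative L) (at (c p) within c ` U)"
  shows "coord_differentiable U c f p" "coord_differential U c f p = L"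
proof -
  show d: "coord_differentiable U c f p"
    using assms(3) unfolding coord_differentiable_def by (rule differentiableI)
  show "coord_differential U c f p = L"
    using derivative_unique_local_coordinates[OF assms(1,2) coord_differential_works[OF d] assms(3)] .
qed

lemma smooth_on_coord_differential:
  assumes c: "LC U c" and X: "openin (top_of_set M) X" "X \<subseteq> U"
    and f: "smooth_on (c ` X) (f \<circ> inv_into U c)"
  shows "\<And>p. p \<in> X \<Longrightarrow> coord_differentiable U c f p"
    and "smooth_on (c ` X) ((\<lambda>p. coord_differential U c f p w) \<circ> inv_into U c)"
    and "continuous_on X (\<lambda>p. coord_differential U c f p w)"
proof -
  show d: "coord_differentiable U c f p" if pX: "p \<in> X" for p
  proof -
    obtain L where "((f \<circ> inv_into U c) has_derivative L) (at (c p) within c ` X)"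
      by (rule smooth_on_has_derivative[OF f imageI[OF pX]])
    then show ?thesis
      using X(2) pX unfolding LC_at_within[OF c X pX] by (intro coord_differential_eqI(1)[OF c]) auto
  qed
  have eq: "frechet_derivative (f \<circ> inv_into U c) (at x within c ` X) w
      = ((\<lambda>p. coord_differential U c f p w) \<circ> inv_into U c) x" if x: "x \<in> c ` X" for x
  proof -
    obtain p where p: "p \<in> X" "x = c p" using x by blast
    then show ?thesis using X(2) LC_at_within[OF c X p(1)]
      by (auto simp: LC_inv[OF c] coord_differential_def subset_iff)
  qed
  have "smooth_on (c ` X) (\<lambda>x. frechet_derivative (f \<circ> inv_into U c) (at x within c ` X) w)"
  proof (rule smooth_on_frechet_derivative[OF f])
    fix x L L' assume "x \<in> c ` X" and L: "((f \<circ> inv_into U c) has_derivative L) (at x within c ` X)"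
        "((f \<circ> inv_into U c) has_derivative L') (at x within c ` X)"
    then obtain p where p: "p \<in> X" "x = c p" by blast
    show "L = L'"
      using L p(1) X(2) unfolding p(2) LC_at_within[OF c X p(1)]
      by (intro derivative_unique_local_coordinates[OF c]) auto
  qed
  then show s: "smooth_on (c ` X) ((\<lambda>p. coord_differential U c f p w) \<circ> inv_into U c)"
    unfolding smooth_on_def using eq by fastforce
  have "continuous_on X (((\<lambda>p. coord_differential U c f p w) \<circ> inv_into U c) \<circ> c)"
    using continuous_on_compose[OF continuous_on_subset[OF LC_continuous[OF c] X(2)] smooth_on_imp_continuous_on[OF s]] .
  then show "continuous_on X (\<lambda>p. coord_differential U c f p w)"
    by (rule continuous_on_eq) (use X(2) in \<open>auto simp: LC_inv[OF c] subset_iff\<close>)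
qed

text \<open>The chain rule for \<open>f\<close> in the coordinates \<open>c\<close>, factored
  through \<open>c'\<close>. The factorization holds only over the overlap \<open>X\<close>, hence
  the restriction of the filter to \<open>X\<close> and back.\<close>

lemma coord_differential_change:
  assumes c: "LC U c" and c': "LC U' c'" and p: "p \<in> U" "p \<in> U'"
    and t: "coord_differentiable U c c' p" and f: "coord_differentiable U' c' f p"
  shows "coord_differentiable U c f p"
    and "coord_differential U c f p w = coord_differential U' c' f p (coord_differential U c c' p w)"
proof -
  define X where "X = U \<inter> U'"
  have X: "openin (top_of_set M) X" "X \<subseteq> U" "X \<subseteq> U'" "p \<in> X"
    using LC_open[OF c] LC_open[OF c'] p by (auto simp: X_def)
  have im: "(c' \<circ> inv_into U c) ` c ` X = c' ` X"
    unfolding image_comp by (rule image_cong) (use LC_inv[OF c] X in auto)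
  have t': "((c' \<circ> inv_into U c) has_derivative coord_differential U c c' p) (at (c p) within c ` X)"
    using coord_differential_works[OF t] LC_at_within[OF c X(1,2,4)] by simp
  have f': "((f \<circ> inv_into U' c') has_derivative coord_differential U' c' f p) (at (c' p) within c' ` X)"
    using coord_differential_works[OF f] LC_at_within[OF c' X(1,3,4)] by simp
  have "(f \<circ> inv_into U' c' \<circ> (c' \<circ> inv_into U c) has_derivative
     coord_differential U' c' f p \<circ> coord_differential U c c' p) (at (c p) within c ` X)"
    by (rule diff_chain_within[OF t']) (use f' im LC_inv[OF c] p in simp)
  then have "(f \<circ> inv_into U c has_derivative
     coord_differential U' c' f p \<circ> coord_differential U c c' p) (at (c p) within c ` X)"
    by (rule has_derivative_transform[OF imageI[OF X(4)], rotated])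
       (use X(2,3) in \<open>auto simp: LC_inv[OF c] LC_inv[OF c'] subset_iff\<close>)
  then have d: "(f \<circ> inv_into U c has_derivative
     coord_differential U' c' f p \<circ> coord_differential U c c' p) (at (c p) within c ` U)"
    using LC_at_within[OF c X(1,2,4)] by simp
  show "coord_differentiable U c f p"
    and "coord_differential U c f p w = coord_differential U' c' f p (coord_differential U c c' p w)"
    using coord_differential_eqI[OF c p(1) d] by simp_all
qed

end

lemma continuous_on_open_Union_openin:
  fixes f :: "'a::t2_space \<Rightarrow> 'b::topological_space"
  assumes o: "\<And>X. X \<in> \<C> \<Longrightarrow> openin (top_of_set (\<Union>\<C>)) X"
    and f: "\<And>X. X \<in> \<C> \<Longrightarrow> continuous_on X f"
  shows "continuous_on (\<Union>\<C>) f"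
  unfolding continuous_on_eq_continuous_within
proof
  fix p assume "p \<in> \<Union>\<C>"
  then obtain X where X: "X \<in> \<C>" "p \<in> X" by (rule UnionE)
  obtain T where T: "open T" "X = \<Union>\<C> \<inter> T" using o[OF X(1)] unfolding openin_open by (elim exE conjE)
  have "at p within X = at p within \<Union>\<C>"
    by (rule at_within_nhd[of _ T]) (use T X(2) in auto)
  then show "continuous (at p within \<Union>\<C>) f"
    using f[OF X(1)] X(2) unfolding continuous_on_eq_continuous_within by (metis (no_types))
qed

context surface_atlas begin

lemma chart_coord_differential:
  assumes c: "LC U c" and W: "(W, \<psi>) \<in> A"
  shows "\<And>p. p \<in> U \<inter> W \<Longrightarrow> coord_differentiable U c \<psi> p"
    and "\<And>p. p \<in> U \<inter> W \<Longrightarrow> coord_differentiable W \<psi> c p"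
    and "continuous_on (U \<inter> W) (\<lambda>p. coord_differential U c \<psi> p w)"
    and "continuous_on (U \<inter> W) (\<lambda>p. coord_differential W \<psi> c p w)"
proof -
  have X: "openin (top_of_set M) (U \<inter> W)"
    using LC_open[OF c] chart_open[OF W] by (rule openin_Int)
  note 1 = smooth_on_coord_differential[OF c X Int_lower1 transition_smooth(2)[OF c W]]
  note 2 = smooth_on_coord_differential[OF chart_local_coordinates[OF W] X Int_lower2 transition_smooth(1)[OF c W]]
  show "\<And>p. p \<in> U \<inter> W \<Longrightarrow> coord_differentiable U c \<psi> p" by (rule 1(1))
  show "\<And>p. p \<in> U \<inter> W \<Longrightarrow> coord_differentiable W \<psi> c p" by (rule 2(1))
  show "continuous_on (U \<inter> W) (\<lambda>p. coord_differential U c \<psi> p w)" by (rule 1(3))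
  show "continuous_on (U \<inter> W) (\<lambda>p. coord_differential W \<psi> c p w)" by (rule 2(3))
qed

text \<open>Continuity for every fixed vector suffices in finite dimension: \<open>L p (v p)\<close>
  is a combination of the two basis values with continuous coefficients.\<close>

lemma continuous_on_linear_vec2:
  fixes L :: "'b::topological_space \<Rightarrow> real^2 \<Rightarrow> 'c::real_normed_vector"
  assumes "\<And>p. p \<in> X \<Longrightarrow> linear (L p)" "\<And>w. continuous_on X (\<lambda>p. L p w)" "continuous_on X v"
  shows "continuous_on X (\<lambda>p. L p (v p))"
proof -
  have "continuous_on X (\<lambda>p. v p $ 1 *\<^sub>R L p (axis 1 1) + v p $ 2 *\<^sub>R L p (axis 2 1))"
    by (intro continuous_intros assms)
  then show ?thesis
    by (rule continuous_on_eq) (simp add: linear_expand_vec2[OF assms(1), symmetric])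
qed

lemma openin_Int_relative:
  assumes "openin (top_of_set M) X" "Y \<subseteq> M"
  shows "openin (top_of_set Y) (Y \<inter> X)"
  using assms by (auto simp: openin_open)

text \<open>\<open>local_coordinates\<close> compares coordinates only with charts of the atlas, so
  two general coordinate systems are compared through a chart near each point, and continuity is
  glued over these overlaps.\<close>

lemma coordinate_change_differentiable:
  assumes c: "LC U c" and c': "LC U' c'"
  shows "\<And>p. p \<in> U \<inter> U' \<Longrightarrow> coord_differentiable U c c' p"
    and "continuous_on (U \<inter> U') (\<lambda>p. coord_differential U c c' p w)"
proof -
  have ch: "coord_differentiable U c c' q \<and>
      coord_differential U c c' q w = coord_differential W \<psi> c' q (coord_differential U c \<psi> q w)"
    if "(W, \<psi>) \<in> A" "q \<in> U \<inter> U' \<inter> W" for W \<psi> q w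
    using that coord_differential_change[OF c chart_local_coordinates[OF that(1)] _ _
        chart_coord_differential(1)[OF c that(1)] chart_coord_differential(2)[OF c' that(1)], of q]
    by auto
  show "coord_differentiable U c c' p" if p: "p \<in> U \<inter> U'" for p
  proof -
    have "p \<in> M" using p LC_subset[OF c] by blast
    then obtain W \<psi> where "(W, \<psi>) \<in> A" "p \<in> W" by (rule chart_at)
    then show ?thesis using ch p by blast
  qed
  let ?C = "(\<lambda>x. U \<inter> U' \<inter> fst x) ` A"
  have cov: "U \<inter> U' = \<Union>?C"
  proof (intro equalityI subsetI)
    fix q assume q: "q \<in> U \<inter> U'"
    then have "q \<in> M" using LC_subset[OF c] by blast
    then obtain W \<psi> where "(W, \<psi>) \<in> A" "q \<in> W" by (rule chart_at)
    then show "q \<in> \<Union>?C" using q by (intro UnionI[of "U \<inter> U' \<inter> W"] image_eqI[of _ _ "(W, \<psi>)"]) auto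
  qed auto
  show "continuous_on (U \<inter> U') (\<lambda>p. coord_differential U c c' p w)"
  proof (subst cov, rule continuous_on_open_Union_openin)
    fix X assume "X \<in> ?C"
    then obtain x where x: "X = U \<inter> U' \<inter> fst x" "x \<in> A" by (rule imageE)
    define W \<psi> where "W = fst x" and "\<psi> = snd x"
    have W: "(W, \<psi>) \<in> A" "X = U \<inter> U' \<inter> W" using x by (simp_all add: W_def \<psi>_def)
    show "openin (top_of_set (\<Union>?C)) X"
      unfolding cov[symmetric] W(2)
      by (rule openin_Int_relative[OF chart_open[OF W(1)]]) (use LC_subset[OF c] in auto)
    have "continuous_on X (\<lambda>p. coord_differential W \<psi> c' p (coord_differential U c \<psi> p w))"
    proof (rule continuous_on_linear_vec2[where L = "coord_differential W \<psi> c'"])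
      show "linear (coord_differential W \<psi> c' p)" if "p \<in> X" for p
        using that chart_coord_differential(2)[OF c' W(1), of p] W(2) by (auto intro: linear_coord_differential)
      show "continuous_on X (\<lambda>p. coord_differential W \<psi> c' p w)" for w
        by (rule continuous_on_subset[OF chart_coord_differential(4)[OF c' W(1)]]) (auto simp: W(2))
      show "continuous_on X (\<lambda>p. coord_differential U c \<psi> p w)"
        by (rule continuous_on_subset[OF chart_coord_differential(3)[OF c W(1)]]) (auto simp: W(2))
    qed
    then show "continuous_on X (\<lambda>p. coord_differential U c c' p w)"
      by (rule continuous_on_eq) (use ch W in auto)
  qed
qed

lemma coord_differential_self:
  assumes c: "LC U c" and p: "p \<in> U"
  shows "coord_differential U c c p w = w"
proof -
  have "((\<lambda>x. x) has_derivative (\<lambda>w. w)) (at (c p) within c ` U)" by (rule has_derivative_ident)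
  then have "(c \<circ> inv_into U c has_derivative (\<lambda>w. w)) (at (c p) within c ` U)"
    by (rule has_derivative_transform[OF imageI[OF p], rotated]) (auto simp: LC_inv[OF c])
  then show ?thesis using coord_differential_eqI(2)[OF c p] by metis
qed

lemma coordinate_change_inverse:
  assumes c: "LC U c" and c': "LC U' c'" and p: "p \<in> U \<inter> U'"
  shows "coord_differential U' c' c p (coord_differential U c c' p w) = w"
  using p coord_differential_change(2)[OF c c' _ _ coordinate_change_differentiable(1)[OF c c']
      coordinate_change_differentiable(1)[OF c' c], of p w] coord_differential_self[OF c] by auto

section \<open>Maps of class C^1 on the surface\<close>

text \<open>Regularity is tested in all local coordinates, so that curvature line coordinates and
  charts can be used interchangeably. Order one is the level that survives multiplication by the
  cut-off functions of the partition of unity.\<close>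

definition C1_on :: "'a set \<Rightarrow> ('a \<Rightarrow> 'b::real_normed_vector) \<Rightarrow> bool" where
  "C1_on X f \<longleftrightarrow> openin (top_of_set M) X \<and>
     (\<forall>U c. LC U c \<longrightarrow> (\<forall>p\<in>U \<inter> X. coord_differentiable U c f p) \<and>
        (\<forall>w. continuous_on (U \<inter> X) (\<lambda>p. coord_differential U c f p w)))"

lemma C1_on_open: "C1_on X f \<Longrightarrow> openin (top_of_set M) X"
  and C1_on_differentiable: "C1_on X f \<Longrightarrow> LC U c \<Longrightarrow> p \<in> U \<Longrightarrow> p \<in> X \<Longrightarrow> coord_differentiable U c f p"
  and C1_on_continuous_differential:
    "C1_on X f \<Longrightarrow> LC U c \<Longrightarrow> continuous_on (U \<inter> X) (\<lambda>p. coord_differential U c f p w)"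
  by (simp_all add: C1_on_def)

lemma C1_on_cover:
  assumes "\<And>p. p \<in> X \<Longrightarrow> \<exists>Y. p \<in> Y \<and> Y \<subseteq> X \<and> C1_on Y f"
  shows "C1_on X f"
proof -
  define \<C> where "\<C> = {Y. Y \<subseteq> X \<and> C1_on Y f}"
  have X: "X = \<Union>\<C>"
  proof (intro equalityI subsetI)
    fix p assume "p \<in> X"
    then obtain Y where "p \<in> Y" "Y \<subseteq> X" "C1_on Y f" using assms by metis
    then show "p \<in> \<Union>\<C>" unfolding \<C>_def by (intro UnionI[of Y]) simp_all
  qed (auto simp: \<C>_def)
  have o: "openin (top_of_set M) X" unfolding X by (rule openin_Union) (simp add: \<C>_def C1_on_def)
  show ?thesis unfolding C1_on_def
  proof (intro conjI allI impI ballI o)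
    fix U c p assume c: "LC U c" and p: "p \<in> U \<inter> X"
    obtain Y where "p \<in> Y" "C1_on Y f" using assms[of p] p by auto
    then show "coord_differentiable U c f p" using C1_on_differentiable[OF _ c] p by auto
  next
    fix U c w assume c: "LC U c"
    have eq: "U \<inter> X = \<Union>((\<inter>) U ` \<C>)" unfolding X by auto
    show "continuous_on (U \<inter> X) (\<lambda>p. coord_differential U c f p w)"
      unfolding eq
    proof (rule continuous_on_open_Union_openin)
      fix Y assume "Y \<in> (\<inter>) U ` \<C>"
      then obtain Z where Z: "Y = U \<inter> Z" "Z \<subseteq> X" "C1_on Z f" by (auto simp: \<C>_def)
      show "openin (top_of_set (\<Union>((\<inter>) U ` \<C>))) Y"
        unfolding eq[symmetric] Z(1)
        using openin_Int_relative[OF C1_on_open[OF Z(3)], of "U \<inter> X"] LC_subset[OF c] Z(2)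
        by (simp add: Int_assoc Int_absorb1 le_infI1)
      show "continuous_on Y (\<lambda>p. coord_differential U c f p w)"
        unfolding Z(1) by (rule C1_on_continuous_differential[OF Z(3) c])
    qed
  qed
qed

lemma C1_on_subset:
  assumes "C1_on X f" "openin (top_of_set M) Y" "Y \<subseteq> X" shows "C1_on Y f"
  using assms unfolding C1_on_def by (meson IntD1 IntD2 IntI Int_mono continuous_on_subset order_refl subsetD)

text \<open>The differential depends only on the values near \<open>p\<close>, because
  \<open>X\<close> is relatively open.\<close>

lemma coord_differential_cong:
  assumes c: "LC U c" and X: "openin (top_of_set M) X" "p \<in> X" "p \<in> U" and eq: "\<And>q. q \<in> X \<inter> U \<Longrightarrow> f q = g q"
    and f: "coord_differentiable U c f p"
  shows "coord_differentiable U c g p" "coord_differential U c g p = coord_differential U c f p"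
proof -
  have Y: "openin (top_of_set M) (X \<inter> U)" "X \<inter> U \<subseteq> U" "p \<in> X \<inter> U"
    using X LC_open[OF c] by auto
  have "((f \<circ> inv_into U c) has_derivative coord_differential U c f p) (at (c p) within c ` (X \<inter> U))"
    using coord_differential_works[OF f] LC_at_within[OF c Y] by simp
  then have "((g \<circ> inv_into U c) has_derivative coord_differential U c f p) (at (c p) within c ` (X \<inter> U))"
    by (rule has_derivative_transform[OF imageI[OF Y(3)], rotated]) (auto simp: LC_inv[OF c] eq)
  then have d: "((g \<circ> inv_into U c) has_derivative coord_differential U c f p) (at (c p) within c ` U)"
    using LC_at_within[OF c Y] by simp
  show "coord_differentiable U c g p" "coord_differential U c g p = coord_differential U c f p"
    using coord_differential_eqI[OF c X(3) d] by auto
qed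

lemma C1_on_cong:
  assumes f: "C1_on X f" and eq: "\<And>q. q \<in> X \<Longrightarrow> f q = g q"
  shows "C1_on X g"
  unfolding C1_on_def
proof (intro conjI allI impI ballI C1_on_open[OF f])
  fix U c assume c: "LC U c"
  have cong: "coord_differentiable U c g p" "coord_differential U c g p = coord_differential U c f p"
    if "p \<in> U \<inter> X" for p
    by (rule coord_differential_cong[OF c C1_on_open[OF f]];
        use that eq C1_on_differentiable[OF f c] in auto)+
  { fix p assume "p \<in> U \<inter> X" then show "coord_differentiable U c g p" by (rule cong(1)) }
  fix w
  show "continuous_on (U \<inter> X) (\<lambda>p. coord_differential U c g p w)"
    by (rule continuous_on_eq[OF C1_on_continuous_differential[OF f c]]) (use cong(2) in auto)
qed

text \<open>One coordinate system suffices: in any other one the differential is composed with that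
  of the coordinate change, which is continuous.\<close>

lemma C1_on_chartI:
  assumes W: "LC W \<psi>" and X: "openin (top_of_set M) X" "X \<subseteq> W"
    and d: "\<And>p. p \<in> X \<Longrightarrow> coord_differentiable W \<psi> f p"
    and cont: "\<And>w. continuous_on X (\<lambda>p. coord_differential W \<psi> f p w)"
  shows "C1_on X f"
  unfolding C1_on_def
proof (intro conjI allI impI ballI X(1))
  fix U c assume c: "LC U c"
  have ch: "coord_differentiable U c f p \<and> coord_differential U c f p w = coord_differential W \<psi> f p (coord_differential U c \<psi> p w)"
    if "p \<in> U \<inter> X" for p w
    using coord_differential_change(1)[OF c W, of p f] coord_differential_change(2)[OF c W, of p f w]
      coordinate_change_differentiable(1)[OF c W, of p] d that X(2) by auto
  { fix p assume "p \<in> U \<inter> X" then show "coord_differentiable U c f p" using ch by blast }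
  fix w
  have "continuous_on (U \<inter> X) (\<lambda>p. coord_differential W \<psi> f p (coord_differential U c \<psi> p w))"
  proof (rule continuous_on_linear_vec2[where L = "coord_differential W \<psi> f"])
    show "linear (coord_differential W \<psi> f p)" if "p \<in> U \<inter> X" for p
      using that d by (auto intro: linear_coord_differential)
    show "continuous_on (U \<inter> X) (\<lambda>p. coord_differential W \<psi> f p w)" for w
      by (rule continuous_on_subset[OF cont]) auto
    show "continuous_on (U \<inter> X) (\<lambda>p. coord_differential U c \<psi> p w)"
      by (rule continuous_on_subset[OF coordinate_change_differentiable(2)[OF c W]]) (use X in auto)
  qed
  then show "continuous_on (U \<inter> X) (\<lambda>p. coord_differential U c f p w)"
    by (rule continuous_on_eq) (use ch in auto)
qed

lemma C1_on_coordinates: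
  assumes "LC U c" shows "C1_on U c"
proof (rule C1_on_cover)
  fix p assume p: "p \<in> U"
  then have "p \<in> M" using LC_subset[OF assms] by blast
  then obtain W \<psi> where W: "(W, \<psi>) \<in> A" "p \<in> W" by (rule chart_at)
  have "C1_on (U \<inter> W) c"
    by (rule C1_on_chartI[OF chart_local_coordinates[OF W(1)]])
       (use chart_coord_differential[OF assms W(1)] LC_open[OF assms] chart_open[OF W(1)] p W(2) in auto)
  then show "\<exists>Y. p \<in> Y \<and> Y \<subseteq> U \<and> C1_on Y c" using p W by (intro exI[of _ "U \<inter> W"]) auto
qed

lemma smooth_map_C1_on:
  assumes f: "smooth_map A f" shows "C1_on M f"
proof (rule C1_on_cover)
  fix p assume p: "p \<in> M"
  then obtain W \<psi> where W: "(W, \<psi>) \<in> A" "p \<in> W" by (rule chart_at)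
  have s: "smooth_on (\<psi> ` W) (f \<circ> inv_into W \<psi>)" using f W(1) by (auto simp: smooth_map_def)
  note \<psi> = chart_local_coordinates[OF W(1)]
  note sm = smooth_on_coord_differential[OF \<psi> LC_open[OF \<psi>] order_refl s]
  have "C1_on W f" by (rule C1_on_chartI[OF \<psi> LC_open[OF \<psi>] order_refl sm(1) sm(3)])
  then show "\<exists>Y. p \<in> Y \<and> Y \<subseteq> M \<and> C1_on Y f" using W LC_subset[OF \<psi>] by blast
qed

lemma smooth_map_differential_C1_on:
  assumes f: "smooth_map A f" and W: "(W, \<psi>) \<in> A"
  shows "C1_on W (\<lambda>p. coord_differential W \<psi> f p w)"
proof -
  have s: "smooth_on (\<psi> ` W) (f \<circ> inv_into W \<psi>)" using f W(1) by (auto simp: smooth_map_def)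
  note \<psi> = chart_local_coordinates[OF W(1)]
  note sm = smooth_on_coord_differential[OF \<psi> LC_open[OF \<psi>] order_refl]
  show ?thesis by (rule C1_on_chartI[OF \<psi> LC_open[OF \<psi>] order_refl sm(1)[OF sm(2)[OF s]] sm(3)[OF sm(2)[OF s]]])
qed

lemma transition_differential_C1_on:
  assumes c: "LC U c" and W: "(W, \<psi>) \<in> A"
  shows "C1_on (U \<inter> W) (\<lambda>p. coord_differential U c \<psi> p w)"
proof -
  have X: "openin (top_of_set M) (U \<inter> W)"
    using LC_open[OF c] chart_open[OF W] by (rule openin_Int)
  note s = smooth_on_coord_differential(2)[OF c X Int_lower1 transition_smooth(2)[OF c W]]
  show ?thesis
    by (rule C1_on_chartI[OF c X Int_lower1])
       (use smooth_on_coord_differential(1,3)[OF c X Int_lower1 s] in auto)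
qed

lemma C1_on_imp_continuous_on:
  assumes f: "C1_on X f" shows "continuous_on X f"
proof -
  have "continuous (at p within X) f" if p: "p \<in> X" for p
  proof -
    have "p \<in> M" using C1_on_open[OF f] p openin_imp_subset by blast
    then obtain U c where c: "(U, c) \<in> A" "p \<in> U" by (rule chart_at)
    note LC = chart_local_coordinates[OF c(1)]
    have Y: "openin (top_of_set M) (U \<inter> X)" using C1_on_open[OF f] LC_open[OF LC] by auto
    have "continuous_on (c ` (U \<inter> X)) (f \<circ> inv_into U c)"
      unfolding continuous_on_eq_continuous_within
    proof
      fix x assume "x \<in> c ` (U \<inter> X)"
      then obtain q where q: "q \<in> U \<inter> X" "x = c q" by blast
      show "continuous (at x within c ` (U \<inter> X)) (f \<circ> inv_into U c)"
        using has_derivative_continuous[OF coord_differential_works[OF C1_on_differentiable[OF f LC]]]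
          q LC_at_within[OF LC Y Int_lower1 q(1)] by auto
    qed
    then have "continuous_on (U \<inter> X) (f \<circ> inv_into U c \<circ> c)"
      by (rule continuous_on_compose[OF continuous_on_subset[OF LC_continuous[OF LC] Int_lower1]])
    then have cont: "continuous_on (U \<inter> X) f"
      by (rule continuous_on_eq) (auto simp: LC_inv[OF LC])
    obtain T where T: "open T" "U = M \<inter> T" using LC_open[OF LC] by (auto simp: openin_open)
    have "at p within X = at p within (U \<inter> X)"
      by (rule at_within_nhd[of _ T]) (use T c(2) openin_imp_subset[OF C1_on_open[OF f]] in auto)
    then show ?thesis using cont c(2) p by (simp add: continuous_on_eq_continuous_within)
  qed
  then show ?thesis by (simp add: continuous_on_eq_continuous_within)
qed

lemma coord_differential_bilinear:
  assumes B: "bounded_bilinear B" and c: "LC U c" "p \<in> U"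
    and f: "coord_differentiable U c f p" and g: "coord_differentiable U c g p"
  shows "coord_differentiable U c (\<lambda>p. B (f p) (g p)) p"
    and "coord_differential U c (\<lambda>p. B (f p) (g p)) p w =
           B (f p) (coord_differential U c g p w) + B (coord_differential U c f p w) (g p)"
proof -
  have "((\<lambda>x. B ((f \<circ> inv_into U c) x) ((g \<circ> inv_into U c) x)) has_derivative
     (\<lambda>w. B ((f \<circ> inv_into U c) (c p)) (coord_differential U c g p w) +
           B (coord_differential U c f p w) ((g \<circ> inv_into U c) (c p)))) (at (c p) within c ` U)"
    by (rule bounded_bilinear.FDERIV[OF B coord_differential_works[OF f] coord_differential_works[OF g]])
  then have d: "((\<lambda>p. B (f p) (g p)) \<circ> inv_into U c has_derivative
     (\<lambda>w. B (f p) (coord_differential U c g p w) + B (coord_differential U c f p w) (g p))) (at (c p) within c ` U)"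
    by (simp add: comp_def LC_inv[OF c])
  show "coord_differentiable U c (\<lambda>p. B (f p) (g p)) p"
    "coord_differential U c (\<lambda>p. B (f p) (g p)) p w =
           B (f p) (coord_differential U c g p w) + B (coord_differential U c f p w) (g p)"
    using coord_differential_eqI[OF c d] by auto
qed

lemma C1_on_bilinear:
  assumes B: "bounded_bilinear B" and f: "C1_on X f" and g: "C1_on X g"
  shows "C1_on X (\<lambda>p. B (f p) (g p))"
  unfolding C1_on_def
proof (intro conjI allI impI ballI C1_on_open[OF f])
  fix U c assume c: "LC U c"
  note d = C1_on_differentiable[OF f c] C1_on_differentiable[OF g c]
  { fix p assume "p \<in> U \<inter> X"
    then show "coord_differentiable U c (\<lambda>p. B (f p) (g p)) p"
      using coord_differential_bilinear(1)[OF B c] d by blast }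
  fix w
  have "continuous_on (U \<inter> X) (\<lambda>p. B (f p) (coord_differential U c g p w) + B (coord_differential U c f p w) (g p))"
    using C1_on_imp_continuous_on[OF f] C1_on_imp_continuous_on[OF g]
      C1_on_continuous_differential[OF f c] C1_on_continuous_differential[OF g c]
    by (intro continuous_intros bounded_bilinear.continuous_on[OF B]) (auto intro: continuous_on_subset)
  then show "continuous_on (U \<inter> X) (\<lambda>p. coord_differential U c (\<lambda>p. B (f p) (g p)) p w)"
    by (rule continuous_on_eq) (use coord_differential_bilinear(2)[OF B c] d in auto)
qed

lemma coord_differential_add:
  assumes c: "LC U c" "p \<in> U"
    and f: "coord_differentiable U c f p" and g: "coord_differentiable U c g p"
  shows "coord_differentiable U c (\<lambda>p. f p + g p) p"
    and "coord_differential U c (\<lambda>p. f p + g p) p w = coord_differential U c f p w + coord_differential U c g p w"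
proof -
  have "((\<lambda>x. (f \<circ> inv_into U c) x + (g \<circ> inv_into U c) x) has_derivative
     (\<lambda>w. coord_differential U c f p w + coord_differential U c g p w)) (at (c p) within c ` U)"
    by (rule has_derivative_add[OF coord_differential_works[OF f] coord_differential_works[OF g]])
  then have d: "((\<lambda>p. f p + g p) \<circ> inv_into U c has_derivative
     (\<lambda>w. coord_differential U c f p w + coord_differential U c g p w)) (at (c p) within c ` U)"
    by (simp add: comp_def)
  show "coord_differentiable U c (\<lambda>p. f p + g p) p"
    "coord_differential U c (\<lambda>p. f p + g p) p w = coord_differential U c f p w + coord_differential U c g p w"
    using coord_differential_eqI[OF c d] by auto
qed

lemma C1_on_add:
  assumes f: "C1_on X f" and g: "C1_on X g"
  shows "C1_on X (\<lambda>p. f p + g p)"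
  unfolding C1_on_def
proof (intro conjI allI impI ballI C1_on_open[OF f])
  fix U c assume c: "LC U c"
  note d = C1_on_differentiable[OF f c] C1_on_differentiable[OF g c]
  { fix p assume "p \<in> U \<inter> X"
    then show "coord_differentiable U c (\<lambda>p. f p + g p) p"
      using coord_differential_add(1)[OF c] d by blast }
  fix w
  have "continuous_on (U \<inter> X) (\<lambda>p. coord_differential U c f p w + coord_differential U c g p w)"
    by (intro continuous_on_add C1_on_continuous_differential[OF f c] C1_on_continuous_differential[OF g c])
  then show "continuous_on (U \<inter> X) (\<lambda>p. coord_differential U c (\<lambda>p. f p + g p) p w)"
    by (rule continuous_on_eq, intro coord_differential_add(2)[OF c, symmetric] d) auto
qed

lemma coord_differential_compose:
  fixes h :: "'b::real_normed_vector \<Rightarrow> 'c::real_normed_vector"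
  assumes c: "LC U c" "p \<in> U" and f: "coord_differentiable U c f p"
    and h: "(h has_derivative h') (at (f p))"
  shows "coord_differentiable U c (\<lambda>p. h (f p)) p"
    and "coord_differential U c (\<lambda>p. h (f p)) p w = h' (coord_differential U c f p w)"
proof -
  have "(h has_derivative h') (at ((f \<circ> inv_into U c) (c p)))" using h by (simp add: LC_inv[OF c])
  then have "((\<lambda>x. h ((f \<circ> inv_into U c) x)) has_derivative (\<lambda>w. h' (coord_differential U c f p w))) (at (c p) within c ` U)"
    by (rule has_derivative_compose[OF coord_differential_works[OF f]])
  then have d: "((\<lambda>p. h (f p)) \<circ> inv_into U c has_derivative (\<lambda>w. h' (coord_differential U c f p w))) (at (c p) within c ` U)"
    by (simp add: comp_def)
  show "coord_differentiable U c (\<lambda>p. h (f p)) p"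
    "coord_differential U c (\<lambda>p. h (f p)) p w = h' (coord_differential U c f p w)"
    using coord_differential_eqI[OF c d] by auto
qed

lemma C1_on_compose_real:
  fixes f :: "'a \<Rightarrow> real"
  assumes f: "C1_on X f" and h: "\<And>x. x \<in> f ` X \<Longrightarrow> (h has_field_derivative h' x) (at x)"
    and h': "continuous_on (f ` X) h'"
  shows "C1_on X (\<lambda>p. h (f p))"
  unfolding C1_on_def
proof (intro conjI allI impI ballI C1_on_open[OF f])
  fix U c assume c: "LC U c"
  note d = C1_on_differentiable[OF f c]
  have hd: "(h has_derivative (\<lambda>w. h' (f p) * w)) (at (f p))" if "p \<in> X" for p
    using h[of "f p"] that by (simp add: has_field_derivative_def)
  { fix p assume "p \<in> U \<inter> X"
    then show "coord_differentiable U c (\<lambda>p. h (f p)) p"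
      using coord_differential_compose(1)[OF c _ d hd] by blast }
  fix w
  have "continuous_on (U \<inter> X) (\<lambda>p. h' (f p) * coord_differential U c f p w)"
    using continuous_on_compose[OF C1_on_imp_continuous_on[OF f] h'] C1_on_continuous_differential[OF f c]
    by (intro continuous_intros) (auto simp: comp_def intro: continuous_on_subset)
  then show "continuous_on (U \<inter> X) (\<lambda>p. coord_differential U c (\<lambda>p. h (f p)) p w)"
    by (rule continuous_on_eq) (use coord_differential_compose(2)[OF c _ d hd] in auto)
qed

lemma coord_differential_const:
  assumes c: "LC U c" "p \<in> U"
  shows "coord_differentiable U c (\<lambda>_. k) p" "coord_differential U c (\<lambda>_. k) p = (\<lambda>_. 0)"
proof -
  have d: "((\<lambda>_. k) \<circ> inv_into U c has_derivative (\<lambda>_. 0)) (at (c p) within c ` U)"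
    by (simp add: comp_def)
  show "coord_differentiable U c (\<lambda>_. k) p" "coord_differential U c (\<lambda>_. k) p = (\<lambda>_. 0)"
    using coord_differential_eqI[OF c d] by auto
qed

lemma C1_on_const: "openin (top_of_set M) X \<Longrightarrow> C1_on X (\<lambda>_. k)"
  unfolding C1_on_def
proof (intro conjI allI impI ballI)
  fix U c w assume c: "LC U c"
  show "continuous_on (U \<inter> X) (\<lambda>p. coord_differential U c (\<lambda>_. k) p w)"
    by (rule continuous_on_eq[OF continuous_on_const[of _ 0]]) (simp add: coord_differential_const[OF c])
qed (auto simp: coord_differential_const)

text \<open>To include boundary points, the symmetry of second derivatives is applied to a smooth
  extension on an open set of the plane. At points of the chart image the derivatives of the
  extension are the coordinate differentials.\<close>

lemma mixed_coord_differentials_commute: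
  fixes f :: "'a \<Rightarrow> 'b::euclidean_space"
  assumes f: "smooth_map A f" and W: "(W, \<psi>) \<in> A" and p: "p \<in> W"
  shows "coord_differential W \<psi> (\<lambda>p. coord_differential W \<psi> f p u) p v =
         coord_differential W \<psi> (\<lambda>p. coord_differential W \<psi> f p v) p u"
proof -
  have s: "smooth_on (\<psi> ` W) (f \<circ> inv_into W \<psi>)" using f W(1) by (auto simp: smooth_map_def)
  note \<psi> = chart_local_coordinates[OF W(1)]
  obtain S g where S: "open S" "\<psi> p \<in> S" "\<forall>k. times_cont_diff k g S" "\<forall>y\<in>S \<inter> \<psi> ` W. g y = (f \<circ> inv_into W \<psi>) y"
    "\<forall>y\<in>S. (g has_derivative frechet_derivative g (at y)) (at y)"
    "\<forall>y\<in>S \<inter> \<psi> ` W. ((f \<circ> inv_into W \<psi>) has_derivative frechet_derivative g (at y)) (at y within \<psi> ` W)"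
    using smooth_on_extension_derivative[OF s imageI[OF p]] by (elim exE conjE)
  let ?g = "\<lambda>u y. frechet_derivative g (at y) u"
  have t1: "times_cont_diff k (?g u) S" for k u using S(3)[rule_format, of "Suc k"] by simp
  have d1: "(?g u has_derivative frechet_derivative (?g u) (at y)) (at y)" if "y \<in> S" for u y
    using t1[of "Suc 0" u] that by (simp add: frechet_derivative_works)
  have c1: "continuous_on S (\<lambda>y. frechet_derivative (?g u) (at y) v)" for u v
    using t1[of "Suc 0" u] by simp
  have comm: "frechet_derivative (?g u) (at (\<psi> p)) v = frechet_derivative (?g v) (at (\<psi> p)) u"
    by (rule mixed_derivatives_commute[OF S(1,2) _ d1 d1 c1 c1]) (use S(5) in auto)
  have D1: "coord_differential W \<psi> f q u = ?g u (\<psi> q)" if "q \<in> W" "\<psi> q \<in> S" for q u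
    using coord_differential_eqI(2)[OF \<psi> that(1)] S(6) that by (metis IntI imageI)
  have D2: "coord_differential W \<psi> (\<lambda>p. coord_differential W \<psi> f p u) p v = frechet_derivative (?g u) (at (\<psi> p)) v" for u v
  proof -
    obtain e where e: "e > 0" "ball (\<psi> p) e \<subseteq> S" using S(1,2) openE by blast
    have "((\<lambda>p. coord_differential W \<psi> f p u) \<circ> inv_into W \<psi> has_derivative frechet_derivative (?g u) (at (\<psi> p))) (at (\<psi> p) within \<psi> ` W)"
    proof (rule has_derivative_transform_within[OF has_derivative_at_withinI[OF d1[OF S(2), of u]] e(1)])
      fix x assume x: "x \<in> \<psi> ` W" "dist x (\<psi> p) < e"
      then have "x \<in> S" using e by (auto simp: dist_commute)
      then show "?g u x = ((\<lambda>p. coord_differential W \<psi> f p u) \<circ> inv_into W \<psi>) x"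
        using x D1 by (auto simp: LC_inv[OF \<psi>])
    qed (use p in auto)
    then show ?thesis using coord_differential_eqI(2)[OF \<psi> p] by metis
  qed
  show ?thesis unfolding D2 by (rule comm)
qed

end

subsection \<open>Geometry of the immersion\<close>

lemma bounded_bilinear_cross3: "bounded_bilinear cross3"
  using bilinear_cross bilinear_conv_bounded_bilinear by blast

text \<open>A vector orthogonal to \<open>x\<close> and \<open>y\<close> is parallel to
  \<open>cross3 x y\<close>, so being orthogonal to that as well it vanishes. This tests the
  equations for the principal curvatures on the two tangent vectors and the normal.\<close>

lemma orthogonal_to_cross_basis_eq_0:
  assumes "v \<bullet> x = 0" "v \<bullet> y = 0" "v \<bullet> cross3 x y = 0" "cross3 x y \<noteq> 0"
  shows "v = 0"
proof -
  have "cross3 v (cross3 x y) = 0" using assms(1,2) by (simp add: Lagrange)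
  then have "(norm v * norm (cross3 x y))\<^sup>2 = 0"
    using norm_cross_dot[of v "cross3 x y"] assms(3) by simp
  then show ?thesis using assms(4) by simp
qed

text \<open>The form X of the overview, taken on two differentials instead of two maps, so that its
  behaviour under a change of coordinates is linear algebra. It is bilinear and symmetric.\<close>

definition wedge :: "(real^2 \<Rightarrow> real^3) \<Rightarrow> (real^2 \<Rightarrow> real^3) \<Rightarrow> real^3" where
  "wedge L L' = cross3 (L (axis 1 1)) (L' (axis 2 1)) - cross3 (L (axis 2 1)) (L' (axis 1 1))"

lemma det_matrix_vec2: "det (matrix J) = J (axis 1 1) $ 1 * J (axis 2 1) $ 2 - J (axis 2 1) $ 1 * J (axis 1 1) $ 2"
  for J :: "real^2 \<Rightarrow> real^2"
  by (simp add: det_2 matrix_def)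

lemma wedge_self: "wedge L L = 2 *\<^sub>R cross3 (L (axis 1 1)) (L (axis 2 1))"
  unfolding wedge_def by (subst (2) cross_skew) (simp add: scaleR_2)

text \<open>In the expansion the terms with \<open>cross3 p p'\<close> and
  \<open>cross3 q q'\<close> cancel, and the four mixed terms assemble to the determinant.\<close>

lemma wedge_comp:
  assumes "linear L" "linear L'"
  shows "wedge (\<lambda>w. L (J w)) (\<lambda>w. L' (J w)) = det (matrix J) *\<^sub>R wedge L L'"
proof -
  define a b c d where "a = J (axis 1 1) $ 1" and "b = J (axis 1 1) $ 2"
    and "c = J (axis 2 1) $ 1" and "d = J (axis 2 1) $ 2"
  define p q p' q' where "p = L (axis 1 1)" and "q = L (axis 2 1)"
    and "p' = L' (axis 1 1)" and "q' = L' (axis 2 1)"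
  have e: "L (J (axis 1 1)) = a *\<^sub>R p + b *\<^sub>R q" "L (J (axis 2 1)) = c *\<^sub>R p + d *\<^sub>R q"
    "L' (J (axis 1 1)) = a *\<^sub>R p' + b *\<^sub>R q'" "L' (J (axis 2 1)) = c *\<^sub>R p' + d *\<^sub>R q'"
    using linear_expand_vec2[OF assms(1)] linear_expand_vec2[OF assms(2)]
    unfolding a_def b_def c_def d_def p_def q_def p'_def q'_def by blast+
  have "cross3 (a *\<^sub>R p + b *\<^sub>R q) (c *\<^sub>R p' + d *\<^sub>R q') - cross3 (c *\<^sub>R p + d *\<^sub>R q) (a *\<^sub>R p' + b *\<^sub>R q')
      = (a * d - c * b) *\<^sub>R (cross3 p q' - cross3 q p')"
    by (simp add: cross_add_left cross_add_right cross_mult_left cross_mult_right algebra_simps)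
  then show ?thesis
    unfolding wedge_def det_matrix_vec2 e unfolding a_def b_def c_def d_def p_def q_def p'_def q'_def .
qed

context surface_atlas begin

lemma wedge_change:
  assumes c: "LC U c" and c': "LC U' c'" and p: "p \<in> U \<inter> U'"
    and f: "coord_differentiable U' c' f p" and g: "coord_differentiable U' c' g p"
  shows "wedge (coord_differential U c f p) (coord_differential U c g p) =
    det (matrix (coord_differential U c c' p)) *\<^sub>R wedge (coord_differential U' c' f p) (coord_differential U' c' g p)"
proof -
  note t = coordinate_change_differentiable(1)[OF c c' p]
  have "coord_differential U c f p = (\<lambda>w. coord_differential U' c' f p (coord_differential U c c' p w))"
    "coord_differential U c g p = (\<lambda>w. coord_differential U' c' g p (coord_differential U c c' p w))"
    using coord_differential_change(2)[OF c c' _ _ t f] coord_differential_change(2)[OF c c' _ _ t g] p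
    by (simp_all add: fun_eq_iff)
  then show ?thesis
    by (simp only: wedge_comp[OF linear_coord_differential[OF f] linear_coord_differential[OF g],
          where J = "coord_differential U c c' p"])
qed

lemma det_change_nonzero:
  assumes c: "LC U c" and c': "LC U' c'" and p: "p \<in> U \<inter> U'"
  shows "det (matrix (coord_differential U c c' p)) \<noteq> 0"
proof -
  have p': "p \<in> U' \<inter> U" using p by blast
  note l = linear_coord_differential[OF coordinate_change_differentiable(1)[OF c c' p]]
    linear_coord_differential[OF coordinate_change_differentiable(1)[OF c' c p']]
  have "coord_differential U' c' c p \<circ> coord_differential U c c' p = id"
    using coordinate_change_inverse[OF c c' p] by auto
  then have "matrix (coord_differential U' c' c p) ** matrix (coord_differential U c c' p) = mat 1"
    using matrix_compose[OF l] matrix_id_mat_1 by (metis id_def)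
  then show ?thesis by (metis det_I det_mul mult_zero_right zero_neq_one)
qed

text \<open>Smoothness is available for \<open>f\<close> in charts and for transitions between
  \<open>c\<close> and charts. So near each point the differential in \<open>c\<close> is written as
  a combination of chart differentials of \<open>f\<close>, with the components of the differential
  of the transition as coefficients.\<close>

lemma differential_C1_on:
  assumes f: "smooth_map A f" and c: "LC U c"
  shows "C1_on U (\<lambda>q. coord_differential U c f q w)"
proof (rule C1_on_cover)
  fix p assume p: "p \<in> U"
  then have "p \<in> M" using LC_subset[OF c] by blast
  then obtain W \<psi> where W: "(W, \<psi>) \<in> A" "p \<in> W" by (rule chart_at)
  note \<psi> = chart_local_coordinates[OF W(1)]
  have Y: "openin (top_of_set M) (U \<inter> W)" using LC_open[OF c] LC_open[OF \<psi>] by (rule openin_Int)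
  let ?J = "\<lambda>q. coord_differential U c \<psi> q w"
  have J: "C1_on (U \<inter> W) (\<lambda>q. ?J q \<bullet> axis i 1)" for i
    by (rule C1_on_bilinear[OF bounded_bilinear_inner transition_differential_C1_on[OF c W(1)] C1_on_const[OF Y]])
  have R: "C1_on (U \<inter> W) (\<lambda>q. coord_differential W \<psi> f q v)" for v
    using C1_on_subset[OF smooth_map_differential_C1_on[OF f W(1)] Y] by simp
  have "C1_on (U \<inter> W) (\<lambda>q. (?J q \<bullet> axis 1 1) *\<^sub>R coord_differential W \<psi> f q (axis 1 1) +
      (?J q \<bullet> axis 2 1) *\<^sub>R coord_differential W \<psi> f q (axis 2 1))"
    by (intro C1_on_add C1_on_bilinear[OF bounded_bilinear_scaleR] J R)
  then have "C1_on (U \<inter> W) (\<lambda>q. coord_differential U c f q w)"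
  proof (rule C1_on_cong)
    fix q assume q: "q \<in> U \<inter> W"
    then have fq: "coord_differentiable W \<psi> f q"
      using C1_on_differentiable[OF smooth_map_C1_on[OF f] \<psi>] LC_subset[OF \<psi>] by blast
    have "coord_differential U c f q w = coord_differential W \<psi> f q (?J q)"
      using coord_differential_change(2)[OF c \<psi> _ _ coordinate_change_differentiable(1)[OF c \<psi> q] fq] q by blast
    then show "(?J q \<bullet> axis 1 1) *\<^sub>R coord_differential W \<psi> f q (axis 1 1) +
      (?J q \<bullet> axis 2 1) *\<^sub>R coord_differential W \<psi> f q (axis 2 1) = coord_differential U c f q w"
      using linear_expand_vec2[OF linear_coord_differential[OF fq], of "?J q"] by (simp add: inner_axis)
  qed
  then show "\<exists>Y. p \<in> Y \<and> Y \<subseteq> U \<and> C1_on Y (\<lambda>q. coord_differential U c f q w)"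
    using p W(2) by (intro exI[of _ "U \<inter> W"]) simp
qed

end

lemma area_density_wedge:
  "area_density U c r p = norm (wedge (coord_differential U c r p) (coord_differential U c r p)) / 2"
  by (simp add: wedge_self area_density_def coord_deriv_def)

section \<open>Unit normal, principal curvatures and mean curvature\<close>

locale surface_immersion = surface_atlas +
  fixes R N :: "'a \<Rightarrow> real^3"
  assumes immersion: "smooth_immersion A R"
    and curvature_coordinates: "\<And>p. p \<in> M \<Longrightarrow>
      \<exists>U c. p \<in> U \<and> curvature_line_coordinates M A R N U c \<and> unit_normal_in U c R N"
begin

abbreviation dR where "dR U c p \<equiv> coord_differential U c R p"
abbreviation dN where "dN U c p \<equiv> coord_differential U c N p"
abbreviation wRR where "wRR U c p \<equiv> wedge (dR U c p) (dR U c p)"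

lemma R_smooth: "smooth_map A R"
  using immersion by (simp add: smooth_immersion_def)

lemma R_differentiable: "LC U c \<Longrightarrow> p \<in> U \<Longrightarrow> coord_differentiable U c R p"
  using C1_on_differentiable[OF smooth_map_C1_on[OF R_smooth]] LC_subset by blast

lemma wRR_change:
  assumes "LC U c" "LC U' c'" "p \<in> U \<inter> U'"
  shows "wRR U c p = det (matrix (coord_differential U c c' p)) *\<^sub>R wRR U' c' p"
  using wedge_change[OF assms R_differentiable R_differentiable] assms by auto

text \<open>In a chart a vanishing cross product makes the two columns of the injective differential
  dependent and gives a kernel vector. Other coordinates follow since the determinant of the change
  is nonzero.\<close>

lemma wRR_nonzero:
  assumes c: "LC U c" and p: "p \<in> U"
  shows "wRR U c p \<noteq> 0"
proof -
  have "p \<in> M" using p LC_subset[OF c] by blast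
  then obtain W \<psi> where W: "(W, \<psi>) \<in> A" "p \<in> W" by (rule chart_at)
  note \<psi> = chart_local_coordinates[OF W(1)]
  let ?L = "dR W \<psi> p"
  have inj: "inj ?L" using immersion W by (auto simp: smooth_immersion_def)
  have l: "linear ?L" by (rule linear_coord_differential[OF R_differentiable[OF \<psi> W(2)]])
  have "cross3 (?L (axis 1 1)) (?L (axis 2 1)) \<noteq> 0"
  proof
    assume "cross3 (?L (axis 1 1)) (?L (axis 2 1)) = 0"
    then consider "?L (axis 1 1) = 0" | "?L (axis 2 1) = 0" | k where "?L (axis 2 1) = k *\<^sub>R ?L (axis 1 1)"
      by (auto simp: cross_eq_0 collinear_lemma)
    then have "\<exists>w. w \<noteq> 0 \<and> ?L w = 0"
    proof cases
      case 1 then show ?thesis by (intro exI[of _ "axis 1 1"]) (simp add: axis_eq_0_iff)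
    next
      case 2 then show ?thesis by (intro exI[of _ "axis 2 1"]) (simp add: axis_eq_0_iff)
    next
      case 3
      then have "?L (axis 2 1 - k *\<^sub>R axis 1 1) = 0" by (simp add: linear_diff[OF l] linear_cmul[OF l])
      moreover have "(axis 2 1 - k *\<^sub>R axis 1 1 :: real^2) $ 2 = 1" by (simp add: axis_def)
      then have "(axis 2 1 - k *\<^sub>R axis 1 1 :: real^2) \<noteq> 0" by (metis zero_index zero_neq_one)
      ultimately show ?thesis by blast
    qed
    then show False using inj linear_injective_0[OF l] by blast
  qed
  then have "wRR W \<psi> p \<noteq> 0" by (simp add: wedge_self)
  then show ?thesis
    using wRR_change[OF c \<psi>, of p] det_change_nonzero[OF c \<psi>, of p] p W(2) by simp
qed

lemma curvature_coordinates_at: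
  assumes "p \<in> M"
  shows "\<exists>U c. p \<in> U \<and> LC U c \<and> curvature_line_coordinates M A R N U c \<and>
    (\<forall>q\<in>U. norm (N q) = 1) \<and> (\<forall>q\<in>U. wRR U c q = norm (wRR U c q) *\<^sub>R N q)"
proof -
  obtain U c where U: "p \<in> U" "curvature_line_coordinates M A R N U c" "unit_normal_in U c R N"
    using curvature_coordinates[OF assms] by (elim exE conjE)
  have "LC U c" using U(2) by (simp add: curvature_line_coordinates_def)
  moreover have "\<forall>q\<in>U. norm (N q) = 1" using U(3) by (simp add: unit_normal_in_def)
  moreover have "\<forall>q\<in>U. wRR U c q = norm (wRR U c q) *\<^sub>R N q"
  proof
    fix q assume q: "q \<in> U"
    let ?a = "cross3 (dR U c q (axis 1 1)) (dR U c q (axis 2 1))"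
    have "?a = norm ?a *\<^sub>R N q"
      using U(3) q unfolding unit_normal_in_def area_density_def coord_deriv_def by blast
    then have "2 *\<^sub>R ?a = 2 *\<^sub>R (norm ?a *\<^sub>R N q)" by (rule arg_cong)
    moreover have "norm (2 *\<^sub>R ?a) = 2 * norm ?a" by simp
    ultimately show "wRR U c q = norm (wRR U c q) *\<^sub>R N q" unfolding wedge_self by (simp only: scaleR_scaleR)
  qed
  ultimately show ?thesis using U by (intro exI[of _ U] exI[of _ c]) simp
qed

lemma norm_N:
  assumes "p \<in> M" shows "norm (N p) = 1"
  using curvature_coordinates_at[OF assms] by (elim exE conjE) simp

lemma N_inner_N: "p \<in> M \<Longrightarrow> N p \<bullet> N p = 1"
  using norm_N by (simp add: dot_square_norm)

text \<open>In coordinates oriented by \<open>N\<close> the wedge is a positive multiple of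
  \<open>N\<close>; in others the determinant may contribute a sign. The coefficient
  \<open>N p \<bullet> wRR U c p\<close> keeps track of this orientation, and its absolute value is
  twice the area density.\<close>

lemma wRR_eq:
  assumes c: "LC U c" and p: "p \<in> U"
  shows "wRR U c p = (N p \<bullet> wRR U c p) *\<^sub>R N p"
proof -
  have pM: "p \<in> M" using p LC_subset[OF c] by blast
  from curvature_coordinates_at[OF this] obtain U' c'
    where U': "p \<in> U'" "LC U' c'" "curvature_line_coordinates M A R N U' c'"
    "\<forall>q\<in>U'. norm (N q) = 1" "\<forall>q\<in>U'. wRR U' c' q = norm (wRR U' c' q) *\<^sub>R N q"
    by (elim exE conjE)
  obtain k where k: "wRR U c p = k *\<^sub>R N p"
    using wRR_change[OF c U'(2), of p] U'(5)[rule_format, OF U'(1)] U'(1) p by (metis IntI scaleR_scaleR)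
  then show ?thesis using N_inner_N[OF pM] by simp
qed

lemma abs_N_wRR: "LC U c \<Longrightarrow> p \<in> U \<Longrightarrow> \<bar>N p \<bullet> wRR U c p\<bar> = 2 * area_density U c R p"
  using wRR_eq[of U c p] norm_N[of p] LC_subset[of U c]
  by (metis (no_types, opaque_lifting) area_density_wedge field_sum_of_halves mult.right_neutral mult_2 norm_scaleR subsetD)

lemma N_wRR_nonzero: "LC U c \<Longrightarrow> p \<in> U \<Longrightarrow> N p \<bullet> wRR U c p \<noteq> 0"
  using wRR_eq[of U c p] wRR_nonzero[of U c p] by (metis scaleR_zero_left)

lemma area_density_R_pos: "LC U c \<Longrightarrow> p \<in> U \<Longrightarrow> 0 < area_density U c R p"
  using wRR_nonzero by (simp add: area_density_wedge)

lemma N_inner_dR: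
  assumes c: "LC U c" and p: "p \<in> U"
  shows "N p \<bullet> dR U c p w = 0"
proof -
  have "wRR U c p \<bullet> dR U c p w = 0"
    unfolding wedge_self using linear_expand_vec2[OF linear_coord_differential[OF R_differentiable[OF c p]], of w]
    by (simp add: inner_add_right dot_cross_self)
  then show ?thesis using wRR_eq[OF c p] N_wRR_nonzero[OF c p] by (metis inner_scaleR_left mult_eq_0_iff)
qed

text \<open>\<open>N\<close> is the normalized cross product of the coordinate vectors in suitable
  coordinates. The cross product never vanishes, and the normalizing factor is the power -1/2 of its
  squared length, so \<open>N\<close> inherits C^1 regularity from the first derivatives of
  \<open>R\<close>.\<close>

lemma N_C1_on: "C1_on M N"
proof (rule C1_on_cover)
  fix p assume "p \<in> M"
  from curvature_coordinates_at[OF this] obtain U c where U: "p \<in> U" "LC U c" "curvature_line_coordinates M A R N U c"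
    "\<forall>q\<in>U. norm (N q) = 1" "\<forall>q\<in>U. wRR U c q = norm (wRR U c q) *\<^sub>R N q"
    by (elim exE conjE)
  let ?a = "\<lambda>q. cross3 (dR U c q (axis 1 1)) (dR U c q (axis 2 1))"
  have a: "C1_on U ?a"
    by (intro C1_on_bilinear[OF bounded_bilinear_cross3] differential_C1_on[OF R_smooth U(2)])
  have aa: "C1_on U (\<lambda>q. ?a q \<bullet> ?a q)"
    by (rule C1_on_bilinear[OF bounded_bilinear_inner a a])
  have a0: "?a q \<noteq> 0" if "q \<in> U" for q using wRR_nonzero[OF U(2) that] by (auto simp: wedge_self)
  have "C1_on U (\<lambda>q. (?a q \<bullet> ?a q) powr (-1/2))"
  proof (rule C1_on_compose_real[OF aa])
    show "((\<lambda>x. x powr (-1/2)) has_field_derivative (-1/2) * x powr (-1/2 - 1)) (at x)"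
      if "x \<in> (\<lambda>q. ?a q \<bullet> ?a q) ` U" for x :: real
      using that a0 by (intro has_real_derivative_powr) auto
    show "continuous_on ((\<lambda>q. ?a q \<bullet> ?a q) ` U) (\<lambda>x. (-1/2) * x powr (-1/2 - 1))"
      using a0 by (intro continuous_intros) auto
  qed
  from C1_on_bilinear[OF bounded_bilinear_scaleR this a] have "C1_on U N"
  proof (rule C1_on_cong)
    fix q assume q: "q \<in> U"
    have "2 *\<^sub>R ?a q = 2 *\<^sub>R (norm (?a q) *\<^sub>R N q)"
      using U(5)[rule_format, OF q] unfolding wedge_self norm_scaleR scaleR_scaleR[symmetric] by simp
    then have "?a q = norm (?a q) *\<^sub>R N q" by (metis scaleR_left_imp_eq zero_neq_numeral)
    then have "(1 / norm (?a q)) *\<^sub>R ?a q = (1 / norm (?a q)) *\<^sub>R (norm (?a q) *\<^sub>R N q)" by (rule arg_cong)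
    also have "\<dots> = N q" using a0[OF q] by simp
    finally show "(?a q \<bullet> ?a q) powr (-1/2) *\<^sub>R ?a q = N q"
      using a0[OF q] by (simp add: powr_minus_divide powr_half_sqrt norm_eq_sqrt_inner)
  qed
  then show "\<exists>Y. p \<in> Y \<and> Y \<subseteq> M \<and> C1_on Y N" using U(1) LC_subset[OF U(2)] by blast
qed

lemma N_differentiable: "LC U c \<Longrightarrow> p \<in> U \<Longrightarrow> coord_differentiable U c N p"
  using C1_on_differentiable[OF N_C1_on] LC_subset by blast

text \<open>The product rule for a constant inner product, applied to
  \<open>N \<bullet> N = 1\<close> and to the orthogonality of \<open>N\<close> and the coordinate
  vectors.\<close>

lemma inner_constant_differential:
  assumes c: "LC U c" and p: "p \<in> U" and f: "coord_differentiable U c f p" and g: "coord_differentiable U c g p"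
    and eq: "\<And>q. q \<in> U \<Longrightarrow> f q \<bullet> g q = k"
  shows "f p \<bullet> coord_differential U c g p w + coord_differential U c f p w \<bullet> g p = 0"
proof -
  have "coord_differential U c (\<lambda>q. f q \<bullet> g q) p = coord_differential U c (\<lambda>_. k) p"
    by (rule coord_differential_cong(2)[OF c LC_open[OF c] p p]) (use eq coord_differential_const(1)[OF c p] in auto)
  then show ?thesis
    using coord_differential_bilinear(2)[OF bounded_bilinear_inner c p f g, of w]
      coord_differential_const(2)[OF c p] by metis
qed

lemma N_inner_dN:
  assumes c: "LC U c" and p: "p \<in> U"
  shows "N p \<bullet> dN U c p w = 0"
proof -
  have "N q \<bullet> N q = 1" if "q \<in> U" for q using N_inner_N that LC_subset[OF c] by blast
  from inner_constant_differential[OF c p N_differentiable[OF c p] N_differentiable[OF c p] this, where w = w]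
  show ?thesis by (simp add: inner_commute)
qed

text \<open>The derivative of \<open>N\<close> along one coordinate is orthogonal to
  \<open>N\<close>, because \<open>N\<close> has unit length, and to the other coordinate vector,
  because differentiating \<open>N \<bullet> dR = 0\<close> turns that product into the off-diagonal
  second form. As the two coordinate vectors are orthogonal, only a multiple of the one along the
  given coordinate is left.\<close>

lemma principal_curvatures_exist:
  assumes p: "p \<in> U" and cur: "curvature_line_coordinates M A R N U c"
  shows "\<exists>k1 k2. coord_deriv U c 1 N p = - k1 *\<^sub>R coord_deriv U c 1 R p \<and>
                 coord_deriv U c 2 N p = - k2 *\<^sub>R coord_deriv U c 2 R p"
proof -
  have c: "LC U c" using cur by (simp add: curvature_line_coordinates_def)
  have orth: "dR U c p (axis 1 1) \<bullet> dR U c p (axis 2 1) = 0"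
    using cur p unfolding curvature_line_coordinates_def first_form_def coord_deriv_def by force
  have sf: "coord_differential U c (\<lambda>q. dR U c q (axis i 1)) p (axis j 1) \<bullet> N p = 0" if "i \<noteq> j" for i j :: 2
    using cur p that unfolding curvature_line_coordinates_def second_form_def coord_deriv_def by blast
  have dRd: "coord_differentiable U c (\<lambda>q. dR U c q w) p" for w
    using C1_on_differentiable[OF differential_C1_on[OF R_smooth c] c p p] .
  have off: "dN U c p (axis j 1) \<bullet> dR U c p (axis i 1) = 0" if "i \<noteq> j" for i j :: 2
    using inner_constant_differential[OF c p N_differentiable[OF c p] dRd
        N_inner_dR[OF c, where w = "axis i 1"], where w = "axis j 1"] sf[OF that] by (simp add: inner_commute)
  let ?x = "dR U c p (axis 1 1)" and ?y = "dR U c p (axis 2 1)"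
  have cr: "cross3 ?x ?y \<noteq> 0" using wRR_nonzero[OF c p] by (auto simp: wedge_self)
  then have x0: "?x \<bullet> ?x \<noteq> 0" "?y \<bullet> ?y \<noteq> 0" by auto
  have crN: "v \<bullet> cross3 ?x ?y = 0" if "N p \<bullet> v = 0" for v
  proof -
    have "v \<bullet> wRR U c p = 0"
      by (subst wRR_eq[OF c p]) (simp add: inner_commute[of v] that)
    then show ?thesis unfolding wedge_self by simp
  qed
  \<comment> \<open>Projection coefficients: they make \<open>N\<^sub>1 + k1 R\<^sub>1\<close>
    orthogonal to \<open>R\<^sub>1\<close>, and likewise for the second direction.\<close>
  let ?k1 = "- (dN U c p (axis 1 1) \<bullet> ?x) / (?x \<bullet> ?x)" and ?k2 = "- (dN U c p (axis 2 1) \<bullet> ?y) / (?y \<bullet> ?y)"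
  have "dN U c p (axis 1 1) + ?k1 *\<^sub>R ?x = 0"
    by (rule orthogonal_to_cross_basis_eq_0[OF _ _ crN cr])
       (use off[of 2 1] orth x0 N_inner_dN[OF c p] N_inner_dR[OF c p] in
         \<open>simp_all add: inner_diff_left inner_diff_right\<close>)
  moreover have "dN U c p (axis 2 1) + ?k2 *\<^sub>R ?y = 0"
    by (rule orthogonal_to_cross_basis_eq_0[OF _ _ crN cr])
       (use off[of 1 2] orth x0 N_inner_dN[OF c p] N_inner_dR[OF c p] in
         \<open>simp_all add: inner_diff_left inner_diff_right inner_commute\<close>)
  ultimately show ?thesis unfolding coord_deriv_def
    by (intro exI[of _ ?k1] exI[of _ ?k2]) (simp add: add_eq_0_iff2)
qed

text \<open>In the coordinates \<open>c\<close> the wedge is \<open>- k2 (R\<^sub>1 \<times>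
  R\<^sub>2) + k1 (R\<^sub>2 \<times> R\<^sub>1)\<close>, that is
  \<open>- (k1 + k2) (R\<^sub>1 \<times> R\<^sub>2)\<close>. In passing to other coordinates both
  sides take the same determinant.\<close>

lemma wedge_principal:
  assumes p: "p \<in> U" and c: "LC U c"
    and k: "coord_deriv U c 1 N p = - k1 *\<^sub>R coord_deriv U c 1 R p"
           "coord_deriv U c 2 N p = - k2 *\<^sub>R coord_deriv U c 2 R p"
    and c': "LC U' c'" and p': "p \<in> U'"
  shows "wedge (dR U' c' p) (dN U' c' p) = - ((k1 + k2) / 2) *\<^sub>R wRR U' c' p"
proof -
  have "wedge (dR U c p) (dN U c p) = - ((k1 + k2) / 2) *\<^sub>R wRR U c p"
    using k unfolding wedge_self wedge_def coord_deriv_def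
    by (simp add: cross_mult_right cross_skew[of "dR U c p (axis 2 1)"] algebra_simps flip: scaleR_add_left)
  then show ?thesis
    using wRR_change[OF c' c, of p] p p'
      wedge_change[OF c' c _ R_differentiable[OF c p] N_differentiable[OF c p]] by (simp add: algebra_simps)
qed

text \<open>Resolves the \<open>THE\<close> in \<open>mean_curvature\<close>. Any admissible value
  is, up to sign, the factor between the two wedges at \<open>p\<close>, and
  \<open>wRR U c p\<close> is nonzero, so there is only one such value.\<close>

lemma wedge_dR_dN:
  assumes c: "LC U c" and p: "p \<in> U"
  shows "wedge (dR U c p) (dN U c p) = - mean_curvature M A R N p *\<^sub>R wRR U c p"
proof -
  have pM: "p \<in> M" using p LC_subset[OF c] by blast
  obtain U' c' where U': "p \<in> U'" "LC U' c'" "curvature_line_coordinates M A R N U' c'"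
    using curvature_coordinates_at[OF pM] by (elim exE conjE)
  obtain k1 k2 where k: "coord_deriv U' c' 1 N p = - k1 *\<^sub>R coord_deriv U' c' 1 R p"
      "coord_deriv U' c' 2 N p = - k2 *\<^sub>R coord_deriv U' c' 2 R p"
    using principal_curvatures_exist[OF U'(1,3)] by (elim exE conjE)
  have eq: "wedge (dR U c p) (dN U c p) = - ((k1 + k2) / 2) *\<^sub>R wRR U c p"
    by (rule wedge_principal[OF U'(1,2) k c p])
  have "mean_curvature M A R N p = (k1 + k2) / 2"
    unfolding mean_curvature_def
  proof (rule the_equality)
    show "\<exists>U c k1' k2'. p \<in> U \<and> curvature_line_coordinates M A R N U c \<and>
        coord_deriv U c 1 N p = - k1' *\<^sub>R coord_deriv U c 1 R p \<and>
        coord_deriv U c 2 N p = - k2' *\<^sub>R coord_deriv U c 2 R p \<and> (k1 + k2) / 2 = (k1' + k2') / 2"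
      using U' k by (intro exI[of _ U'] exI[of _ c'] exI[of _ k1] exI[of _ k2]) simp
  next
    fix h assume "\<exists>U c k1 k2. p \<in> U \<and> curvature_line_coordinates M A R N U c \<and>
        coord_deriv U c 1 N p = - k1 *\<^sub>R coord_deriv U c 1 R p \<and>
        coord_deriv U c 2 N p = - k2 *\<^sub>R coord_deriv U c 2 R p \<and> h = (k1 + k2) / 2"
    then obtain U'' c'' l1 l2 where l: "p \<in> U''" "curvature_line_coordinates M A R N U'' c''"
        "coord_deriv U'' c'' 1 N p = - l1 *\<^sub>R coord_deriv U'' c'' 1 R p"
        "coord_deriv U'' c'' 2 N p = - l2 *\<^sub>R coord_deriv U'' c'' 2 R p" "h = (l1 + l2) / 2"
      by (elim exE conjE)
    have "LC U'' c''" using l(2) by (simp add: curvature_line_coordinates_def)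
    from wedge_principal[OF l(1) this l(3,4) c p]
    have "(- ((l1 + l2) / 2)) *\<^sub>R wRR U c p = (- ((k1 + k2) / 2)) *\<^sub>R wRR U c p"
      using eq by (rule trans[OF sym])
    then have "- ((l1 + l2) / 2) = - ((k1 + k2) / 2)"
      unfolding scaleR_cancel_right using wRR_nonzero[OF c p] by blast
    then show "h = (k1 + k2) / 2" using l(5) by simp
  qed
  then show ?thesis using eq by simp
qed

text \<open>The derivatives of \<open>R\<^sub>1\<close> and \<open>R\<^sub>2\<close> cancel because mixed derivatives commute.\<close>

lemma divergence_in_chart:
  assumes W: "(W, \<psi>) \<in> A" and p: "p \<in> W" and V: "coord_differentiable W \<psi> V p"
  shows "coord_differential W \<psi> (\<lambda>q. N q \<bullet> cross3 (V q) (dR W \<psi> q (axis 2 1))) p (axis 1 1) +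
         coord_differential W \<psi> (\<lambda>q. N q \<bullet> cross3 (dR W \<psi> q (axis 1 1)) (V q)) p (axis 2 1)
       = N p \<bullet> wedge (dR W \<psi> p) (coord_differential W \<psi> V p) + mean_curvature M A R N p * (V p \<bullet> wRR W \<psi> p)"
proof -
  note c = chart_local_coordinates[OF W]
  note dN = N_differentiable[OF c p]
  have dRd: "coord_differentiable W \<psi> (\<lambda>q. dR W \<psi> q w) p" for w
    using C1_on_differentiable[OF differential_C1_on[OF R_smooth c] c p p] .
  note x1 = coord_differential_bilinear[OF bounded_bilinear_cross3 c p V dRd]
  note x2 = coord_differential_bilinear[OF bounded_bilinear_cross3 c p dRd V]
  note y1 = coord_differential_bilinear(2)[OF bounded_bilinear_inner c p dN x1(1)]
  note y2 = coord_differential_bilinear(2)[OF bounded_bilinear_inner c p dN x2(1)]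
  define r1 r2 n1 n2 v1 v2 m where "r1 = dR W \<psi> p (axis 1 1)" and "r2 = dR W \<psi> p (axis 2 1)"
    and "n1 = dN W \<psi> p (axis 1 1)" and "n2 = dN W \<psi> p (axis 2 1)"
    and "v1 = coord_differential W \<psi> V p (axis 1 1)" and "v2 = coord_differential W \<psi> V p (axis 2 1)"
    and "m = coord_differential W \<psi> (\<lambda>p. dR W \<psi> p (axis 1 1)) p (axis 2 1)"
  have m': "coord_differential W \<psi> (\<lambda>p. dR W \<psi> p (axis 2 1)) p (axis 1 1) = m"
    unfolding m_def by (rule mixed_coord_differentials_commute[OF R_smooth W p])
  have "coord_differential W \<psi> (\<lambda>q. N q \<bullet> cross3 (V q) (dR W \<psi> q (axis 2 1))) p (axis 1 1) +
         coord_differential W \<psi> (\<lambda>q. N q \<bullet> cross3 (dR W \<psi> q (axis 1 1)) (V q)) p (axis 2 1)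
      = N p \<bullet> (cross3 (V p) m + cross3 v1 r2) + n1 \<bullet> cross3 (V p) r2
        + (N p \<bullet> (cross3 r1 v2 + cross3 m (V p)) + n2 \<bullet> cross3 r1 (V p))"
    unfolding y1 y2 x1(2) x2(2) m' r1_def[symmetric] r2_def[symmetric] n1_def[symmetric] n2_def[symmetric]
      v1_def[symmetric] v2_def[symmetric] m_def[symmetric] by simp
  \<comment> \<open>Cyclic invariance of the triple product turns
    \<open>n1 \<bullet> (V \<times> r2) + n2 \<bullet> (r1 \<times> V)\<close> into minus
    \<open>V \<bullet> (r1 \<times> n2 - r2 \<times> n1)\<close>, and the bracket is the wedge of
    \<open>R\<close> and \<open>N\<close>.\<close>
  also have "\<dots> = N p \<bullet> (cross3 r1 v2 - cross3 r2 v1) - V p \<bullet> (cross3 r1 n2 - cross3 r2 n1)"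
    by (simp add: cross3_simps)
  also have "\<dots> = N p \<bullet> wedge (dR W \<psi> p) (coord_differential W \<psi> V p) - V p \<bullet> wedge (dR W \<psi> p) (dN W \<psi> p)"
    by (simp add: wedge_def r1_def r2_def n1_def n2_def v1_def v2_def)
  also have "\<dots> = N p \<bullet> wedge (dR W \<psi> p) (coord_differential W \<psi> V p) + mean_curvature M A R N p * (V p \<bullet> wRR W \<psi> p)"
    by (simp add: wedge_dR_dN[OF c p])
  finally show ?thesis .
qed

end

subsection \<open>The area measure\<close>

context surface_atlas begin

abbreviation BM :: "'a measure" where "BM \<equiv> restrict_space borel M"

lemma openin_sets_restrict_borel:
  assumes "openin (top_of_set X) S" shows "S \<in> sets (restrict_space borel X)"
proof -
  obtain T where "open T" "S = X \<inter> T" using assms by (auto simp: openin_open)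
  then show ?thesis by (auto simp: sets_restrict_space)
qed

lemma LC_sets: "LC U c \<Longrightarrow> U \<in> sets BM"
  using LC_open openin_sets_restrict_borel by blast

text \<open>The image need not be open, nor relatively open in a half-plane. Over each chart it is
  homeomorphic to a relatively open subset of the closed half-plane, hence locally compact, hence
  the intersection of a closed and an open set. Countably many charts suffice by Lindelof.\<close>

lemma borel_image_local_coordinates:
  assumes c: "LC U c" shows "c ` U \<in> sets borel"
proof -
  have piece: "c ` (U \<inter> W) \<in> sets borel" if W: "(W, \<psi>) \<in> A" for W \<psi>
  proof -
    note \<psi> = chart_local_coordinates[OF W]
    have "closed half_plane"
      unfolding half_plane_def by (intro closed_Collect_le continuous_intros)
    then have "locally compact half_plane" by (rule closed_imp_locally_compact)
    moreover have "openin (top_of_set half_plane) (\<psi> ` (U \<inter> W))"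
      using chart_subset_image_open[OF W openin_Int[OF LC_open[OF c] LC_open[OF \<psi>]]] by simp
    ultimately have "locally compact (\<psi> ` (U \<inter> W))" by (rule locally_open_subset)
    moreover have "c ` (U \<inter> W) homeomorphic \<psi> ` (U \<inter> W)"
      unfolding homeomorphic_def homeomorphism_def
    proof (intro exI conjI)
      let ?f = "\<psi> \<circ> inv_into U c" and ?g = "c \<circ> inv_into W \<psi>"
      show "continuous_on (c ` (U \<inter> W)) ?f" "continuous_on (\<psi> ` (U \<inter> W)) ?g"
        using transition_smooth[OF c W] smooth_on_imp_continuous_on by blast+
      have f: "?f (c p) = \<psi> p" and g: "?g (\<psi> p) = c p" if "p \<in> U \<inter> W" for p
        using that by (simp_all add: LC_inv[OF c] LC_inv[OF \<psi>])
      show "?f ` c ` (U \<inter> W) = \<psi> ` (U \<inter> W)" "?g ` \<psi> ` (U \<inter> W) = c ` (U \<inter> W)"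
        unfolding image_image by (rule image_cong[OF refl f], simp) (rule image_cong[OF refl g], simp)
      show "\<forall>x\<in>c ` (U \<inter> W). ?g (?f x) = x" "\<forall>y\<in>\<psi> ` (U \<inter> W). ?f (?g y) = y"
        using f g by (simp_all del: comp_apply)
    qed
    ultimately have "locally compact (c ` (U \<inter> W))"
      using homeomorphic_local_compactness by blast
    then obtain F O' where "closed F" "open O'" "c ` (U \<inter> W) = F \<inter> O'"
      unfolding locally_compact_closed_Int_open by (elim exE conjE)
    then show ?thesis by auto
  qed
  let ?\<F> = "(\<lambda>x. U \<inter> fst x) ` A"
  have "openin (top_of_set M) S" if "S \<in> ?\<F>" for S
    using that chart_open openin_Int[OF LC_open[OF c]] by fastforce
  then obtain \<F>' where F: "\<F>' \<subseteq> ?\<F>" "countable \<F>'" "\<Union>\<F>' = \<Union>?\<F>"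
    using Lindelof_openin[of ?\<F> M] by metis
  have "U \<subseteq> \<Union>?\<F>"
  proof
    fix p assume p: "p \<in> U"
    then have "p \<in> M" using LC_subset[OF c] by blast
    then obtain W \<psi> where "(W, \<psi>) \<in> A" "p \<in> W" by (rule chart_at)
    then show "p \<in> \<Union>?\<F>" using p by (intro UnionI[of "U \<inter> W"] image_eqI[of _ _ "(W, \<psi>)"]) auto
  qed
  moreover have "\<Union>\<F>' \<subseteq> U" using F(1) by auto
  ultimately have "\<Union>\<F>' = U" using F(3) by auto
  then have "c ` U = (\<Union>S\<in>\<F>'. c ` S)" by auto
  moreover have "c ` S \<in> sets borel" if "S \<in> \<F>'" for S
  proof -
    from that F(1) have "S \<in> ?\<F>" by blast
    then obtain x where "S = U \<inter> fst x" "x \<in> A" by (rule imageE)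
    then show ?thesis using piece[of "fst x" "snd x"] by simp
  qed
  ultimately show ?thesis using F(2) by (auto intro: sets.countable_UN')
qed

lemma vimage_inv_into:
  assumes "LC U c" "E \<subseteq> U" shows "{x\<in>c ` U. inv_into U c x \<in> E} = c ` E"
  using assms LC_inv[OF assms(1)] by (auto simp: subset_iff)

lemma measurable_inv_into:
  assumes c: "LC U c"
  shows "inv_into U c \<in> measurable (restrict_space lborel (c ` U)) (restrict_space BM U)"
proof (rule measurable_restrict_space2)
  show "inv_into U c \<in> space (restrict_space lborel (c ` U)) \<rightarrow> U"
    by (auto simp: space_restrict_space inv_into_into)
  have "inv_into U c \<in> borel_measurable (restrict_space lborel (c ` U))"
    using borel_measurable_continuous_on_restrict[OF LC_continuous_inv[OF c]]
    by (simp add: measurable_cong_sets[OF sets_restrict_space_cong[OF sets_lborel]])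
  moreover have "inv_into U c \<in> space (restrict_space lborel (c ` U)) \<rightarrow> M"
    using LC_subset[OF c] by (auto simp: space_restrict_space inv_into_into subset_iff)
  ultimately show "inv_into U c \<in> restrict_space lborel (c ` U) \<rightarrow>\<^sub>M BM"
    by (rule measurable_restrict_space2[rotated])
qed

text \<open>The image of \<open>E\<close> is the preimage of a Borel set under the inverse of
  \<open>c\<close>, which is continuous on a Borel domain.\<close>

lemma borel_image:
  assumes c: "LC U c" and E: "E \<in> sets BM" "E \<subseteq> U"
  shows "c ` E \<in> sets borel"
proof -
  obtain B where B: "B \<in> sets borel" "E = M \<inter> B" using E(1) by (auto simp: sets_restrict_space)
  have "inv_into U c -` B \<inter> space (restrict_space borel (c ` U)) \<in> sets (restrict_space borel (c ` U))"
    using borel_measurable_continuous_on_restrict[OF LC_continuous_inv[OF c]] B(1) by (rule measurable_sets)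
  moreover have "inv_into U c -` B \<inter> space (restrict_space borel (c ` U)) = c ` E"
  proof -
    have "inv_into U c -` B \<inter> space (restrict_space borel (c ` U)) = {x \<in> c ` U. inv_into U c x \<in> E}"
      using B(2) LC_subset[OF c] inv_into_into[of _ c U] by (fastforce simp: space_restrict_space)
    then show ?thesis using vimage_inv_into[OF c E(2)] by simp
  qed
  ultimately show ?thesis
    using borel_image_local_coordinates[OF c] by (simp add: sets_restrict_space_iff)
qed

definition chart_area :: "('a \<Rightarrow> real^3) \<Rightarrow> 'a set \<Rightarrow> ('a \<Rightarrow> real^2) \<Rightarrow> 'a set \<Rightarrow> ennreal" where
  "chart_area r U c E = (\<integral>\<^sup>+ x\<in>c ` E. ennreal (area_density U c r (inv_into U c x)) \<partial>lborel)"

lemma continuous_on_wedge: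
  assumes "C1_on X f" "C1_on X g" "LC U c"
  shows "continuous_on (U \<inter> X) (\<lambda>p. wedge (coord_differential U c f p) (coord_differential U c g p))"
  unfolding wedge_def
  by (intro continuous_intros continuous_on_cross C1_on_continuous_differential assms)

lemma continuous_on_area_density:
  assumes r: "C1_on M r" and c: "LC U c"
  shows "continuous_on U (area_density U c r)"
proof -
  have "continuous_on (U \<inter> M) (\<lambda>p. norm (wedge (coord_differential U c r p) (coord_differential U c r p)) / 2)"
    by (intro continuous_intros continuous_on_wedge[OF r r c]) auto
  then show ?thesis
    using LC_subset[OF c] by (simp add: area_density_wedge[abs_def] Int_absorb2)
qed

lemma measurable_chart_density:
  assumes r: "C1_on M r" and c: "LC U c" and E: "E \<in> sets BM" "E \<subseteq> U"
  shows "(\<lambda>x. indicator (c ` E) x * area_density U c r (inv_into U c x)) \<in> borel_measurable borel"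
proof -
  have "continuous_on (c ` U) (\<lambda>x. area_density U c r (inv_into U c x))"
    using continuous_on_compose2[OF continuous_on_area_density[OF r c] LC_continuous_inv[OF c]]
      inv_into_into[of _ c U] by auto
  then have "continuous_on (c ` E) (\<lambda>x. area_density U c r (inv_into U c x))"
    by (rule continuous_on_subset) (use E(2) in auto)
  from borel_measurable_continuous_on_indicator[OF borel_image[OF c E] this] show ?thesis by simp
qed

lemma area_density_change:
  assumes r: "C1_on M r" and c: "LC U c" and c': "LC U' c'" and p: "p \<in> U \<inter> U'"
  shows "area_density U' c' r p = \<bar>det (matrix (coord_differential U' c' c p))\<bar> * area_density U c r p"
proof -
  have d: "coord_differentiable U c r p" using C1_on_differentiable[OF r c] p LC_subset[OF c] by blast
  have p': "p \<in> U' \<inter> U" using p by blast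
  show ?thesis unfolding area_density_wedge wedge_change[OF c' c p' d d] by simp
qed

text \<open>The transition from \<open>c'\<close> to \<open>c\<close> is injective and
  differentiable on the image of \<open>E\<close>, and the area density changes by the absolute
  value of the determinant, so this is the change of variables formula.\<close>

lemma chart_area_compatible:
  assumes r: "C1_on M r" and c: "LC U c" and c': "LC U' c'"
    and E: "E \<in> sets BM" "E \<subseteq> U \<inter> U'"
  shows "chart_area r U c E = chart_area r U' c' E"
proof -
  let ?S = "c' ` E" and ?g = "c \<circ> inv_into U' c'" and ?d = "\<lambda>x. coord_differential U' c' c (inv_into U' c' x)"
  have E': "E \<subseteq> U" "E \<subseteq> U'" using E by auto
  have gS: "?g ` ?S = c ` E"
    unfolding image_image by (rule image_cong[OF refl]) (use E' in \<open>auto simp: LC_inv[OF c'] subset_iff\<close>)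
  have dens: "area_density U' c' r (inv_into U' c' x)
      = \<bar>det (matrix (?d x))\<bar> * area_density U c r (inv_into U c (?g x))" if "x \<in> ?S" for x
    using that E' area_density_change[OF r c c'] by (auto simp: LC_inv[OF c] LC_inv[OF c'] subset_iff)
  have "(\<integral>\<^sup>+x\<in>?S. ennreal (\<bar>det (matrix (?d x))\<bar> * area_density U c r (inv_into U c (?g x))) \<partial>lborel)
      = (\<integral>\<^sup>+y\<in>?g ` ?S. ennreal (area_density U c r (inv_into U c y)) \<partial>lborel)"
  proof (rule nn_integral_change_of_variables_vec)
    show "?S \<in> sets lebesgue" using borel_image[OF c' E(1) E'(2)] by simp
    show "(?g has_derivative ?d x) (at x within ?S)" if "x \<in> ?S" for x
    proof -
      obtain p where p: "p \<in> E" "x = c' p" using \<open>x \<in> ?S\<close> by blast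
      then have "(?g has_derivative coord_differential U' c' c p) (at (c' p) within c' ` U')"
        using coord_differential_works[OF coordinate_change_differentiable(1)[OF c' c, of p]] E' by blast
      then show ?thesis
        using p E' by (auto simp: LC_inv[OF c'] subset_iff intro: has_derivative_subset)
    qed
    show "inj_on ?g ?S"
      using LC_inj[OF c] E' by (auto simp: inj_on_def LC_inv[OF c'] subset_iff)
    show "(\<lambda>y. indicator (?g ` ?S) y * area_density U c r (inv_into U c y)) \<in> borel_measurable lebesgue"
      unfolding gS using measurable_chart_density[OF r c E(1) E'(1)] by (simp add: measurable_completion)
    have "(\<lambda>x. indicator ?S x * area_density U' c' r (inv_into U' c' x)) \<in> borel_measurable lebesgue"
      using measurable_chart_density[OF r c' E(1) E'(2)] by (simp add: measurable_completion)
    moreover have "(\<lambda>x. indicator ?S x * area_density U' c' r (inv_into U' c' x)) =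
        (\<lambda>x. indicator ?S x * (\<bar>det (matrix (?d x))\<bar> * area_density U c r (inv_into U c (?g x))))"
      using dens by (auto simp: indicator_def)
    ultimately show "(\<lambda>x. indicator ?S x * (\<bar>det (matrix (?d x))\<bar> * area_density U c r (inv_into U c (?g x))))
        \<in> borel_measurable lebesgue" by simp
  qed (simp add: area_density_def)
  moreover have "(\<integral>\<^sup>+x\<in>?S. ennreal (\<bar>det (matrix (?d x))\<bar> * area_density U c r (inv_into U c (?g x))) \<partial>lborel)
      = (\<integral>\<^sup>+x\<in>?S. ennreal (area_density U' c' r (inv_into U' c' x)) \<partial>lborel)"
    by (rule nn_integral_cong) (use dens in \<open>auto simp: indicator_def\<close>)
  ultimately show ?thesis unfolding chart_area_def gS by simp
qed

text \<open>On subsets of \<open>U\<close> the local area is the value of one density measure of the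
  plane on the image, and \<open>c\<close> is injective, so disjoint sets have disjoint
  images.\<close>

lemma chart_area_sums:
  assumes r: "C1_on M r" and c: "LC U c"
    and F: "range F \<subseteq> sets BM" "\<Union>(range F) \<subseteq> U" "disjoint_family F"
  shows "(\<Sum>i::nat. chart_area r U c (F i)) = chart_area r U c (\<Union>(range F))"
proof -
  let ?f = "\<lambda>x. ennreal (indicator (c ` U) x * area_density U c r (inv_into U c x))"
  have m: "?f \<in> borel_measurable lborel"
    using measurable_chart_density[OF r c LC_sets[OF c] order_refl] by simp
  have em: "chart_area r U c E = emeasure (density lborel ?f) (c ` E)" if "E \<in> sets BM" "E \<subseteq> U" for E
  proof -
    have "emeasure (density lborel ?f) (c ` E) = (\<integral>\<^sup>+x\<in>c ` E. ?f x \<partial>lborel)"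
      using borel_image[OF c that] by (intro emeasure_density m) simp
    also have "\<dots> = chart_area r U c E"
      unfolding chart_area_def using that by (intro nn_integral_cong) (auto simp: indicator_def)
    finally show ?thesis ..
  qed
  have Fi: "F i \<in> sets BM" "F i \<subseteq> U" for i using F by auto
  have "(\<Sum>i. chart_area r U c (F i)) = (\<Sum>i. emeasure (density lborel ?f) (c ` F i))"
    using em Fi by simp
  also have "\<dots> = emeasure (density lborel ?f) (\<Union>i. c ` F i)"
  proof (rule suminf_emeasure)
    show "range (\<lambda>i. c ` F i) \<subseteq> sets (density lborel ?f)" using borel_image[OF c Fi] by auto
    show "disjoint_family (\<lambda>i. c ` F i)"
      using F(3) LC_inj[OF c] Fi(2) unfolding disjoint_family_on_def
      by (metis UNIV_I image_empty inj_on_image_Int)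
  qed
  also have "\<dots> = chart_area r U c (\<Union>(range F))"
    using em[of "\<Union>(range F)"] F(1,2) by (auto simp: image_UN)
  finally show ?thesis .
qed

definition is_area_measure :: "('a \<Rightarrow> real^3) \<Rightarrow> 'a measure \<Rightarrow> bool" where
  "is_area_measure r \<mu> \<longleftrightarrow> sets \<mu> = sets BM \<and>
     (\<forall>U c. LC U c \<longrightarrow> (\<forall>E\<in>sets \<mu>. E \<subseteq> U \<longrightarrow> emeasure \<mu> E = chart_area r U c E))"

text \<open>Stated for any C^1 map because the deformed surfaces \<open>R + t V\<close> also need an
  area measure, and they may degenerate.\<close>

lemma ex1_area_measure:
  assumes r: "C1_on M r"
  shows "\<exists>!\<mu>. is_area_measure r \<mu>"
proof -
  let ?\<C> = "{(U, chart_area r U c) |U c. LC U c}"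
  have "\<exists>!\<mu>. sets \<mu> = sets BM \<and> (\<forall>(U, m)\<in>?\<C>. \<forall>E\<in>sets \<mu>. E \<subseteq> U \<longrightarrow> emeasure \<mu> E = m E)"
  proof (rule ex1_measure_gluing)
    fix U m assume "(U, m) \<in> ?\<C>"
    then obtain c where c: "LC U c" "m = chart_area r U c" by auto
    show "openin (top_of_set M) U" by (rule LC_open[OF c(1)])
    show "m {} = 0" by (simp add: c(2) chart_area_def)
    show "(\<Sum>i::nat. m (F i)) = m (\<Union>(range F))"
      if "range F \<subseteq> sets BM" "\<Union>(range F) \<subseteq> U" "disjoint_family F" for F
      unfolding c(2) by (rule chart_area_sums[OF r c(1) that])
    fix U' m' E assume "(U', m') \<in> ?\<C>" and E: "E \<in> sets BM" "E \<subseteq> U \<inter> U'"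
    then obtain c' where c': "LC U' c'" "m' = chart_area r U' c'" by auto
    show "m E = m' E" unfolding c(2) c'(2) by (rule chart_area_compatible[OF r c(1) c'(1) E])
  next
    show "M \<subseteq> (\<Union>(U, m)\<in>?\<C>. U)"
    proof
      fix p assume "p \<in> M"
      then obtain W \<psi> where W: "(W, \<psi>) \<in> A" "p \<in> W" by (rule chart_at)
      then have "(W, chart_area r W \<psi>) \<in> ?\<C>" using chart_local_coordinates by blast
      then show "p \<in> (\<Union>(U, m)\<in>?\<C>. U)" using W(2) by blast
    qed
  qed
  moreover have "(\<forall>(U, m)\<in>?\<C>. \<forall>E\<in>sets \<mu>. E \<subseteq> U \<longrightarrow> emeasure \<mu> E = m E) \<longleftrightarrow>
      (\<forall>U c. LC U c \<longrightarrow> (\<forall>E\<in>sets \<mu>. E \<subseteq> U \<longrightarrow> emeasure \<mu> E = chart_area r U c E))" for \<mu>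
    by auto
  ultimately show ?thesis unfolding is_area_measure_def by simp
qed

lemma area_measure_eq_The: "area_measure M A r = The (is_area_measure r)"
  unfolding area_measure_def is_area_measure_def chart_area_def ..

lemma area_measure_is_area_measure: "C1_on M r \<Longrightarrow> is_area_measure r (area_measure M A r)"
  unfolding area_measure_eq_The by (rule theI'[OF ex1_area_measure])

lemma area_measure_unique: "C1_on M r \<Longrightarrow> is_area_measure r \<mu> \<Longrightarrow> \<mu> = area_measure M A r"
  using ex1_area_measure area_measure_is_area_measure by blast

lemma sets_area_measure: "C1_on M r \<Longrightarrow> sets (area_measure M A r) = sets BM"
  and space_area_measure: "C1_on M r \<Longrightarrow> space (area_measure M A r) = M"
proof -
  assume r: "C1_on M r"
  show s: "sets (area_measure M A r) = sets BM"
    using area_measure_is_area_measure[OF r] by (simp add: is_area_measure_def)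
  show "space (area_measure M A r) = M"
    using sets_eq_imp_space_eq[OF s] by (simp add: space_restrict_space)
qed

lemma area_measure_pullback_facts:
  assumes r: "C1_on M r" and c: "LC U c"
  shows "U \<in> sets (area_measure M A r)" "c ` U \<in> sets lborel"
    and "inv_into U c \<in> measurable (restrict_space lborel (c ` U)) (restrict_space (area_measure M A r) U)"
    and "(\<lambda>x. area_density U c r (inv_into U c x)) \<in> borel_measurable (restrict_space lborel (c ` U))"
    and "\<And>E. E \<in> sets (area_measure M A r) \<Longrightarrow> E \<subseteq> U \<Longrightarrow> emeasure (area_measure M A r) E =
      (\<integral>\<^sup>+x. ennreal (area_density U c r (inv_into U c x)) * indicator {x\<in>c ` U. inv_into U c x \<in> E} x \<partial>lborel)"
proof -
  show "U \<in> sets (area_measure M A r)" using LC_sets[OF c] sets_area_measure[OF r] by simp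
  show "c ` U \<in> sets lborel" using borel_image_local_coordinates[OF c] by simp
  show "inv_into U c \<in> measurable (restrict_space lborel (c ` U)) (restrict_space (area_measure M A r) U)"
    using measurable_inv_into[OF c]
    by (simp add: measurable_cong_sets[OF refl sets_restrict_space_cong[OF sets_area_measure[OF r]]])
  have "continuous_on (c ` U) (\<lambda>x. area_density U c r (inv_into U c x))"
    using continuous_on_compose2[OF continuous_on_area_density[OF r c] LC_continuous_inv[OF c]]
      inv_into_into[of _ c U] by auto
  from borel_measurable_continuous_on_restrict[OF this]
  show "(\<lambda>x. area_density U c r (inv_into U c x)) \<in> borel_measurable (restrict_space lborel (c ` U))"
    by (simp add: measurable_cong_sets[OF sets_restrict_space_cong[OF sets_lborel]])
  show "emeasure (area_measure M A r) E =
      (\<integral>\<^sup>+x. ennreal (area_density U c r (inv_into U c x)) * indicator {x\<in>c ` U. inv_into U c x \<in> E} x \<partial>lborel)"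
    if "E \<in> sets (area_measure M A r)" "E \<subseteq> U" for E
    using area_measure_is_area_measure[OF r] c that
    unfolding is_area_measure_def chart_area_def vimage_inv_into[OF c that(2)] by blast
qed

lemma nn_integral_area_measure:
  assumes r: "C1_on M r" and c: "LC U c" and f: "f \<in> borel_measurable (area_measure M A r)"
    and f0: "\<And>p. p \<in> M - U \<Longrightarrow> f p = 0"
  shows "(\<integral>\<^sup>+p. f p \<partial>area_measure M A r) =
    (\<integral>\<^sup>+x. ennreal (area_density U c r (inv_into U c x)) * f (inv_into U c x) * indicator (c ` U) x \<partial>lborel)"
  using area_measure_pullback_facts[OF r c]
  by (intro nn_integral_pullback f) (auto simp: space_area_measure[OF r] f0)

lemma area_density_nonneg: "0 \<le> area_density U c r p"
  by (simp add: area_density_def)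

lemma integral_area_measure:
  assumes r: "C1_on M r" and c: "LC U c" and f: "f \<in> borel_measurable (area_measure M A r)"
    and f0: "\<And>p. p \<in> M - U \<Longrightarrow> f p = 0"
  shows "(\<integral>p. f p \<partial>area_measure M A r) =
    (\<integral>x. indicator (c ` U) x * (area_density U c r (inv_into U c x) * f (inv_into U c x)) \<partial>lborel)"
  using area_measure_pullback_facts[OF r c]
  by (intro integral_pullback f) (auto simp: area_density_nonneg space_area_measure[OF r] f0)

end

subsection \<open>The boundary and its length measure\<close>

context surface_atlas begin

abbreviation bd :: "'a set" where "bd \<equiv> manifold_boundary A"
abbreviation BB :: "'a measure" where "BB \<equiv> restrict_space borel bd"

lemma chart_half_plane: "(U, \<phi>) \<in> A \<Longrightarrow> p \<in> U \<Longrightarrow> 0 \<le> \<phi> p $ 2"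
  using openin_imp_subset[OF chart_image_open, of U \<phi>] by (auto simp: half_plane_def)

lemma bd_subset: "bd \<subseteq> M"
  using chart_open openin_imp_subset by (fastforce simp: manifold_boundary_def)

lemma transition_derivative_within:
  assumes U: "(U, \<phi>) \<in> A" and W: "(W, \<psi>) \<in> A" and p: "p \<in> U \<inter> W"
  shows "((\<phi> \<circ> inv_into W \<psi>) has_derivative coord_differential W \<psi> \<phi> p) (at (\<psi> p) within \<psi> ` (U \<inter> W))"
proof -
  note c = chart_local_coordinates[OF U] and c' = chart_local_coordinates[OF W]
  have p': "p \<in> W \<inter> U" using p by blast
  have "((\<phi> \<circ> inv_into W \<psi>) has_derivative coord_differential W \<psi> \<phi> p) (at (\<psi> p) within \<psi> ` W)"
    by (rule coord_differential_works[OF coordinate_change_differentiable(1)[OF c' c p']])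
  then show ?thesis by (rule has_derivative_subset) auto
qed

lemma chart_overlap_open:
  assumes U: "(U, \<phi>) \<in> A" and W: "(W, \<psi>) \<in> A" and p: "p \<in> U \<inter> W"
  shows "\<exists>e>0. ball (\<psi> p) e \<inter> half_plane \<subseteq> \<psi> ` (U \<inter> W)"
proof -
  have "openin (top_of_set half_plane) (\<psi> ` (U \<inter> W))"
    using chart_subset_image_open[OF W openin_Int[OF chart_open[OF U] chart_open[OF W]]] by simp
  moreover have "\<psi> p \<in> \<psi> ` (U \<inter> W)" using p by blast
  ultimately show ?thesis unfolding openin_contains_ball by blast
qed

text \<open>If \<open>\<psi> p\<close> were interior, the transition would be defined on a full
  disc, and its second component would have a minimum, namely 0, at the centre. The second row of
  the Jacobian would vanish, against invertibility.\<close>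

lemma boundary_invariant:
  assumes U: "(U, \<phi>) \<in> A" and W: "(W, \<psi>) \<in> A" and p: "p \<in> U \<inter> W" and 0: "\<phi> p $ 2 = 0"
  shows "\<psi> p $ 2 = 0"
proof (rule ccontr)
  assume "\<psi> p $ 2 \<noteq> 0"
  then have pos: "\<psi> p $ 2 > 0" using chart_half_plane[OF W] p by (metis IntD2 order_le_less)
  note c = chart_local_coordinates[OF U] and c' = chart_local_coordinates[OF W]
  have p': "p \<in> W \<inter> U" using p by blast
  let ?J = "coord_differential W \<psi> \<phi> p"
  obtain e where e: "e > 0" "ball (\<psi> p) e \<inter> half_plane \<subseteq> \<psi> ` (U \<inter> W)"
    using chart_overlap_open[OF U W p] by blast
  \<comment> \<open>A disc whose radius is at most the height of its centre lies in the
    half-plane.\<close>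
  define d where "d = min e (\<psi> p $ 2)"
  have "x \<in> half_plane" if "x \<in> ball (\<psi> p) d" for x
  proof -
    have "\<bar>(\<psi> p - x) $ 2\<bar> < \<psi> p $ 2"
      using component_le_norm_cart[of "\<psi> p - x" 2] that by (simp add: d_def dist_norm)
    then show ?thesis by (auto simp: half_plane_def)
  qed
  then have ball: "ball (\<psi> p) d \<subseteq> \<psi> ` (U \<inter> W)" and d: "d > 0"
    using e pos unfolding d_def by auto
  let ?f = "\<lambda>x. (\<phi> \<circ> inv_into W \<psi>) x $ 2"
  have "((\<phi> \<circ> inv_into W \<psi>) has_derivative ?J) (at (\<psi> p) within ball (\<psi> p) d)"
    by (rule has_derivative_subset[OF transition_derivative_within[OF U W p] ball])
  then have "((\<phi> \<circ> inv_into W \<psi>) has_derivative ?J) (at (\<psi> p))"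
    using d by (subst (asm) at_within_open) auto
  then have der: "(?f has_derivative (\<lambda>w. ?J w $ 2)) (at (\<psi> p))"
    by (rule bounded_linear.has_derivative[OF bounded_linear_vec_nth])
  have min: "\<forall>x\<in>ball (\<psi> p) d. ?f (\<psi> p) \<le> ?f x"
  proof
    fix x assume "x \<in> ball (\<psi> p) d"
    then obtain q where q: "q \<in> U \<inter> W" "x = \<psi> q" using ball by blast
    then show "?f (\<psi> p) \<le> ?f x"
      using chart_half_plane[OF U, of q] p 0 by (simp add: LC_inv[OF c'])
  qed
  have "(\<lambda>w. ?J w $ 2) = (\<lambda>v. 0)"
    by (rule differential_zero_maxmin[OF _ open_ball[of "\<psi> p" d] der disjI2[OF min]]) (use d in simp)
  then have "?J w $ 2 = 0" for w by metis
  then have "det (matrix ?J) = 0" by (simp add: det_matrix_vec2)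
  then show False using det_change_nonzero[OF c' c p'] by simp
qed

lemma boundary_iff:
  assumes U: "(U, \<phi>) \<in> A" and p: "p \<in> U"
  shows "p \<in> bd \<longleftrightarrow> \<phi> p $ 2 = 0"
proof
  assume "p \<in> bd"
  then obtain W \<psi> where "(W, \<psi>) \<in> A" "p \<in> W" "\<psi> p $ 2 = 0" by (auto simp: manifold_boundary_def)
  then show "\<phi> p $ 2 = 0" using boundary_invariant[OF _ U] p by blast
next
  assume "\<phi> p $ 2 = 0"
  then show "p \<in> bd" using U p by (auto simp: manifold_boundary_def)
qed

text \<open>A transition maps the boundary line into itself and the half-plane into itself. The
  first fact makes the Jacobian triangular, the second makes its lower right entry nonnegative, and
  invertibility excludes zeros on the diagonal.\<close>

lemma boundary_transition:
  assumes U: "(U, \<phi>) \<in> A" and W: "(W, \<psi>) \<in> A" and p: "p \<in> U \<inter> W" and bd: "p \<in> bd"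
  defines "J \<equiv> coord_differential W \<psi> \<phi> p"
  shows "J (axis 1 1) $ 2 = 0" "J (axis 1 1) $ 1 \<noteq> 0" "J (axis 2 1) $ 2 > 0"
proof -
  note c = chart_local_coordinates[OF U] and c' = chart_local_coordinates[OF W]
  have p': "p \<in> W \<inter> U" using p by blast
  have l: "linear J"
    unfolding J_def by (rule linear_coord_differential[OF coordinate_change_differentiable(1)[OF c' c p']])
  have z: "\<psi> p $ 2 = 0" "\<phi> p $ 2 = 0" using boundary_iff[OF W] boundary_iff[OF U] p bd by auto
  obtain e where e: "e > 0" "ball (\<psi> p) e \<inter> half_plane \<subseteq> \<psi> ` (U \<inter> W)"
    using chart_overlap_open[OF U W p] by blast
  let ?f = "\<lambda>v s. (\<phi> \<circ> inv_into W \<psi>) (\<psi> p + s *\<^sub>R v) $ 2"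
  have der: "((?f v) has_real_derivative J v $ 2) (at 0 within S)"
    if S: "\<And>s. s \<in> S \<Longrightarrow> \<psi> p + s *\<^sub>R v \<in> \<psi> ` (U \<inter> W)" for v S
  proof -
    have "((\<lambda>s. (\<phi> \<circ> inv_into W \<psi>) (\<psi> p + s *\<^sub>R v)) has_derivative (\<lambda>h. J (h *\<^sub>R v))) (at 0 within S)"
    proof (rule has_derivative_in_compose[where f = "\<lambda>s. \<psi> p + s *\<^sub>R v" and g = "\<phi> \<circ> inv_into W \<psi>" and g' = J])
      show "((\<lambda>s. \<psi> p + s *\<^sub>R v) has_derivative (\<lambda>h. h *\<^sub>R v)) (at 0 within S)"
        by (auto intro!: derivative_eq_intros)
      have "(\<lambda>s. \<psi> p + s *\<^sub>R v) ` S \<subseteq> \<psi> ` (U \<inter> W)" using S by blast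
      from has_derivative_subset[OF transition_derivative_within[OF U W p] this]
      show "(\<phi> \<circ> inv_into W \<psi> has_derivative J) (at (\<psi> p + 0 *\<^sub>R v) within (\<lambda>s. \<psi> p + s *\<^sub>R v) ` S)"
        by (simp add: J_def)
    qed
    from bounded_linear.has_derivative[OF bounded_linear_vec_nth[of 2] this]
    have "((\<lambda>s. (\<phi> \<circ> inv_into W \<psi>) (\<psi> p + s *\<^sub>R v) $ 2) has_derivative (\<lambda>h. J (h *\<^sub>R v) $ 2)) (at 0 within S)" .
    then show ?thesis
      unfolding has_field_derivative_def
      by (rule has_derivative_eq_rhs) (simp add: fun_eq_iff linear_cmul[OF l])
  qed
  have dist: "dist (\<psi> p) (\<psi> p + s *\<^sub>R axis k 1) = \<bar>s\<bar>" for s and k :: 2 by (simp add: dist_norm)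
  have in1: "\<psi> p + s *\<^sub>R axis 1 1 \<in> \<psi> ` (U \<inter> W)" if "s \<in> ball 0 e" for s
  proof (rule subsetD[OF e(2)], rule IntI)
    show "\<psi> p + s *\<^sub>R axis 1 1 \<in> ball (\<psi> p) e" using that by (simp add: dist)
    show "\<psi> p + s *\<^sub>R axis 1 1 \<in> half_plane" using that z by (simp add: half_plane_def axis_def)
  qed
  have f1: "?f (axis 1 1) s = 0" if sb: "s \<in> ball 0 e" for s
  proof -
    obtain q where q: "q \<in> U \<inter> W" "\<psi> p + s *\<^sub>R axis 1 1 = \<psi> q" using in1[OF sb] by blast
    have "\<psi> q $ 2 = 0" using z(1) q(2)[symmetric] by (simp add: axis_def)
    then have "\<phi> q $ 2 = 0" using boundary_invariant[OF W U, of q] q(1) by blast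
    then show ?thesis using q by (simp add: LC_inv[OF c'])
  qed
  have "(?f (axis 1 1) has_real_derivative J (axis 1 1) $ 2) (at 0)"
    using der[of "ball 0 e" "axis 1 1"] in1 e(1) at_within_open[of "0::real" "ball 0 e"] by simp
  moreover have "(?f (axis 1 1) has_real_derivative 0) (at 0)"
    by (rule has_field_derivative_transform_within_open[OF DERIV_const[of 0] open_ball[of 0 e]])
       (use f1 e(1) in auto)
  ultimately show J1: "J (axis 1 1) $ 2 = 0" by (rule DERIV_unique)
  \<comment> \<open>Downward steps leave the half-plane, so the derivative in this direction is
    one-sided.\<close>
  have in2: "\<psi> p + s *\<^sub>R axis 2 1 \<in> \<psi> ` (U \<inter> W)" if "s \<in> {0..<e}" for s
  proof (rule subsetD[OF e(2)], rule IntI)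
    show "\<psi> p + s *\<^sub>R axis 2 1 \<in> ball (\<psi> p) e" using that by (simp add: dist)
    show "\<psi> p + s *\<^sub>R axis 2 1 \<in> half_plane" using that z by (simp add: half_plane_def axis_def)
  qed
  have f2: "?f (axis 2 1) s \<ge> 0" if sb: "s \<in> {0..<e}" for s
  proof -
    obtain q where q: "q \<in> U \<inter> W" "\<psi> p + s *\<^sub>R axis 2 1 = \<psi> q" using in2[OF sb] by blast
    then show ?thesis using chart_half_plane[OF U, of q] by (simp add: LC_inv[OF c'])
  qed
  have "\<not> J (axis 2 1) $ 2 < 0"
  proof
    assume neg: "J (axis 2 1) $ 2 < 0"
    obtain d where d: "d > 0" "\<forall>h>0. 0 + h \<in> {0..<e} \<longrightarrow> h < d \<longrightarrow> ?f (axis 2 1) (0 + h) < ?f (axis 2 1) 0"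
      using has_real_derivative_neg_dec_right[OF der[of "{0..<e}" "axis 2 1"] neg] in2 by blast
    define h where "h = min d e / 2"
    have "?f (axis 2 1) (0 + h) < ?f (axis 2 1) 0" using d e(1) by (auto simp: h_def)
    moreover have "?f (axis 2 1) 0 = 0" using z(2) p by (simp add: LC_inv[OF c'])
    moreover have "?f (axis 2 1) h \<ge> 0" using d(1) e(1) by (intro f2) (auto simp: h_def)
    ultimately show False by simp
  qed
  moreover have "det (matrix J) \<noteq> 0" unfolding J_def by (rule det_change_nonzero[OF c' c p'])
  ultimately show "J (axis 1 1) $ 1 \<noteq> 0" "J (axis 2 1) $ 2 > 0" using J1 by (auto simp: det_matrix_vec2)
qed

end

section \<open>Arc length of the boundary in charts\<close>

context surface_immersion begin

abbreviation bpt where "bpt U \<phi> s \<equiv> inv_into U \<phi> (axis 1 s)"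
abbreviation bspeed where "bspeed U \<phi> s \<equiv> norm (coord_deriv U \<phi> 1 R (bpt U \<phi> s))"
abbreviation bline where "bline \<phi> U \<equiv> {s::real. (axis 1 s :: real^2) \<in> \<phi> ` U}"

definition chart_length where
  "chart_length U \<phi> E = (\<integral>\<^sup>+ s\<in>bline \<phi> E. ennreal (bspeed U \<phi> s) \<partial>lborel)"

lemma axis_eq_scaleR: "(axis 1 s :: real^2) = s *\<^sub>R axis 1 1"
  by (simp add: vec_eq_iff axis_def)

lemma continuous_on_axis: "continuous_on S (\<lambda>s. axis 1 s :: real^2)"
proof -
  have "continuous_on S (\<lambda>s. s *\<^sub>R axis 1 1 :: real^2)" by (intro continuous_intros)
  then show ?thesis by (rule continuous_on_eq) (rule axis_eq_scaleR[symmetric])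
qed

lemma boundary_point_eq: "(U, \<phi>) \<in> A \<Longrightarrow> p \<in> U \<Longrightarrow> p \<in> bd \<Longrightarrow> \<phi> p = axis 1 (\<phi> p $ 1)"
  using boundary_iff[of U \<phi> p] by (simp add: vec_eq_iff forall_2 axis_def)

lemma bline_point:
  assumes U: "(U, \<phi>) \<in> A" and s: "s \<in> bline \<phi> U"
  shows "bpt U \<phi> s \<in> U" "bpt U \<phi> s \<in> bd" "\<phi> (bpt U \<phi> s) = axis 1 s"
proof -
  show 1: "bpt U \<phi> s \<in> U" and 2: "\<phi> (bpt U \<phi> s) = axis 1 s"
    using s by (auto intro: inv_into_into f_inv_into_f)
  show "bpt U \<phi> s \<in> bd" unfolding boundary_iff[OF U 1] 2 by (simp add: axis_def)
qed

lemma bline_open: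
  assumes U: "(U, \<phi>) \<in> A" shows "open (bline \<phi> U)"
proof -
  obtain T where T: "open T" "\<phi> ` U = half_plane \<inter> T" using chart_image_open[OF U] by (auto simp: openin_open)
  have "s *\<^sub>R axis 1 1 \<in> half_plane" for s by (simp add: half_plane_def axis_def)
  then have "s \<in> bline \<phi> U \<longleftrightarrow> s *\<^sub>R axis 1 1 \<in> T" for s
    using T(2) axis_eq_scaleR[of s] by simp
  then have "bline \<phi> U = (\<lambda>s. s *\<^sub>R axis 1 1) -` T" by blast
  also have "open \<dots>" by (rule open_vimage[OF T(1)]) (intro continuous_intros)
  finally show ?thesis .
qed

lemma continuous_on_bpt:
  assumes U: "(U, \<phi>) \<in> A" shows "continuous_on (bline \<phi> U) (bpt U \<phi>)"
  by (rule continuous_on_compose2[OF LC_continuous_inv[OF chart_local_coordinates[OF U]]])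
     (auto intro: continuous_on_axis)

lemma continuous_on_bspeed:
  assumes U: "(U, \<phi>) \<in> A" shows "continuous_on (bline \<phi> U) (bspeed U \<phi>)"
proof -
  note c = chart_local_coordinates[OF U]
  have "continuous_on U (\<lambda>p. norm (dR U \<phi> p (axis 1 1)))"
    using C1_on_imp_continuous_on[OF differential_C1_on[OF R_smooth c]] by (rule continuous_on_norm)
  then show ?thesis unfolding coord_deriv_def
    by (rule continuous_on_compose2[OF _ continuous_on_bpt[OF U]]) (use bline_point(1)[OF U] in auto)
qed

lemma bline_eq:
  assumes U: "(U, \<phi>) \<in> A" and E: "E \<subseteq> U"
  shows "bline \<phi> E = {s \<in> bline \<phi> U. bpt U \<phi> s \<in> E}"
  using E LC_inv[OF chart_local_coordinates[OF U]] bline_point(3)[OF U]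
  by (auto simp: image_iff subset_iff)

lemma bline_borel:
  assumes U: "(U, \<phi>) \<in> A" and E: "E \<in> sets BB" "E \<subseteq> U"
  shows "bline \<phi> E \<in> sets borel"
proof -
  obtain B where B: "B \<in> sets borel" "E = bd \<inter> B" using E(1) by (auto simp: sets_restrict_space)
  have L: "bline \<phi> U \<in> sets borel" using bline_open[OF U] by simp
  have "bpt U \<phi> -` B \<inter> space (restrict_space borel (bline \<phi> U)) \<in> sets (restrict_space borel (bline \<phi> U))"
    using borel_measurable_continuous_on_restrict[OF continuous_on_bpt[OF U]] B(1) by (rule measurable_sets)
  moreover have "bpt U \<phi> -` B \<inter> space (restrict_space borel (bline \<phi> U)) = {s \<in> bline \<phi> U. bpt U \<phi> s \<in> E}"
    using B(2) bline_point(2)[OF U] by (auto simp: space_restrict_space)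
  ultimately show ?thesis using L bline_eq[OF U E(2)] by (simp add: sets_restrict_space_iff)
qed

lemma measurable_bspeed:
  assumes U: "(U, \<phi>) \<in> A" and E: "E \<in> sets BB" "E \<subseteq> U"
  shows "(\<lambda>s. indicator (bline \<phi> E) s * bspeed U \<phi> s) \<in> borel_measurable borel"
proof -
  have "bline \<phi> E \<subseteq> bline \<phi> U" using E(2) by auto
  from borel_measurable_continuous_on_indicator[OF bline_borel[OF U E] continuous_on_subset[OF continuous_on_bspeed[OF U] this]]
  show ?thesis by simp
qed

text \<open>On the boundary line a transition is a map of one variable with derivative
  \<open>?j\<close>. As the Jacobian sends \<open>axis 1 1\<close> to \<open>?j\<close> times
  itself, the speed changes by the absolute value of \<open>?j\<close>, and one-dimensional
  substitution applies.\<close>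

lemma chart_length_compatible:
  assumes U: "(U, \<phi>) \<in> A" and W: "(W, \<psi>) \<in> A" and E: "E \<in> sets BB" "E \<subseteq> U \<inter> W"
  shows "chart_length U \<phi> E = chart_length W \<psi> E"
proof -
  note c = chart_local_coordinates[OF U] and c' = chart_local_coordinates[OF W]
  have E': "E \<subseteq> U" "E \<subseteq> W" using E by auto
  have Ebd: "E \<subseteq> bd" using sets.sets_into_space[OF E(1)] by (simp add: space_restrict_space)
  let ?S = "bline \<psi> E" and ?g = "\<lambda>s. \<phi> (bpt W \<psi> s) $ 1"
  let ?j = "\<lambda>s. coord_differential W \<psi> \<phi> (bpt W \<psi> s) (axis 1 1) $ 1"
  have S: "bpt W \<psi> s \<in> E" "\<psi> (bpt W \<psi> s) = axis 1 s" "\<phi> (bpt W \<psi> s) = axis 1 (?g s)"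
    if s: "s \<in> ?S" for s
  proof -
    have "s \<in> {s \<in> bline \<psi> W. bpt W \<psi> s \<in> E}" using s bline_eq[OF W E'(2)] by simp
    then show 1: "bpt W \<psi> s \<in> E" and "\<psi> (bpt W \<psi> s) = axis 1 s" using bline_point(3)[OF W] by auto
    show "\<phi> (bpt W \<psi> s) = axis 1 (?g s)" using boundary_point_eq[OF U] 1 E' Ebd by blast
  qed
  have gb: "bpt U \<phi> (?g s) = bpt W \<psi> s" if "s \<in> ?S" for s
    unfolding S(3)[OF that, symmetric] using S(1)[OF that] E'(1) LC_inv[OF c] by blast
  have gS: "?g ` ?S = bline \<phi> E"
  proof (intro equalityI subsetI)
    fix x assume "x \<in> ?g ` ?S"
    then obtain s where s: "x = ?g s" "s \<in> ?S" by (rule imageE)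
    have "axis 1 x = \<phi> (bpt W \<psi> s)" unfolding s(1) by (rule S(3)[OF s(2), symmetric])
    then show "x \<in> bline \<phi> E" using S(1)[OF s(2)] by blast
  next
    fix x assume "x \<in> bline \<phi> E"
    then obtain p where p: "p \<in> E" "axis 1 x = \<phi> p" by blast
    have ps: "\<psi> p = axis 1 (\<psi> p $ 1)" using boundary_point_eq[OF W] p(1) E' Ebd by blast
    have "bpt W \<psi> (\<psi> p $ 1) = p" unfolding ps[symmetric] using LC_inv[OF c'] p(1) E'(2) by blast
    then have "?g (\<psi> p $ 1) = x" using p(2)[symmetric] by (simp add: axis_def)
    moreover have "\<psi> p $ 1 \<in> ?S" using ps p(1) by (metis (mono_tags, lifting) imageI mem_Collect_eq)
    ultimately show "x \<in> ?g ` ?S" by (rule image_eqI[OF sym])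
  qed
  have speed: "bspeed W \<psi> s = \<bar>?j s\<bar> * bspeed U \<phi> (?g s)" if s: "s \<in> ?S" for s
  proof -
    let ?p = "bpt W \<psi> s"
    have p: "?p \<in> U \<inter> W" "?p \<in> bd" "?p \<in> W \<inter> U" using S(1)[OF s] E(2) Ebd by auto
    have a: "coord_differential W \<psi> \<phi> ?p (axis 1 1) = ?j s *\<^sub>R axis 1 1"
      using boundary_transition(1)[OF U W p(1,2)] by (simp add: vec_eq_iff forall_2 axis_def)
    have pU: "?p \<in> U" using p(1) by blast
    have "dR W \<psi> ?p (axis 1 1) = dR U \<phi> ?p (coord_differential W \<psi> \<phi> ?p (axis 1 1))"
      using coord_differential_change(2)[OF c' c _ _ coordinate_change_differentiable(1)[OF c' c p(3)]
          R_differentiable[OF c]] p(1) by blast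
    also have "\<dots> = dR U \<phi> ?p (?j s *\<^sub>R axis 1 1)" by (rule arg_cong[OF a])
    also have "\<dots> = ?j s *\<^sub>R dR U \<phi> ?p (axis 1 1)"
      by (rule linear_cmul[OF linear_coord_differential[OF R_differentiable[OF c pU]]])
    finally show ?thesis unfolding gb[OF s] coord_deriv_def by simp
  qed
  have "(\<integral>\<^sup>+s\<in>?S. ennreal (\<bar>?j s\<bar> * bspeed U \<phi> (?g s)) \<partial>lborel) = (\<integral>\<^sup>+x\<in>?g ` ?S. ennreal (bspeed U \<phi> x) \<partial>lborel)"
  proof (rule nn_integral_change_of_variables_real)
    show "?S \<in> sets lebesgue" using bline_borel[OF W E(1) E'(2)] by simp
    show "(?g has_field_derivative ?j s) (at s within ?S)" if s: "s \<in> ?S" for s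
    proof -
      let ?J = "coord_differential W \<psi> \<phi> (bpt W \<psi> s)"
      have p: "bpt W \<psi> s \<in> W \<inter> U" using S(1)[OF s] E(2) by auto
      note d = coordinate_change_differentiable(1)[OF c' c p]
      have "((\<lambda>s. (\<phi> \<circ> inv_into W \<psi>) (s *\<^sub>R axis 1 1)) has_derivative (\<lambda>h. ?J (h *\<^sub>R axis 1 1))) (at s within ?S)"
      proof (rule has_derivative_in_compose[where f = "\<lambda>s. s *\<^sub>R axis 1 1" and g = "\<phi> \<circ> inv_into W \<psi>" and g' = ?J])
        have "(\<lambda>s. s *\<^sub>R axis 1 1) ` ?S \<subseteq> \<psi> ` W" using E'(2) by (auto simp: axis_eq_scaleR[symmetric])
        from has_derivative_subset[OF coord_differential_works[OF d] this]
        show "(\<phi> \<circ> inv_into W \<psi> has_derivative ?J) (at (s *\<^sub>R axis 1 1) within (\<lambda>s. s *\<^sub>R axis 1 1) ` ?S)"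
          unfolding trans[OF S(2)[OF s] axis_eq_scaleR[of s]] .
      qed (auto intro!: derivative_eq_intros)
      from bounded_linear.has_derivative[OF bounded_linear_vec_nth[of 1] this]
      have "(?g has_derivative (\<lambda>h. ?J (h *\<^sub>R axis 1 1) $ 1)) (at s within ?S)"
        unfolding axis_eq_scaleR[symmetric] comp_def .
      then show ?thesis
        unfolding has_field_derivative_def
        by (rule has_derivative_eq_rhs) (simp add: fun_eq_iff linear_cmul[OF linear_coord_differential[OF d]])
    qed
    show "inj_on ?g ?S"
    proof (rule inj_onI)
      fix s t assume st: "s \<in> ?S" "t \<in> ?S" "?g s = ?g t"
      have "bpt W \<psi> s = bpt U \<phi> (?g s)" by (rule gb[OF st(1), symmetric])
      also have "\<dots> = bpt U \<phi> (?g t)" by (rule arg_cong[OF st(3)])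
      also have "\<dots> = bpt W \<psi> t" by (rule gb[OF st(2)])
      finally have "\<psi> (bpt W \<psi> s) = \<psi> (bpt W \<psi> t)" by (rule arg_cong)
      then have "(axis 1 s :: real^2) = axis 1 t" unfolding S(2)[OF st(1)] S(2)[OF st(2)] .
      then show "s = t" by (auto simp: axis_eq_axis)
    qed
    show "(\<lambda>y. indicator (?g ` ?S) y * bspeed U \<phi> y) \<in> borel_measurable lebesgue"
      unfolding gS using measurable_bspeed[OF U E(1) E'(1)] by (simp add: measurable_completion)
    have "(\<lambda>s. indicator ?S s * bspeed W \<psi> s) \<in> borel_measurable lebesgue"
      using measurable_bspeed[OF W E(1) E'(2)] by (simp add: measurable_completion)
    moreover have "(\<lambda>s. indicator ?S s * bspeed W \<psi> s) = (\<lambda>s. indicator ?S s * (\<bar>?j s\<bar> * bspeed U \<phi> (?g s)))"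
    proof
      fix s show "indicator ?S s * bspeed W \<psi> s = indicator ?S s * (\<bar>?j s\<bar> * bspeed U \<phi> (?g s))"
        using speed[of s] by (cases "s \<in> ?S") simp_all
    qed
    ultimately show "(\<lambda>s. indicator ?S s * (\<bar>?j s\<bar> * bspeed U \<phi> (?g s))) \<in> borel_measurable lebesgue" by simp
  qed simp
  moreover have "(\<integral>\<^sup>+s\<in>?S. ennreal (\<bar>?j s\<bar> * bspeed U \<phi> (?g s)) \<partial>lborel) = chart_length W \<psi> E"
    unfolding chart_length_def
  proof (rule nn_integral_cong)
    fix s show "ennreal (\<bar>?j s\<bar> * bspeed U \<phi> (?g s)) * indicator ?S s = ennreal (bspeed W \<psi> s) * indicator ?S s"
      using speed[of s] by (cases "s \<in> ?S") simp_all
  qed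
  ultimately show ?thesis unfolding chart_length_def gS by simp
qed

lemma chart_length_sums:
  assumes U: "(U, \<phi>) \<in> A"
    and F: "range F \<subseteq> sets BB" "\<Union>(range F) \<subseteq> U" "disjoint_family F"
  shows "(\<Sum>i::nat. chart_length U \<phi> (F i)) = chart_length U \<phi> (\<Union>(range F))"
proof -
  have UE: "\<Union>(range F) \<in> sets BB" using F(1) by auto
  \<comment> \<open>The density is cut off to the union of the family, a Borel subset of the
    boundary, since \<open>U\<close> itself may contain interior points.\<close>
  let ?f = "\<lambda>s. ennreal (indicator (bline \<phi> (\<Union>(range F))) s * bspeed U \<phi> s)"
  have m: "?f \<in> borel_measurable lborel"
    using measurable_bspeed[OF U UE F(2)] by simp
  have em: "chart_length U \<phi> E = emeasure (density lborel ?f) (bline \<phi> E)" if E: "E \<in> sets BB" "E \<subseteq> \<Union>(range F)" for E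
  proof -
    have EU: "E \<subseteq> U" using E(2) F(2) by blast
    have "emeasure (density lborel ?f) (bline \<phi> E) = (\<integral>\<^sup>+s\<in>bline \<phi> E. ?f s \<partial>lborel)"
      using bline_borel[OF U E(1) EU] by (intro emeasure_density m) simp
    also have "\<dots> = chart_length U \<phi> E"
      unfolding chart_length_def
    proof (rule nn_integral_cong)
      fix s
      have "s \<in> bline \<phi> E \<Longrightarrow> s \<in> bline \<phi> (\<Union>(range F))" using E(2) by auto
      then show "?f s * indicator (bline \<phi> E) s = ennreal (bspeed U \<phi> s) * indicator (bline \<phi> E) s"
        by (cases "s \<in> bline \<phi> E") simp_all
    qed
    finally show ?thesis ..
  qed
  have Fi: "F i \<in> sets BB" "F i \<subseteq> \<Union>(range F)" "F i \<subseteq> U" for i using F by auto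
  have "(\<Sum>i. chart_length U \<phi> (F i)) = (\<Sum>i. emeasure (density lborel ?f) (bline \<phi> (F i)))"
    using em[OF Fi(1,2)] by simp
  also have "\<dots> = emeasure (density lborel ?f) (\<Union>i. bline \<phi> (F i))"
  proof (rule suminf_emeasure)
    show "range (\<lambda>i. bline \<phi> (F i)) \<subseteq> sets (density lborel ?f)" using bline_borel[OF U Fi(1,3)] by auto
    show "disjoint_family (\<lambda>i. bline \<phi> (F i))"
      unfolding disjoint_family_on_def
    proof (intro ballI impI)
      fix i k :: nat assume "i \<noteq> k"
      then have "F i \<inter> F k = {}" using F(3) by (auto simp: disjoint_family_on_def)
      then show "bline \<phi> (F i) \<inter> bline \<phi> (F k) = {}"
        unfolding bline_eq[OF U Fi(3)] by blast
    qed
  qed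
  also have "(\<Union>i. bline \<phi> (F i)) = bline \<phi> (\<Union>(range F))" by blast
  also have "emeasure (density lborel ?f) \<dots> = chart_length U \<phi> (\<Union>(range F))"
    by (rule em[OF UE order_refl, symmetric])
  finally show ?thesis .
qed

abbreviation ds :: "'a measure" where "ds \<equiv> boundary_measure A R"

text \<open>The gluing lemma asks for patches that are relatively open in the boundary, so the
  charts are intersected with it. For sets inside the boundary, being contained in \<open>U\<close>
  or in \<open>U \<inter> bd\<close> is the same.\<close>

lemma boundary_measure:
  shows sets_boundary_measure: "sets ds = sets BB"
    and emeasure_boundary_measure: "\<And>U \<phi> E. (U, \<phi>) \<in> A \<Longrightarrow> E \<in> sets ds \<Longrightarrow> E \<subseteq> U \<Longrightarrow> emeasure ds E = chart_length U \<phi> E"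
proof -
  let ?\<C> = "(\<lambda>x. (fst x \<inter> bd, chart_length (fst x) (snd x))) ` A"
  let ?P = "\<lambda>\<sigma>. sets \<sigma> = sets BB \<and> (\<forall>(U, \<phi>)\<in>A. \<forall>E\<in>sets \<sigma>. E \<subseteq> U \<longrightarrow> emeasure \<sigma> E = chart_length U \<phi> E)"
  have "\<exists>!\<sigma>. sets \<sigma> = sets BB \<and> (\<forall>(U, m)\<in>?\<C>. \<forall>E\<in>sets \<sigma>. E \<subseteq> U \<longrightarrow> emeasure \<sigma> E = m E)"
  proof (rule ex1_measure_gluing)
    fix U' m assume "(U', m) \<in> ?\<C>"
    then obtain U \<phi> where U: "(U, \<phi>) \<in> A" "U' = U \<inter> bd" "m = chart_length U \<phi>" by auto
    show "openin (top_of_set bd) U'"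
      using openin_Int_relative[OF chart_open[OF U(1)] bd_subset] by (simp add: U(2) Int_commute)
    show "m {} = 0" by (simp add: U(3) chart_length_def)
    show "(\<Sum>i::nat. m (F i)) = m (\<Union>(range F))"
      if "range F \<subseteq> sets BB" "\<Union>(range F) \<subseteq> U'" "disjoint_family F" for F
      unfolding U(3) by (rule chart_length_sums[OF U(1) that(1) _ that(3)]) (use that(2) U(2) in blast)
    fix W' m' E assume "(W', m') \<in> ?\<C>" and E: "E \<in> sets BB" "E \<subseteq> U' \<inter> W'"
    then obtain W \<psi> where W: "(W, \<psi>) \<in> A" "W' = W \<inter> bd" "m' = chart_length W \<psi>" by auto
    show "m E = m' E"
      unfolding U(3) W(3) by (rule chart_length_compatible[OF U(1) W(1) E(1)]) (use E(2) U(2) W(2) in blast)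
  next
    show "bd \<subseteq> (\<Union>(U, m)\<in>?\<C>. U)"
    proof
      fix p assume p: "p \<in> bd"
      then have "p \<in> M" using bd_subset by blast
      then obtain W \<psi> where W: "(W, \<psi>) \<in> A" "p \<in> W" by (rule chart_at)
      have "(W \<inter> bd, chart_length W \<psi>) \<in> ?\<C>" by (rule image_eqI[OF _ W(1)]) simp
      then show "p \<in> (\<Union>(U, m)\<in>?\<C>. U)" using W(2) p by blast
    qed
  qed
  moreover have "(sets \<sigma> = sets BB \<and> (\<forall>(U, m)\<in>?\<C>. \<forall>E\<in>sets \<sigma>. E \<subseteq> U \<longrightarrow> emeasure \<sigma> E = m E)) \<longleftrightarrow> ?P \<sigma>" for \<sigma>
  proof (cases "sets \<sigma> = sets BB")
    case True
    then have "E \<subseteq> bd" if "E \<in> sets \<sigma>" for E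
      using sets.sets_into_space[of E BB] that by (simp add: space_restrict_space)
    then show ?thesis by (auto simp: split_beta)
  qed simp
  ultimately have "\<exists>!\<sigma>. ?P \<sigma>" by simp
  define P where "P = ?P"
  have "\<exists>!\<sigma>. P \<sigma>" unfolding P_def by fact
  then have "P (The P)" by (rule theI')
  moreover have "ds = The P" unfolding P_def boundary_measure_def chart_length_def ..
  ultimately have "P ds" by (simp only:)
  then have "?P ds" unfolding P_def .
  then show "sets ds = sets BB"
    and "\<And>U \<phi> E. (U, \<phi>) \<in> A \<Longrightarrow> E \<in> sets ds \<Longrightarrow> E \<subseteq> U \<Longrightarrow> emeasure ds E = chart_length U \<phi> E" by blast+
qed

lemma space_boundary_measure: "space ds = bd"
  using sets_eq_imp_space_eq[OF sets_boundary_measure] by (simp add: space_restrict_space)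

lemma
  fixes f :: "'a \<Rightarrow> real"
  assumes U: "(U, \<phi>) \<in> A" and f: "f \<in> borel_measurable ds" and f0: "\<And>p. p \<in> bd - U \<Longrightarrow> f p = 0"
  shows integral_boundary_measure:
      "(\<integral>p. f p \<partial>ds) = (\<integral>s. indicator (bline \<phi> U) s * (bspeed U \<phi> s * f (bpt U \<phi> s)) \<partial>lborel)"
    and integrable_boundary_measure:
      "integrable ds f \<longleftrightarrow> integrable lborel (\<lambda>s. indicator (bline \<phi> U) s * (bspeed U \<phi> s * f (bpt U \<phi> s)))"
proof -
  have o: "openin (top_of_set bd) (U \<inter> bd)"
    using openin_Int_relative[OF chart_open[OF U] bd_subset] by (simp add: Int_commute)
  have 1: "U \<inter> bd \<in> sets ds" using openin_sets_restrict_borel[OF o] sets_boundary_measure by simp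
  have 2: "bline \<phi> U \<in> sets lborel" using bline_open[OF U] by simp
  have "bpt U \<phi> \<in> measurable (restrict_space lborel (bline \<phi> U)) borel"
    using borel_measurable_continuous_on_restrict[OF continuous_on_bpt[OF U]]
    by (simp add: measurable_cong_sets[OF sets_restrict_space_cong[OF sets_lborel]])
  then have "bpt U \<phi> \<in> measurable (restrict_space lborel (bline \<phi> U)) BB"
    using bline_point(2)[OF U] by (intro measurable_restrict_space2) (auto simp: space_restrict_space)
  then have "bpt U \<phi> \<in> measurable (restrict_space lborel (bline \<phi> U)) ds"
    by (simp add: measurable_cong_sets[OF refl sets_boundary_measure])
  then have 3: "bpt U \<phi> \<in> measurable (restrict_space lborel (bline \<phi> U)) (restrict_space ds (U \<inter> bd))"
    using bline_point(1,2)[OF U] by (intro measurable_restrict_space2) (auto simp: space_restrict_space)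
  have 4: "bspeed U \<phi> \<in> borel_measurable (restrict_space lborel (bline \<phi> U))"
    using borel_measurable_continuous_on_restrict[OF continuous_on_bspeed[OF U]]
    by (simp add: measurable_cong_sets[OF sets_restrict_space_cong[OF sets_lborel]])
  have 5: "emeasure ds E = (\<integral>\<^sup>+s. ennreal (bspeed U \<phi> s) * indicator {s\<in>bline \<phi> U. bpt U \<phi> s \<in> E} s \<partial>lborel)"
    if "E \<in> sets ds" "E \<subseteq> U \<inter> bd" for E
    using emeasure_boundary_measure[OF U that(1)] that(2) bline_eq[OF U, of E] by (simp add: chart_length_def)
  have 6: "f p = 0" if "p \<in> space ds - U \<inter> bd" for p
    using that f0[of p] space_boundary_measure by blast
  show "(\<integral>p. f p \<partial>ds) = (\<integral>s. indicator (bline \<phi> U) s * (bspeed U \<phi> s * f (bpt U \<phi> s)) \<partial>lborel)"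
    by (rule integral_pullback[OF 1 2 3 4 norm_ge_zero 5 f 6])
  show "integrable ds f \<longleftrightarrow> integrable lborel (\<lambda>s. indicator (bline \<phi> U) s * (bspeed U \<phi> s * f (bpt U \<phi> s)))"
    by (rule integrable_pullback[OF 1 2 3 4 norm_ge_zero 5 f 6])
qed

end

subsection \<open>Variation of the area\<close>

text \<open>After division by \<open>t\<close> the error is at most a multiple of
  \<open>\<bar>t\<bar>\<close>. Serves both for the area and for the cut-off function
  \<open>square_pos\<close> at 0.\<close>

lemma has_real_derivative_quadratic_remainder:
  fixes f :: "real \<Rightarrow> real"
  assumes "\<And>t. \<bar>t\<bar> \<le> 1 \<Longrightarrow> \<bar>f t - f 0 - t * d\<bar> \<le> C * t\<^sup>2"
  shows "(f has_real_derivative d) (at 0)"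
proof -
  have "((\<lambda>t. (f t - f 0) / t - d) \<longlongrightarrow> 0) (at 0)"
  proof (rule Lim_null_comparison)
    show "((\<lambda>t. C * \<bar>t\<bar>) \<longlongrightarrow> 0) (at (0::real))"
      by (auto intro!: tendsto_eq_intros)
    have "norm ((f t - f 0) / t - d) \<le> C * \<bar>t\<bar>" if t: "t \<noteq> 0" "\<bar>t\<bar> < 1" for t
    proof -
      have "(f t - f 0) / t - d = (f t - f 0 - t * d) / t" using t(1) by (simp add: field_simps)
      then have "norm ((f t - f 0) / t - d) = \<bar>f t - f 0 - t * d\<bar> / \<bar>t\<bar>" by (simp add: abs_divide)
      also have "\<dots> \<le> C * t\<^sup>2 / \<bar>t\<bar>" using assms[of t] t by (intro divide_right_mono) auto
      also have "t\<^sup>2 = \<bar>t\<bar> * \<bar>t\<bar>" by (simp add: power2_eq_square)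
      also have "C * (\<bar>t\<bar> * \<bar>t\<bar>) / \<bar>t\<bar> = C * \<bar>t\<bar>"
        using t(1) by (simp only: mult.assoc[symmetric] nonzero_mult_div_cancel_right abs_eq_0_iff simp_thms)
      finally show ?thesis .
    qed
    then show "\<forall>\<^sub>F t in at 0. norm ((f t - f 0) / t - d) \<le> C * \<bar>t\<bar>"
      unfolding eventually_at by (intro exI[of _ 1]) auto
  qed
  then have "((\<lambda>t. (f t - f 0) / t) \<longlongrightarrow> d) (at 0)" by (simp add: LIM_zero_iff)
  then show ?thesis by (simp add: has_field_derivative_iff)
qed

section \<open>Areas relative to the undeformed surface\<close>

context surface_immersion begin

definition chart_of :: "'a \<Rightarrow> 'a chart" where
  "chart_of p = (SOME x. x \<in> A \<and> p \<in> fst x)"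

lemma chart_of:
  assumes "p \<in> M" shows "chart_of p \<in> A" "p \<in> fst (chart_of p)"
proof -
  obtain U \<phi> where "(U, \<phi>) \<in> A" "p \<in> U" using assms by (rule chart_at)
  then have "\<exists>x. x \<in> A \<and> p \<in> fst x" by (intro exI[of _ "(U, \<phi>)"]) simp
  from someI_ex[OF this] show "chart_of p \<in> A" "p \<in> fst (chart_of p)" by (simp_all add: chart_of_def)
qed

text \<open>Dividing by the oriented area of \<open>R\<close> makes the wedge of two differentials independent of
  the coordinates.\<close>

definition rel_wedge :: "('a \<Rightarrow> real^3) \<Rightarrow> ('a \<Rightarrow> real^3) \<Rightarrow> 'a \<Rightarrow> real^3" where
  "rel_wedge f g p = (case chart_of p of (U, c) \<Rightarrow>
     (1 / (N p \<bullet> wRR U c p)) *\<^sub>R wedge (coord_differential U c f p) (coord_differential U c g p))"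

text \<open>Passing to other coordinates multiplies numerator and denominator by the same nonzero
  determinant, so the arbitrary choice in \<open>chart_of\<close> is harmless.\<close>

lemma rel_wedge_eq:
  assumes f: "C1_on M f" and g: "C1_on M g" and c: "LC U c" and p: "p \<in> U"
  shows "rel_wedge f g p = (1 / (N p \<bullet> wRR U c p)) *\<^sub>R wedge (coord_differential U c f p) (coord_differential U c g p)"
proof -
  have pM: "p \<in> M" using p LC_subset[OF c] by blast
  define W \<psi> where "W = fst (chart_of p)" and "\<psi> = snd (chart_of p)"
  have W: "(W, \<psi>) \<in> A" "p \<in> W" using chart_of[OF pM] by (simp_all add: W_def \<psi>_def)
  note \<psi> = chart_local_coordinates[OF W(1)]
  have i: "p \<in> W \<inter> U" using p W(2) by blast
  have d: "coord_differentiable U c f p" "coord_differentiable U c g p"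
    using C1_on_differentiable[OF f c] C1_on_differentiable[OF g c] p pM by auto
  define D where "D = det (matrix (coord_differential W \<psi> c p))"
  have D: "D \<noteq> 0" unfolding D_def by (rule det_change_nonzero[OF \<psi> c i])
  show ?thesis
    unfolding rel_wedge_def split_beta W_def[symmetric] \<psi>_def[symmetric]
      wedge_change[OF \<psi> c i d] wRR_change[OF \<psi> c i] D_def[symmetric]
    using D by simp
qed

lemma continuous_on_rel_wedge:
  assumes f: "C1_on M f" and g: "C1_on M g"
  shows "continuous_on M (rel_wedge f g)"
proof -
  have M: "\<Union>(fst ` A) = M" using chart_cover by force
  have "continuous_on (\<Union>(fst ` A)) (rel_wedge f g)"
  proof (rule continuous_on_open_Union_openin)
    fix U assume "U \<in> fst ` A"
    then obtain x where "U = fst x" "x \<in> A" by (rule imageE)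
    then have U: "(U, snd x) \<in> A" by simp
    note c = chart_local_coordinates[OF U]
    show "openin (top_of_set (\<Union>(fst ` A))) U" unfolding M by (rule chart_open[OF U])
    have UM: "U \<inter> M = U" using LC_subset[OF c] by blast
    have "continuous_on U (\<lambda>p. (1 / (N p \<bullet> wRR U (snd x) p)) *\<^sub>R
        wedge (coord_differential U (snd x) f p) (coord_differential U (snd x) g p))"
      using continuous_on_wedge[OF f g c] continuous_on_wedge[OF smooth_map_C1_on[OF R_smooth] smooth_map_C1_on[OF R_smooth] c]
        C1_on_imp_continuous_on[OF N_C1_on] N_wRR_nonzero[OF c] LC_subset[OF c]
      unfolding UM by (intro continuous_intros) (auto intro: continuous_on_subset)
    then show "continuous_on U (rel_wedge f g)"
      by (rule continuous_on_eq) (rule rel_wedge_eq[OF f g c, symmetric])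
  qed
  then show ?thesis unfolding M .
qed

lemma R_C1_on: "C1_on M R"
  by (rule smooth_map_C1_on[OF R_smooth])

lemma rel_wedge_RR: "p \<in> M \<Longrightarrow> rel_wedge R R p = N p"
proof -
  assume "p \<in> M"
  then obtain W \<psi> where W: "(W, \<psi>) \<in> A" "p \<in> W" by (rule chart_at)
  note c = chart_local_coordinates[OF W(1)]
  have "rel_wedge R R p = (1 / (N p \<bullet> wRR W \<psi> p)) *\<^sub>R wRR W \<psi> p"
    by (rule rel_wedge_eq[OF R_C1_on R_C1_on c W(2)])
  also have "\<dots> = (1 / (N p \<bullet> wRR W \<psi> p)) *\<^sub>R ((N p \<bullet> wRR W \<psi> p) *\<^sub>R N p)"
    using wRR_eq[OF c W(2)] by (rule arg_cong)
  also have "\<dots> = N p" using N_wRR_nonzero[OF c W(2)] by simp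
  finally show ?thesis .
qed

lemma rel_wedge_RN: "p \<in> M \<Longrightarrow> rel_wedge R N p = - mean_curvature M A R N p *\<^sub>R N p"
proof -
  assume p: "p \<in> M"
  then obtain W \<psi> where W: "(W, \<psi>) \<in> A" "p \<in> W" by (rule chart_at)
  note c = chart_local_coordinates[OF W(1)]
  have "rel_wedge R N p = - mean_curvature M A R N p *\<^sub>R rel_wedge R R p"
    unfolding rel_wedge_eq[OF R_C1_on N_C1_on c W(2)] rel_wedge_eq[OF R_C1_on R_C1_on c W(2)] wedge_dR_dN[OF c W(2)]
    by simp
  then show ?thesis using rel_wedge_RR[OF p] by simp
qed

text \<open>\<open>mean_curvature\<close> is defined pointwise by \<open>THE\<close>, so its
  continuity is read off from \<open>rel_wedge R N\<close>, of which it is minus the normal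
  component.\<close>

lemma continuous_on_mean_curvature: "continuous_on M (mean_curvature M A R N)"
proof -
  have "continuous_on M (\<lambda>p. - (N p \<bullet> rel_wedge R N p))"
    by (intro continuous_intros C1_on_imp_continuous_on N_C1_on continuous_on_rel_wedge R_C1_on)
  then show ?thesis
    by (rule continuous_on_eq) (simp add: rel_wedge_RN N_inner_N)
qed

lemma C1_on_scaled: "C1_on X V \<Longrightarrow> C1_on X (\<lambda>p. t *\<^sub>R V p)"
  by (rule C1_on_bilinear[OF bounded_bilinear_scaleR C1_on_const[OF C1_on_open]])

text \<open>The wedge is bilinear and symmetric, which gives the coefficient \<open>2 * t\<close>;
  the constant term is \<open>N\<close> because the denominator is
  \<open>N \<bullet> X(R, R)\<close>.\<close>

lemma rel_wedge_variation:
  assumes V: "C1_on M V" and p: "p \<in> M"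
  shows "rel_wedge (\<lambda>p. R p + t *\<^sub>R V p) (\<lambda>p. R p + t *\<^sub>R V p) p =
    N p + ((2 * t) *\<^sub>R rel_wedge R V p + t\<^sup>2 *\<^sub>R rel_wedge V V p)"
proof -
  obtain W \<psi> where W: "(W, \<psi>) \<in> A" "p \<in> W" using p by (rule chart_at)
  note c = chart_local_coordinates[OF W(1)]
  let ?D = "\<lambda>f. coord_differential W \<psi> f p"
  have Vd: "coord_differentiable W \<psi> V p" using C1_on_differentiable[OF V c W(2) p] .
  note k = coord_differential_const[OF c W(2), of t]
  note tV = coord_differential_bilinear[OF bounded_bilinear_scaleR c W(2) k(1) Vd]
  have D: "?D (\<lambda>p. R p + t *\<^sub>R V p) w = ?D R w + t *\<^sub>R ?D V w" for w
    using coord_differential_add(2)[OF c W(2) R_differentiable[OF c W(2)] tV(1)] tV(2) k(2) by simp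
  have r: "C1_on M (\<lambda>p. R p + t *\<^sub>R V p)" by (rule C1_on_add[OF R_C1_on C1_on_scaled[OF V]])
  define r1 r2 v1 v2 where "r1 = ?D R (axis 1 1)" and "r2 = ?D R (axis 2 1)"
    and "v1 = ?D V (axis 1 1)" and "v2 = ?D V (axis 2 1)"
  have "cross3 (r1 + t *\<^sub>R v1) (r2 + t *\<^sub>R v2) - cross3 (r2 + t *\<^sub>R v2) (r1 + t *\<^sub>R v1)
      = cross3 r1 r2 - cross3 r2 r1 + ((2 * t) *\<^sub>R (cross3 r1 v2 - cross3 r2 v1) +
          t\<^sup>2 *\<^sub>R (cross3 v1 v2 - cross3 v2 v1))"
    by (simp add: cross3_simps forall_3 power2_eq_square)
  then have "wedge (?D (\<lambda>p. R p + t *\<^sub>R V p)) (?D (\<lambda>p. R p + t *\<^sub>R V p)) =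
      wedge (?D R) (?D R) + ((2 * t) *\<^sub>R wedge (?D R) (?D V) + t\<^sup>2 *\<^sub>R wedge (?D V) (?D V))"
    unfolding wedge_def D r1_def r2_def v1_def v2_def .
  then have "rel_wedge (\<lambda>p. R p + t *\<^sub>R V p) (\<lambda>p. R p + t *\<^sub>R V p) p =
      rel_wedge R R p + ((2 * t) *\<^sub>R rel_wedge R V p + t\<^sup>2 *\<^sub>R rel_wedge V V p)"
    unfolding rel_wedge_eq[OF r r c W(2)] rel_wedge_eq[OF R_C1_on V c W(2)]
      rel_wedge_eq[OF V V c W(2)] rel_wedge_eq[OF R_C1_on R_C1_on c W(2)]
    by (simp add: scaleR_add_right mult.commute)
  then show ?thesis by (simp only: rel_wedge_RR[OF p])
qed

abbreviation dA :: "'a measure" where "dA \<equiv> area_measure M A R"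

lemma continuous_on_M_measurable: "continuous_on M f \<Longrightarrow> f \<in> borel_measurable dA"
  using borel_measurable_continuous_on_restrict sets_area_measure[OF R_C1_on] measurable_cong_sets by blast

text \<open>Half the norm of the wedge of \<open>r\<close> is
  \<open>\<bar>N \<bullet> X(R, R)\<bar> / 2\<close> times the norm of the quotient, and the first
  factor is the area density of \<open>R\<close>.\<close>

lemma area_density_rel_wedge:
  assumes r: "C1_on M r" and c: "LC U c" and p: "p \<in> U"
  shows "area_density U c r p = area_density U c R p * norm (rel_wedge r r p)"
  using area_density_R_pos[OF c p] abs_N_wRR[OF c p] N_wRR_nonzero[OF c p]
  unfolding rel_wedge_eq[OF r r c p] area_density_wedge[of U c r] by simp

text \<open>Puts the areas of all deformed surfaces over the fixed measure \<open>dA\<close>, so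
  that the parameter occurs only in the integrand. By uniqueness it suffices to compare densities in
  coordinates.\<close>

lemma area_measure_eq_density:
  assumes r: "C1_on M r"
  shows "area_measure M A r = density dA (\<lambda>p. ennreal (norm (rel_wedge r r p)))"
proof (rule area_measure_unique[OF r, symmetric])
  have m: "(\<lambda>p. ennreal (norm (rel_wedge r r p))) \<in> borel_measurable dA"
    using continuous_on_M_measurable[OF continuous_on_norm[OF continuous_on_rel_wedge[OF r r]]] by simp
  show "is_area_measure r (density dA (\<lambda>p. ennreal (norm (rel_wedge r r p))))"
    unfolding is_area_measure_def
  proof (intro conjI allI impI ballI)
    show "sets (density dA (\<lambda>p. ennreal (norm (rel_wedge r r p)))) = sets BM"
      using sets_area_measure[OF R_C1_on] by simp
    fix U c E assume c: "LC U c" and E: "E \<in> sets (density dA (\<lambda>p. ennreal (norm (rel_wedge r r p))))" "E \<subseteq> U"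
    have "emeasure (density dA (\<lambda>p. ennreal (norm (rel_wedge r r p)))) E
        = (\<integral>\<^sup>+p. ennreal (norm (rel_wedge r r p)) * indicator E p \<partial>dA)"
      using E by (intro emeasure_density m) simp
    also have "\<dots> = (\<integral>\<^sup>+x. ennreal (area_density U c R (inv_into U c x)) *
        (ennreal (norm (rel_wedge r r (inv_into U c x))) * indicator E (inv_into U c x)) * indicator (c ` U) x \<partial>lborel)"
    proof (rule nn_integral_area_measure[OF R_C1_on c])
      show "(\<lambda>p. ennreal (norm (rel_wedge r r p)) * indicator E p) \<in> borel_measurable dA"
        using m E by simp
    qed (use E in \<open>auto simp: indicator_def\<close>)
    also have "\<dots> = chart_area r U c E"
      unfolding chart_area_def
    proof (rule nn_integral_cong)
      fix x
      show "ennreal (area_density U c R (inv_into U c x)) *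
        (ennreal (norm (rel_wedge r r (inv_into U c x))) * indicator E (inv_into U c x)) * indicator (c ` U) x
        = ennreal (area_density U c r (inv_into U c x)) * indicator (c ` E) x"
      proof (cases "x \<in> c ` U")
        case True
        then obtain p where p: "p \<in> U" "x = c p" by blast
        have "x \<in> c ` E \<longleftrightarrow> p \<in> E"
          using p E(2) LC_inj[OF c] by (simp add: inj_on_image_mem_iff)
        then show ?thesis
          using p area_density_rel_wedge[OF r c p(1)] area_density_nonneg[of U c R p]
          by (simp add: LC_inv[OF c] indicator_def ennreal_mult'')
      next
        case False
        then have "x \<notin> c ` E" using E(2) by blast
        then show ?thesis using False by simp
      qed
    qed
    finally show "emeasure (density dA (\<lambda>p. ennreal (norm (rel_wedge r r p)))) E = chart_area r U c E" .
  qed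
qed

text \<open>Also correct for infinite area: \<open>measure\<close> and the Bochner integral both
  return 0 there.\<close>

lemma measure_area_measure:
  assumes r: "C1_on M r"
  shows "measure (area_measure M A r) M = (\<integral>p. norm (rel_wedge r r p) \<partial>dA)"
proof -
  have m: "(\<lambda>p. norm (rel_wedge r r p)) \<in> borel_measurable dA"
    by (rule continuous_on_M_measurable[OF continuous_on_norm[OF continuous_on_rel_wedge[OF r r]]])
  have M: "M \<in> sets dA" using sets.top[of dA] by (simp add: space_area_measure[OF R_C1_on])
  have "emeasure (area_measure M A r) M = (\<integral>\<^sup>+p. ennreal (norm (rel_wedge r r p)) * indicator M p \<partial>dA)"
    unfolding area_measure_eq_density[OF r] using m M by (intro emeasure_density) auto
  also have "\<dots> = (\<integral>\<^sup>+p. ennreal (norm (rel_wedge r r p)) \<partial>dA)"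
    by (intro nn_integral_cong) (simp add: space_area_measure[OF R_C1_on])
  finally show ?thesis
    using integral_eq_nn_integral[OF m] by (simp add: measure_def)
qed

text \<open>A compact set is closed in a Hausdorff space, so \<open>V\<close> vanishes on
  \<open>M\<close> near \<open>p\<close> and its differential at \<open>p\<close> is zero.\<close>

lemma rel_wedge_outside:
  assumes K: "compact K" "K \<subseteq> M" and V: "C1_on M V" "\<And>p. p \<in> M - K \<Longrightarrow> V p = 0"
    and f: "C1_on M f" and p: "p \<in> M - K"
  shows "rel_wedge f V p = 0"
proof -
  have pM: "p \<in> M" using p by blast
  then obtain W \<psi> where W: "(W, \<psi>) \<in> A" "p \<in> W" by (rule chart_at)
  note c = chart_local_coordinates[OF W(1)]
  have o: "openin (top_of_set M) (M - K)"
    using compact_imp_closed[OF K(1)] by (auto simp: openin_open intro!: exI[of _ "- K"])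
  have "coord_differential W \<psi> V p = coord_differential W \<psi> (\<lambda>_. 0) p"
    by (rule coord_differential_cong(2)[OF c o p W(2) _ coord_differential_const(1)[OF c W(2)]]) (use V(2) in auto)
  then have "coord_differential W \<psi> V p = (\<lambda>_. 0)" by (simp add: coord_differential_const(2)[OF c W(2)])
  then show ?thesis unfolding rel_wedge_eq[OF f V(1) c W(2)] by (simp add: wedge_def)
qed

lemma bounded_if_compact_support:
  fixes g :: "'a \<Rightarrow> 'b::real_normed_vector"
  assumes K: "compact K" "K \<subseteq> M" and g: "continuous_on M g" "\<And>p. p \<in> M - K \<Longrightarrow> g p = 0"
  shows "\<exists>B\<ge>0. \<forall>p\<in>M. norm (g p) \<le> B"
proof -
  have "bounded (g ` K)"
    using compact_continuous_image[OF continuous_on_subset[OF g(1) K(2)] K(1)] by (rule compact_imp_bounded)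
  then obtain B where B: "\<And>p. p \<in> K \<Longrightarrow> norm (g p) \<le> B" unfolding bounded_iff by auto
  have "norm (g p) \<le> max 0 B" if "p \<in> M" for p using that B[of p] g(2)[of p] by (cases "p \<in> K") auto
  then show ?thesis by (intro exI[of _ "max 0 B"]) auto
qed

section \<open>Differentiation of the area\<close>

text \<open>Off \<open>K\<close> the wedges with \<open>V\<close> vanish and on \<open>K\<close>
  they are bounded, so the expansion of the norm around the unit vector \<open>N p\<close> has a
  remainder of order \<open>t\<^sup>2\<close> uniformly in \<open>p\<close>. Finite area lets this
  bound be integrated.\<close>

lemma area_derivative:
  assumes fin: "emeasure dA M < \<infinity>" and V: "C1_on M V"
    and K: "compact K" "K \<subseteq> M" "\<And>p. p \<in> M - K \<Longrightarrow> V p = 0"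
  shows "((\<lambda>t. measure (area_measure M A (\<lambda>p. R p + t *\<^sub>R V p)) M) has_real_derivative
           (\<integral>p. 2 * (N p \<bullet> rel_wedge R V p) \<partial>dA)) (at 0)"
proof -
  have sp: "space dA = M" by (rule space_area_measure[OF R_C1_on])
  interpret finite_measure dA using fin sp by (intro finite_measureI) auto
  let ?B = "rel_wedge R V" and ?C = "rel_wedge V V"
  let ?r = "\<lambda>t p. R p + t *\<^sub>R V p"
  have r: "C1_on M (?r t)" for t by (rule C1_on_add[OF R_C1_on C1_on_scaled[OF V]])
  have cB: "continuous_on M ?B" and cC: "continuous_on M ?C"
    by (intro continuous_on_rel_wedge R_C1_on V)+
  obtain b where b: "b \<ge> 0" "\<And>p. p \<in> M \<Longrightarrow> norm (?B p) \<le> b"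
    using bounded_if_compact_support[OF K(1,2) cB rel_wedge_outside[OF K(1,2) V K(3) R_C1_on]] by blast
  obtain k where k: "k \<ge> 0" "\<And>p. p \<in> M \<Longrightarrow> norm (?C p) \<le> k"
    using bounded_if_compact_support[OF K(1,2) cC rel_wedge_outside[OF K(1,2) V K(3) V]] by blast
  \<comment> \<open>Let \<open>?u\<close> be the perturbation of \<open>N p\<close>. The summand
    \<open>k\<close> bounds the coefficient of \<open>t\<^sup>2\<close> in
    \<open>N p \<bullet> ?u\<close>. The other summand comes from half the square of the norm of
    \<open>?u\<close>, which is at most \<open>\<bar>t\<bar> * (2 * b + k)\<close> for
    \<open>\<bar>t\<bar> \<le> 1\<close>.\<close>
  define C where "C = k + (2 * b + k)\<^sup>2 / 2"
  have est: "\<bar>norm (rel_wedge (?r t) (?r t) p) - 1 - t * (2 * (N p \<bullet> ?B p))\<bar> \<le> C * t\<^sup>2"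
    if p: "p \<in> M" and t: "\<bar>t\<bar> \<le> 1" for p t
  proof -
    let ?u = "(2 * t) *\<^sub>R ?B p + t\<^sup>2 *\<^sub>R ?C p"
    have n: "norm (N p) = 1" by (rule norm_N[OF p])
    have "norm ?u \<le> 2 * \<bar>t\<bar> * norm (?B p) + t\<^sup>2 * norm (?C p)"
      by (rule norm_triangle_le) (simp add: abs_mult)
    also have "\<dots> \<le> 2 * \<bar>t\<bar> * b + t\<^sup>2 * k"
      using b k p by (intro add_mono mult_left_mono) auto
    also have "\<dots> \<le> \<bar>t\<bar> * (2 * b + k)"
    proof -
      have "t\<^sup>2 \<le> \<bar>t\<bar>" using t by (metis abs_ge_zero abs_power2 mult_left_le power2_abs power2_eq_square)
      then have "t\<^sup>2 * k \<le> \<bar>t\<bar> * k" using k(1) by (rule mult_right_mono)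
      then show ?thesis by (simp add: algebra_simps)
    qed
    finally have "(norm ?u)\<^sup>2 \<le> (\<bar>t\<bar> * (2 * b + k))\<^sup>2" by (intro power_mono) auto
    then have u2: "(norm ?u)\<^sup>2 \<le> t\<^sup>2 * (2 * b + k)\<^sup>2" by (simp add: power_mult_distrib)
    have "\<bar>norm (N p + ?u) - 1 - N p \<bullet> ?u\<bar> \<le> (norm ?u)\<^sup>2 / 2"
      using norm_add_taylor[of "N p" ?u] n by fastforce
    moreover have "\<bar>N p \<bullet> ?C p\<bar> \<le> k"
      using Cauchy_Schwarz_ineq2[of "N p" "?C p"] n k(2)[OF p] by simp
    then have "\<bar>t\<^sup>2 * (N p \<bullet> ?C p)\<bar> \<le> t\<^sup>2 * k" by (simp add: abs_mult mult_left_mono)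
    moreover have "N p \<bullet> ?u = t * (2 * (N p \<bullet> ?B p)) + t\<^sup>2 * (N p \<bullet> ?C p)"
      by (simp add: inner_add_right)
    ultimately have "\<bar>norm (N p + ?u) - 1 - t * (2 * (N p \<bullet> ?B p))\<bar> \<le> t\<^sup>2 * (2 * b + k)\<^sup>2 / 2 + t\<^sup>2 * k"
      using u2 by linarith
    then show ?thesis unfolding rel_wedge_variation[OF V p] C_def by (simp add: algebra_simps)
  qed
  have m: "(\<lambda>p. norm (rel_wedge (?r t) (?r t) p)) \<in> borel_measurable dA" for t
    by (rule continuous_on_M_measurable[OF continuous_on_norm[OF continuous_on_rel_wedge[OF r r]]])
  have mB: "(\<lambda>p. 2 * (N p \<bullet> ?B p)) \<in> borel_measurable dA"
    by (rule continuous_on_M_measurable) (intro continuous_intros cB C1_on_imp_continuous_on N_C1_on)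
  have iB: "integrable dA (\<lambda>p. 2 * (N p \<bullet> ?B p))"
  proof (rule integrable_const_bound[OF _ mB])
    show "AE p in dA. norm (2 * (N p \<bullet> ?B p)) \<le> 2 * b"
    proof (rule AE_I2)
      fix p assume "p \<in> space dA"
      then have p: "p \<in> M" using sp by simp
      show "norm (2 * (N p \<bullet> ?B p)) \<le> 2 * b"
        using Cauchy_Schwarz_ineq2[of "N p" "?B p"] norm_N[OF p] b(2)[OF p] by (simp add: abs_mult)
    qed
  qed
  have ir: "integrable dA (\<lambda>p. norm (rel_wedge (?r t) (?r t) p))" if t: "\<bar>t\<bar> \<le> 1" for t
  proof (rule integrable_const_bound[OF _ m])
    show "AE p in dA. norm (norm (rel_wedge (?r t) (?r t) p)) \<le> 1 + 2 * b + C"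
    proof (rule AE_I2)
      fix p assume "p \<in> space dA"
      then have p: "p \<in> M" using sp by simp
      have "\<bar>N p \<bullet> ?B p\<bar> \<le> b"
        using Cauchy_Schwarz_ineq2[of "N p" "?B p"] norm_N[OF p] b(2)[OF p] by simp
      then have "\<bar>t * (2 * (N p \<bullet> ?B p))\<bar> \<le> 1 * (2 * b)"
        unfolding abs_mult using t by (intro mult_mono) auto
      moreover have "C * t\<^sup>2 \<le> C * 1"
        using t k(1) unfolding C_def by (intro mult_left_mono) (auto simp: abs_square_le_1)
      ultimately show "norm (norm (rel_wedge (?r t) (?r t) p)) \<le> 1 + 2 * b + C"
        using est[OF p t] by simp
    qed
  qed
  have f0: "measure (area_measure M A (?r 0)) M = (\<integral>p. 1 \<partial>dA)"
    unfolding measure_area_measure[OF r]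
    by (rule Bochner_Integration.integral_cong) (simp_all add: sp rel_wedge_RR norm_N)
  show ?thesis
  proof (rule has_real_derivative_quadratic_remainder[where C = "C * measure dA M"])
    fix t :: real assume t: "\<bar>t\<bar> \<le> 1"
    let ?g = "\<lambda>p. norm (rel_wedge (?r t) (?r t) p) - 1 - t * (2 * (N p \<bullet> ?B p))"
    have ig: "integrable dA ?g" by (intro Bochner_Integration.integrable_diff ir[OF t] integrable_mult_right iB integrable_const)
    have eq: "measure (area_measure M A (?r t)) M - measure (area_measure M A (?r 0)) M - t * (\<integral>p. 2 * (N p \<bullet> ?B p) \<partial>dA)
        = (\<integral>p. ?g p \<partial>dA)"
      unfolding f0 measure_area_measure[OF r[of t]] using ir[OF t] iB by simp
    have "\<bar>\<integral>p. ?g p \<partial>dA\<bar> \<le> (\<integral>p. \<bar>?g p\<bar> \<partial>dA)" by (rule integral_abs_bound)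
    also have "\<dots> \<le> (\<integral>p. C * t\<^sup>2 \<partial>dA)"
      by (rule integral_mono) (use ig est t sp in auto)
    also have "\<dots> = C * measure dA M * t\<^sup>2" by (simp add: sp)
    finally show "\<bar>measure (area_measure M A (?r t)) M - measure (area_measure M A (?r 0)) M
        - t * (\<integral>p. 2 * (N p \<bullet> ?B p) \<partial>dA)\<bar> \<le> C * measure dA M * t\<^sup>2" unfolding eq .
  qed
qed

end

subsection \<open>The divergence theorem in a chart\<close>

context surface_immersion begin

section \<open>The outward conormal\<close>

text \<open>The condition in \<open>outward_conormal\<close> for one fixed chart. On the boundary it
  does not depend on the chart, which removes the quantifier over charts under
  \<open>THE\<close>.\<close>

definition conormal_candidate :: "'a set \<Rightarrow> ('a \<Rightarrow> real^2) \<Rightarrow> 'a \<Rightarrow> real^3 \<Rightarrow> bool" where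
  "conormal_candidate U \<phi> p \<tau> \<longleftrightarrow> (\<exists>w. w $ 2 < 0 \<and> \<tau> = dR U \<phi> p w) \<and> norm \<tau> = 1 \<and> \<tau> \<bullet> dR U \<phi> p (axis 1 1) = 0"

lemma dR1_nonzero: "LC U c \<Longrightarrow> p \<in> U \<Longrightarrow> dR U c p (axis 1 1) \<noteq> 0"
  using wRR_nonzero[of U c p] by (auto simp: wedge_self)

text \<open>\<open>R\<^sub>1 \<times> \<tau>\<close> is normal with coefficient
  \<open>w $ 2 * k / 2\<close> and has the length of \<open>R\<^sub>1\<close>; as
  \<open>w $ 2\<close> is negative, the coefficient has the sign of \<open>- k\<close>. Taking the
  cross product with \<open>R\<^sub>1\<close> once more recovers \<open>\<tau>\<close>, which is
  therefore unique.\<close>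

lemma conormal_candidate_eq:
  assumes U: "(U, \<phi>) \<in> A" and p: "p \<in> U" and \<tau>: "conormal_candidate U \<phi> p \<tau>"
  shows "norm (dR U \<phi> p (axis 1 1)) *\<^sub>R \<tau> = - (sgn (N p \<bullet> wRR U \<phi> p) *\<^sub>R cross3 (N p) (dR U \<phi> p (axis 1 1)))"
proof -
  note c = chart_local_coordinates[OF U]
  have pM: "p \<in> M" using p LC_subset[OF c] by blast
  define r1 r2 k where "r1 = dR U \<phi> p (axis 1 1)" and "r2 = dR U \<phi> p (axis 2 1)" and "k = N p \<bullet> wRR U \<phi> p"
  have r1: "r1 \<noteq> 0" unfolding r1_def by (rule dR1_nonzero[OF c p])
  obtain w where w: "w $ 2 < 0" "\<tau> = dR U \<phi> p w" and n: "norm \<tau> = 1" and o: "\<tau> \<bullet> r1 = 0"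
    using \<tau> by (auto simp: conormal_candidate_def r1_def)
  have \<tau>w: "\<tau> = w $ 1 *\<^sub>R r1 + w $ 2 *\<^sub>R r2"
    unfolding w(2) r1_def r2_def by (rule linear_expand_vec2[OF linear_coord_differential[OF R_differentiable[OF c p]]])
  have "2 *\<^sub>R cross3 r1 r2 = k *\<^sub>R N p"
    using wRR_eq[OF c p] unfolding k_def r1_def r2_def wedge_self .
  then have "(1/2) *\<^sub>R (2 *\<^sub>R cross3 r1 r2) = (1/2) *\<^sub>R (k *\<^sub>R N p)" by (rule arg_cong)
  then have cr: "cross3 r1 r2 = (k / 2) *\<^sub>R N p" by simp
  have cr\<tau>: "cross3 r1 \<tau> = (w $ 2 * k / 2) *\<^sub>R N p"
    unfolding \<tau>w by (simp add: cross_add_right cross_mult_right cr)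
  have "norm (cross3 r1 \<tau>) = norm r1"
    using norm_cross_dot[of r1 \<tau>] o n by (simp add: inner_commute power2_eq_iff_nonneg)
  then have "\<bar>w $ 2 * k / 2\<bar> = norm r1" using norm_N[OF pM] unfolding cr\<tau> by simp
  moreover have "k \<noteq> 0" unfolding k_def by (rule N_wRR_nonzero[OF c p])
  ultimately have coef: "w $ 2 * k / 2 = - sgn k * norm r1"
    using w(1) by (cases "k > 0") (auto simp: abs_if mult_neg_pos mult_neg_neg mult_less_0_iff zero_less_mult_iff)
  have "(norm r1 * norm r1) *\<^sub>R \<tau> = cross3 (cross3 r1 \<tau>) r1"
    using o by (subst cross_skew) (simp add: Lagrange inner_commute power2_norm_eq_inner[symmetric] power2_eq_square)
  also have "\<dots> = norm r1 *\<^sub>R (- (sgn k *\<^sub>R cross3 (N p) r1))"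
    unfolding cr\<tau> coef by (simp add: cross_mult_left mult.commute)
  finally have "norm r1 *\<^sub>R (norm r1 *\<^sub>R \<tau>) = norm r1 *\<^sub>R (- (sgn k *\<^sub>R cross3 (N p) r1))" by simp
  then have "norm r1 *\<^sub>R \<tau> = - (sgn k *\<^sub>R cross3 (N p) r1)"
    using r1 unfolding scaleR_cancel_left by simp
  then show ?thesis unfolding r1_def k_def .
qed

text \<open>Gram-Schmidt: remove from \<open>R\<^sub>2\<close> its component along
  \<open>R\<^sub>1\<close>, normalize, and reverse the sign so that the preimage has second
  component \<open>- 1 / norm v\<close>.\<close>

lemma conormal_candidate_exists:
  assumes U: "(U, \<phi>) \<in> A" and p: "p \<in> U"
  shows "\<exists>\<tau>. conormal_candidate U \<phi> p \<tau>"
proof -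
  note c = chart_local_coordinates[OF U]
  define r1 r2 where "r1 = dR U \<phi> p (axis 1 1)" and "r2 = dR U \<phi> p (axis 2 1)"
  have l: "linear (dR U \<phi> p)" by (rule linear_coord_differential[OF R_differentiable[OF c p]])
  have cr: "cross3 r1 r2 \<noteq> 0" using wRR_nonzero[OF c p] by (auto simp: wedge_self r1_def r2_def)
  then have r1: "r1 \<noteq> 0" by auto
  define m where "m = (r2 \<bullet> r1) / (r1 \<bullet> r1)"
  define v where "v = r2 - m *\<^sub>R r1"
  have v0: "v \<noteq> 0"
  proof
    assume "v = 0"
    then have "r2 = m *\<^sub>R r1" by (simp add: v_def)
    then have "cross3 r1 r2 = 0" by (simp add: cross_mult_right)
    then show False using cr by simp
  qed
  define w where "w = (- 1 / norm v) *\<^sub>R (axis 2 1 - m *\<^sub>R axis 1 1 :: real^2)"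
  have dw: "dR U \<phi> p w = (- 1 / norm v) *\<^sub>R v"
    unfolding w_def v_def r1_def r2_def by (simp only: linear_cmul[OF l] linear_diff[OF l])
  have "w $ 2 < 0" using v0 by (simp add: w_def axis_def)
  moreover have "norm (dR U \<phi> p w) = 1" unfolding dw using v0 by simp
  moreover have "dR U \<phi> p w \<bullet> r1 = 0"
    unfolding dw using r1 by (simp add: v_def m_def inner_diff_left)
  ultimately show ?thesis unfolding conormal_candidate_def r1_def by blast
qed

text \<open>At a boundary point the Jacobian of the transition is triangular with positive lower
  right entry, so it maps outward vectors to outward vectors and preserves the tangent line of the
  boundary.\<close>

lemma conormal_candidate_change:
  assumes U: "(U, \<phi>) \<in> A" and W: "(W, \<psi>) \<in> A" and p: "p \<in> U \<inter> W" and bd: "p \<in> bd"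
    and \<tau>: "conormal_candidate W \<psi> p \<tau>"
  shows "conormal_candidate U \<phi> p \<tau>"
proof -
  note c = chart_local_coordinates[OF U] and c' = chart_local_coordinates[OF W]
  have pU: "p \<in> U" and pW: "p \<in> W" and p': "p \<in> W \<inter> U" using p by auto
  define J where "J = coord_differential W \<psi> \<phi> p"
  note t = coordinate_change_differentiable(1)[OF c' c p']
  have l: "linear J" unfolding J_def by (rule linear_coord_differential[OF t])
  have lR: "linear (dR U \<phi> p)" by (rule linear_coord_differential[OF R_differentiable[OF c pU]])
  note J = boundary_transition[OF U W p bd, folded J_def]
  have ch: "dR W \<psi> p w = dR U \<phi> p (J w)" for w
    unfolding J_def by (rule coord_differential_change(2)[OF c' c pW pU t R_differentiable[OF c pU]])
  obtain w where w: "w $ 2 < 0" "\<tau> = dR W \<psi> p w" and n: "norm \<tau> = 1" and o: "\<tau> \<bullet> dR W \<psi> p (axis 1 1) = 0"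
    using \<tau> by (auto simp: conormal_candidate_def)
  have "J w $ 2 = w $ 2 * J (axis 2 1) $ 2"
    by (subst linear_expand_vec2[OF l]) (simp add: J(1))
  then have "J w $ 2 < 0" using w(1) J(3) by (simp add: mult_neg_pos)
  moreover have "\<tau> = dR U \<phi> p (J w)" using w(2) ch by simp
  moreover have "\<tau> \<bullet> dR U \<phi> p (axis 1 1) = 0"
  proof -
    have e: "J (axis 1 1) = J (axis 1 1) $ 1 *\<^sub>R axis 1 1" using J(1) by (simp add: vec_eq_iff forall_2 axis_def)
    have "dR W \<psi> p (axis 1 1) = dR U \<phi> p (J (axis 1 1) $ 1 *\<^sub>R axis 1 1)"
      unfolding ch by (rule arg_cong[OF e])
    then have "dR W \<psi> p (axis 1 1) = J (axis 1 1) $ 1 *\<^sub>R dR U \<phi> p (axis 1 1)" by (simp only: linear_cmul[OF lR])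
    then show ?thesis using o J(2) by simp
  qed
  ultimately show ?thesis using n unfolding conormal_candidate_def by blast
qed

abbreviation con where "con \<equiv> outward_conormal A R"

lemma outward_conormal_candidate:
  assumes U: "(U, \<phi>) \<in> A" and p: "p \<in> U" and bd: "p \<in> bd"
  shows "conormal_candidate U \<phi> p (con p)"
proof -
  let ?P = "\<lambda>\<tau>. \<exists>(U, \<phi>)\<in>A. p \<in> U \<and> (\<exists>w. w $ 2 < 0 \<and> \<tau> = coord_differential U \<phi> R p w) \<and>
        norm \<tau> = 1 \<and> \<tau> \<bullet> coord_deriv U \<phi> 1 R p = 0"
  have P: "?P \<tau> \<longleftrightarrow> conormal_candidate U \<phi> p \<tau>" for \<tau>
  proof
    assume "?P \<tau>"
    then obtain x where "x \<in> A" "case x of (U, \<phi>) \<Rightarrow> p \<in> U \<and> (\<exists>w. w $ 2 < 0 \<and> \<tau> = coord_differential U \<phi> R p w) \<and>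
        norm \<tau> = 1 \<and> \<tau> \<bullet> coord_deriv U \<phi> 1 R p = 0" by (rule bexE)
    moreover obtain W \<psi> where "x = (W, \<psi>)" by (cases x)
    ultimately have W: "(W, \<psi>) \<in> A" "p \<in> W" "conormal_candidate W \<psi> p \<tau>"
      by (simp_all add: conormal_candidate_def coord_deriv_def)
    then show "conormal_candidate U \<phi> p \<tau>" using conormal_candidate_change[OF U W(1) _ bd W(3)] p by blast
  next
    assume "conormal_candidate U \<phi> p \<tau>"
    then show "?P \<tau>" using U p unfolding conormal_candidate_def coord_deriv_def by (intro bexI[OF _ U]) simp
  qed
  have un: "\<tau> = \<tau>'" if "conormal_candidate U \<phi> p \<tau>" "conormal_candidate U \<phi> p \<tau>'" for \<tau> \<tau>'
  proof -
    have "norm (dR U \<phi> p (axis 1 1)) *\<^sub>R \<tau> = norm (dR U \<phi> p (axis 1 1)) *\<^sub>R \<tau>'"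
      using conormal_candidate_eq[OF U p that(1)] conormal_candidate_eq[OF U p that(2)] by (rule trans[OF _ sym])
    then show ?thesis using dR1_nonzero[OF chart_local_coordinates[OF U] p] unfolding scaleR_cancel_left by simp
  qed
  obtain \<tau> where \<tau>: "conormal_candidate U \<phi> p \<tau>" using conormal_candidate_exists[OF U p] by blast
  have "con p = \<tau>" unfolding outward_conormal_def P
    by (rule the_equality[where P = "conormal_candidate U \<phi> p", OF \<tau> un[OF _ \<tau>]])
  then show ?thesis using \<tau> by simp
qed

text \<open>Rewrites the conormal component as the second component of the vector field whose
  divergence is integrated, up to the orientation sign. The minus sign matches the outward direction
  at the bottom edge of a box.\<close>

lemma inner_outward_conormal:
  assumes U: "(U, \<phi>) \<in> A" and p: "p \<in> U" and bd: "p \<in> bd"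
  shows "norm (dR U \<phi> p (axis 1 1)) * (v \<bullet> con p) =
    - sgn (N p \<bullet> wRR U \<phi> p) * (N p \<bullet> cross3 (dR U \<phi> p (axis 1 1)) v)"
proof -
  have "norm (dR U \<phi> p (axis 1 1)) * (v \<bullet> con p) = v \<bullet> (norm (dR U \<phi> p (axis 1 1)) *\<^sub>R con p)" by simp
  also have "\<dots> = - sgn (N p \<bullet> wRR U \<phi> p) * (v \<bullet> cross3 (N p) (dR U \<phi> p (axis 1 1)))"
    unfolding conormal_candidate_eq[OF U p outward_conormal_candidate[OF assms]] by simp
  also have "v \<bullet> cross3 (N p) (dR U \<phi> p (axis 1 1)) = N p \<bullet> cross3 (dR U \<phi> p (axis 1 1)) v"
    by (metis cross_triple inner_commute)
  finally show ?thesis .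
qed

text \<open>The reason why only the tangential part of \<open>V\<close> enters the boundary
  integral.\<close>

lemma N_inner_conormal:
  assumes "p \<in> bd" shows "N p \<bullet> con p = 0"
proof -
  have "p \<in> M" using assms bd_subset by blast
  then obtain U \<phi> where U: "(U, \<phi>) \<in> A" "p \<in> U" by (rule chart_at)
  then show ?thesis
    using outward_conormal_candidate[OF U assms] N_inner_dR[OF chart_local_coordinates[OF U(1)] U(2)]
    unfolding conormal_candidate_def by metis
qed

text \<open>\<open>con\<close> comes from \<open>THE\<close>, so measurability is obtained from the
  continuity, in charts, of an explicit formula for \<open>V p \<bullet> con p\<close>. The sign is
  written as \<open>?k p / \<bar>?k p\<bar>\<close>, which is visibly continuous where
  \<open>?k\<close> is nonzero.\<close>

lemma conormal_measurable:
  assumes V: "C1_on M V"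
  shows "(\<lambda>p. V p \<bullet> con p) \<in> borel_measurable ds"
proof -
  let ?\<C> = "(\<lambda>x. fst x \<inter> bd) ` A"
  have cov: "\<Union>?\<C> = bd"
  proof (intro equalityI subsetI)
    fix p assume p: "p \<in> bd"
    then have "p \<in> M" using bd_subset by blast
    then obtain U \<phi> where "(U, \<phi>) \<in> A" "p \<in> U" by (rule chart_at)
    then show "p \<in> \<Union>?\<C>" using p by (intro UnionI[of "U \<inter> bd"] image_eqI[of _ _ "(U, \<phi>)"]) auto
  qed auto
  have "continuous_on (\<Union>?\<C>) (\<lambda>p. V p \<bullet> con p)"
  proof (rule continuous_on_open_Union_openin)
    fix X assume "X \<in> ?\<C>"
    then obtain x where x: "X = fst x \<inter> bd" "x \<in> A" by (rule imageE)
    define U \<phi> where "U = fst x" and "\<phi> = snd x"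
    have U: "(U, \<phi>) \<in> A" and X: "X = U \<inter> bd" using x by (simp_all add: U_def \<phi>_def)
    note c = chart_local_coordinates[OF U]
    show "openin (top_of_set (\<Union>?\<C>)) X"
      unfolding cov X using openin_Int_relative[OF chart_open[OF U] bd_subset] by (simp add: Int_commute)
    have UM: "U \<inter> M = U" using LC_subset[OF c] by blast
    let ?k = "\<lambda>p. N p \<bullet> wRR U \<phi> p" and ?r = "\<lambda>p. dR U \<phi> p (axis 1 1)"
    have "continuous_on U N" "continuous_on U V"
      using C1_on_imp_continuous_on[OF N_C1_on] C1_on_imp_continuous_on[OF V] LC_subset[OF c]
      by (auto intro: continuous_on_subset)
    moreover have "continuous_on U (wRR U \<phi>)" using continuous_on_wedge[OF R_C1_on R_C1_on c] unfolding UM .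
    moreover have "continuous_on U ?r" by (rule C1_on_imp_continuous_on[OF differential_C1_on[OF R_smooth c]])
    ultimately have "continuous_on U (\<lambda>p. - (?k p / \<bar>?k p\<bar>) * (N p \<bullet> cross3 (?r p) (V p)) / norm (?r p))"
      using N_wRR_nonzero[OF c] dR1_nonzero[OF c] by (intro continuous_intros continuous_on_cross) auto
    then have "continuous_on X (\<lambda>p. - (?k p / \<bar>?k p\<bar>) * (N p \<bullet> cross3 (?r p) (V p)) / norm (?r p))"
      by (rule continuous_on_subset) (simp add: X)
    then show "continuous_on X (\<lambda>p. V p \<bullet> con p)"
    proof (rule continuous_on_eq)
      fix p assume "p \<in> X"
      then have p: "p \<in> U" "p \<in> bd" using X by auto
      have "norm (?r p) * (V p \<bullet> con p) = - (?k p / \<bar>?k p\<bar>) * (N p \<bullet> cross3 (?r p) (V p))"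
        using inner_outward_conormal[OF U p] by (simp add: sgn_div_norm divide_inverse mult.commute)
      then show "- (?k p / \<bar>?k p\<bar>) * (N p \<bullet> cross3 (?r p) (V p)) / norm (?r p) = V p \<bullet> con p"
        using dR1_nonzero[OF c p(1)] by (metis nonzero_mult_div_cancel_left norm_eq_zero)
    qed
  qed
  then have "(\<lambda>p. V p \<bullet> con p) \<in> borel_measurable BB"
    unfolding cov by (rule borel_measurable_continuous_on_restrict)
  then show ?thesis using measurable_cong_sets[OF sets_boundary_measure refl] by blast
qed

end

text \<open>A change of sign on a connected set would produce a zero. This fixes the orientation of
  a chart relative to \<open>N\<close> on a whole box.\<close>

lemma constant_sgn_on_connected:
  fixes f :: "'a::topological_space \<Rightarrow> real"
  assumes S: "connected S" and f: "continuous_on S f" and nz: "\<And>x. x \<in> S \<Longrightarrow> f x \<noteq> 0"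
  obtains e :: real where "\<And>x. x \<in> S \<Longrightarrow> sgn (f x) = e"
proof (cases "S = {}")
  case False
  then obtain y where y: "y \<in> S" by blast
  have conn: "connected (f ` S)" using connected_continuous_image[OF f S] .
  have "sgn (f x) = sgn (f y)" if x: "x \<in> S" for x
  proof (rule ccontr)
    assume ne: "sgn (f x) \<noteq> sgn (f y)"
    have "0 \<in> f ` S"
    proof (cases "f x < 0")
      case True
      then have "f y > 0" using ne nz[OF y] by (cases "f y < 0") auto
      then show ?thesis using connected_contains_Icc[OF conn, of "f x" "f y"] x y True by auto
    next
      case False
      then have "f x > 0" using nz[OF x] by auto
      then have "f y < 0" using ne nz[OF y] by (cases "f y < 0") auto
      then show ?thesis using connected_contains_Icc[OF conn, of "f y" "f x"] x y \<open>f x > 0\<close> by auto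
    qed
    then show False using nz by auto
  qed
  then show ?thesis using that by blast
qed (use that in auto)

section \<open>The divergence theorem on a coordinate box\<close>

context surface_immersion begin

text \<open>On the connected box the orientation sign is a constant \<open>\<epsilon>\<close>. The
  area density is \<open>\<bar>k\<bar> / 2 = \<epsilon> * k / 2\<close>, so the integrand times the
  density is \<open>\<epsilon>\<close> times the divergence, while the bottom edge carries the flux
  with factor \<open>- \<epsilon>\<close>. The field vanishes on the bottom edge too unless this
  edge lies on the boundary line.\<close>

lemma divergence_theorem_chart_box:
  assumes U: "(U, \<phi>) \<in> A" and V: "C1_on M V"
    and ab: "a $ 1 \<le> b $ 1" "a $ 2 \<le> b $ 2" and box: "cbox a b \<subseteq> \<phi> ` U"
    and supp: "\<And>p. p \<in> M \<Longrightarrow> V p \<noteq> 0 \<Longrightarrow> p \<in> U \<and> \<phi> p \<in> cbox a b"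
    and side1: "\<And>p. p \<in> U \<Longrightarrow> \<phi> p $ 1 = a $ 1 \<or> \<phi> p $ 1 = b $ 1 \<Longrightarrow> V p = 0"
    and side2: "\<And>p. p \<in> U \<Longrightarrow> \<phi> p $ 2 = b $ 2 \<Longrightarrow> V p = 0"
    and side3: "\<And>p. p \<in> U \<Longrightarrow> \<phi> p $ 2 = a $ 2 \<Longrightarrow> a $ 2 \<noteq> 0 \<Longrightarrow> V p = 0"
  shows "(\<integral>p. 2 * (N p \<bullet> rel_wedge R V p) + 2 * (mean_curvature M A R N p * (V p \<bullet> N p)) \<partial>dA) = (\<integral>p. V p \<bullet> con p \<partial>ds)"
    and "integrable ds (\<lambda>p. V p \<bullet> con p)"
proof -
  note c = chart_local_coordinates[OF U]
  have UM: "U \<subseteq> M" by (rule LC_subset[OF c])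
  let ?i = "inv_into U \<phi>" and ?H = "mean_curvature M A R N"
  let ?K = "?i ` cbox a b"
  have ic: "continuous_on (cbox a b) ?i" using LC_continuous_inv[OF c] box by (rule continuous_on_subset)
  have K: "compact ?K" "?K \<subseteq> M"
    using compact_continuous_image[OF ic compact_cbox] box UM inv_into_into[of _ \<phi> U] by auto
  have iU: "?i x \<in> U" "\<phi> (?i x) = x" if "x \<in> cbox a b" for x
    using that box by (auto intro: inv_into_into f_inv_into_f)
  have VK: "V p = 0" if "p \<in> M - ?K" for p
  proof (rule ccontr)
    assume "V p \<noteq> 0"
    then have "p \<in> U" "\<phi> p \<in> cbox a b" using supp that by auto
    then have "p \<in> ?K" using LC_inv[OF c, of p] by (metis imageI)
    then show False using that by blast
  qed
  have a2: "0 \<le> a $ 2"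
  proof -
    have "a \<in> cbox a b" using ab by (auto simp: mem_box_cart forall_2)
    then have "a \<in> half_plane" using box openin_imp_subset[OF chart_image_open[OF U]] by blast
    then show ?thesis by (simp add: half_plane_def)
  qed
  let ?k = "\<lambda>p. N p \<bullet> wRR U \<phi> p"
  have cN: "continuous_on U N" using C1_on_imp_continuous_on[OF N_C1_on] UM by (rule continuous_on_subset)
  have cW: "continuous_on U (wRR U \<phi>)" using continuous_on_wedge[OF R_C1_on R_C1_on c] UM by (simp add: Int_absorb2)
  have "continuous_on (cbox a b) (\<lambda>x. ?k (?i x))"
    by (rule continuous_on_compose2[OF continuous_on_inner[OF cN cW] ic]) (use iU in auto)
  then obtain \<epsilon> where \<epsilon>: "\<And>x. x \<in> cbox a b \<Longrightarrow> sgn (?k (?i x)) = \<epsilon>"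
    using N_wRR_nonzero[OF c] iU(1) convex_connected[OF convex_box(1)]
    by (rule_tac constant_sgn_on_connected[of "cbox a b" "\<lambda>x. ?k (?i x)"]) auto
  let ?g1 = "\<lambda>q. N q \<bullet> cross3 (V q) (dR U \<phi> q (axis 2 1))"
  let ?g2 = "\<lambda>q. N q \<bullet> cross3 (dR U \<phi> q (axis 1 1)) (V q)"
  let ?D = "coord_differential U \<phi>"
  have NU: "C1_on U N" and VU: "C1_on U V"
    using C1_on_subset[OF N_C1_on LC_open[OF c] UM] C1_on_subset[OF V LC_open[OF c] UM] .
  have g: "C1_on U ?g1" "C1_on U ?g2"
    by (intro C1_on_bilinear[OF bounded_bilinear_inner] C1_on_bilinear[OF bounded_bilinear_cross3]
        NU VU differential_C1_on[OF R_smooth c])+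
  have der: "((\<lambda>x. g (?i x)) has_derivative ?D g (?i x)) (at x within cbox a b)"
    and cont: "continuous_on (cbox a b) (\<lambda>x. ?D g (?i x) w)"
    if g: "C1_on U g" and x: "x \<in> cbox a b" for g :: "'a \<Rightarrow> real" and x w
  proof -
    have "(g \<circ> ?i has_derivative ?D g (?i x)) (at (\<phi> (?i x)) within \<phi> ` U)"
      by (rule coord_differential_works[OF C1_on_differentiable[OF g c iU(1)[OF x] iU(1)[OF x]]])
    then show "((\<lambda>x. g (?i x)) has_derivative ?D g (?i x)) (at x within cbox a b)"
      unfolding iU(2)[OF x] comp_def using box by (rule has_derivative_subset)
    have "continuous_on U (\<lambda>p. ?D g p w)" using C1_on_continuous_differential[OF g c] by simp
    then show "continuous_on (cbox a b) (\<lambda>x. ?D g (?i x) w)"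
      by (rule continuous_on_compose2[OF _ ic]) (use iU in auto)
  qed
  have amem: "a \<in> cbox a b" using ab by (auto simp: mem_box_cart forall_2)
  let ?line = "\<lambda>s. indicator {a$1..b$1} s * ?g2 (?i (vector [s, a$2]))"
  have "(\<integral>x. indicator (cbox a b) x * (?D ?g1 (?i x) (axis 1 1) + ?D ?g2 (?i x) (axis 2 1)) \<partial>lborel)
      = - (\<integral>s. ?line s \<partial>lborel)"
  proof (rule divergence_theorem_box[OF ab])
    show "((\<lambda>x. ?g1 (?i x)) has_derivative ?D ?g1 (?i x)) (at x within cbox a b)" if "x \<in> cbox a b" for x
      by (rule der[OF g(1) that])
    show "((\<lambda>x. ?g2 (?i x)) has_derivative ?D ?g2 (?i x)) (at x within cbox a b)" if "x \<in> cbox a b" for x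
      by (rule der[OF g(2) that])
    show "continuous_on (cbox a b) (\<lambda>x. ?D ?g1 (?i x) (axis 1 1))" by (rule cont[OF g(1) amem])
    show "continuous_on (cbox a b) (\<lambda>x. ?D ?g2 (?i x) (axis 2 1))" by (rule cont[OF g(2) amem])
    show "?g1 (?i x) = 0" if "x \<in> cbox a b" "x $ 1 = a $ 1 \<or> x $ 1 = b $ 1" for x
      using side1[OF iU(1)[OF that(1)]] that iU(2)[OF that(1)] by simp
    show "?g2 (?i x) = 0" if "x \<in> cbox a b" "x $ 2 = b $ 2" for x
      using side2[OF iU(1)[OF that(1)]] that iU(2)[OF that(1)] by simp
  qed
  moreover have "indicator (\<phi> ` U) x * (area_density U \<phi> R (?i x) *
        (2 * (N (?i x) \<bullet> rel_wedge R V (?i x)) + 2 * (?H (?i x) * (V (?i x) \<bullet> N (?i x)))))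
      = \<epsilon> * (indicator (cbox a b) x * (?D ?g1 (?i x) (axis 1 1) + ?D ?g2 (?i x) (axis 2 1)))" for x
  proof (cases "x \<in> cbox a b")
    case True
    define p where "p = ?i x"
    have p: "p \<in> U" using iU(1)[OF True] by (simp add: p_def)
    have Vd: "coord_differentiable U \<phi> V p" using C1_on_differentiable[OF VU c p p] .
    define k where "k = ?k p"
    have k0: "k \<noteq> 0" unfolding k_def by (rule N_wRR_nonzero[OF c p])
    have dens: "area_density U \<phi> R p = \<bar>k\<bar> / 2" using abs_N_wRR[OF c p] by (simp add: k_def)
    have "\<bar>k\<bar> = sgn k * k" by (simp add: abs_sgn mult.commute)
    moreover have "sgn k = \<epsilon>" using \<epsilon>[OF True] by (simp add: k_def p_def)
    ultimately have ak: "\<bar>k\<bar> = \<epsilon> * k" by simp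
    have div: "?D ?g1 p (axis 1 1) + ?D ?g2 p (axis 2 1) = N p \<bullet> wedge (dR U \<phi> p) (?D V p) + ?H p * (V p \<bullet> wRR U \<phi> p)"
      by (rule divergence_in_chart[OF U p Vd])
    have VW: "V p \<bullet> wRR U \<phi> p = k * (V p \<bullet> N p)"
      by (subst wRR_eq[OF c p]) (simp add: k_def)
    have rw: "N p \<bullet> rel_wedge R V p = (N p \<bullet> wedge (dR U \<phi> p) (?D V p)) / k"
      unfolding rel_wedge_eq[OF R_C1_on V c p] k_def by simp
    have "area_density U \<phi> R p * (2 * (N p \<bullet> rel_wedge R V p) + 2 * (?H p * (V p \<bullet> N p)))
        = \<epsilon> * (?D ?g1 p (axis 1 1) + ?D ?g2 p (axis 2 1))"
      unfolding div dens ak VW rw using k0 by (simp add: field_simps)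
    then show ?thesis using True box by (simp add: p_def subset_iff)
  next
    case False
    show ?thesis
    proof (cases "x \<in> \<phi> ` U")
      case True
      have "?i x \<in> M - ?K"
      proof
        show "?i x \<in> M" using UM inv_into_into[OF True] by blast
        show "?i x \<notin> ?K"
        proof
          assume "?i x \<in> ?K"
          then obtain y where "y \<in> cbox a b" "?i x = ?i y" by blast
          then have "x = y" using True box by (metis f_inv_into_f subsetD)
          then show False using \<open>y \<in> cbox a b\<close> False by simp
        qed
      qed
      then show ?thesis
        using False VK rel_wedge_outside[OF K V VK R_C1_on] by simp
    qed (use False in simp)
  qed
  moreover have "(\<integral>p. 2 * (N p \<bullet> rel_wedge R V p) + 2 * (?H p * (V p \<bullet> N p)) \<partial>dA)
      = (\<integral>x. indicator (\<phi> ` U) x * (area_density U \<phi> R (?i x) *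
        (2 * (N (?i x) \<bullet> rel_wedge R V (?i x)) + 2 * (?H (?i x) * (V (?i x) \<bullet> N (?i x))))) \<partial>lborel)"
  proof (rule integral_area_measure[OF R_C1_on c])
    show "(\<lambda>p. 2 * (N p \<bullet> rel_wedge R V p) + 2 * (?H p * (V p \<bullet> N p))) \<in> borel_measurable dA"
      by (rule continuous_on_M_measurable)
         (intro continuous_intros continuous_on_rel_wedge continuous_on_mean_curvature R_C1_on V
            C1_on_imp_continuous_on[OF N_C1_on] C1_on_imp_continuous_on[OF V])
    show "2 * (N p \<bullet> rel_wedge R V p) + 2 * (?H p * (V p \<bullet> N p)) = 0" if p: "p \<in> M - U" for p
    proof -
      have "p \<in> M - ?K" using p iU(1) by auto
      then show ?thesis using VK rel_wedge_outside[OF K V VK R_C1_on] by simp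
    qed
  qed
  ultimately have I: "(\<integral>p. 2 * (N p \<bullet> rel_wedge R V p) + 2 * (?H p * (V p \<bullet> N p)) \<partial>dA) = \<epsilon> * - (\<integral>s. ?line s \<partial>lborel)"
    by (simp only:) simp
  \<comment> \<open>Where \<open>V\<close> is nonzero at a boundary point, \<open>a $ 2 = 0\<close>
    and the bottom edge runs along the boundary line. In the other cases both sides vanish: by
    \<open>side3\<close> when \<open>a $ 2\<close> is nonzero, otherwise because both sides see the
    same point.\<close>
  have bdl: "indicator (bline \<phi> U) s * (bspeed U \<phi> s * (V (bpt U \<phi> s) \<bullet> con (bpt U \<phi> s))) = - \<epsilon> * ?line s" for s
  proof (cases "s \<in> bline \<phi> U")
    case True
    let ?p = "bpt U \<phi> s"
    note p = bline_point[OF U True]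
    have lhs: "bspeed U \<phi> s * (V ?p \<bullet> con ?p) = - sgn (?k ?p) * ?g2 ?p"
      using inner_outward_conormal[OF U p(1,2)] by (simp add: coord_deriv_def)
    show ?thesis
    proof (cases "V ?p = 0")
      case V0: True
      have "?line s = 0"
      proof (cases "s \<in> {a$1..b$1}")
        case s: True
        have mem: "vector [s, a$2] \<in> cbox a b" using s ab by (simp add: mem_box_cart forall_2)
        have "V (?i (vector [s, a$2])) = 0"
        proof (cases "a $ 2 = 0")
          case True
          then have "(vector [s, a$2] :: real^2) = axis 1 s" by (simp add: vec_eq_iff forall_2 axis_def)
          then show ?thesis using V0 by simp
        next
          case False
          then show ?thesis using side3[OF iU(1)[OF mem]] iU(2)[OF mem] by simp
        qed
        then show ?thesis by simp
      qed simp
      then show ?thesis using V0 by simp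
    next
      case False
      then have mem: "axis 1 s \<in> cbox a b" using supp[of ?p] p UM by auto
      then have s: "s \<in> {a$1..b$1}" and "a $ 2 \<le> 0" by (auto simp: mem_box_cart forall_2 axis_def)
      then have "(vector [s, a$2] :: real^2) = axis 1 s" using a2 by (simp add: vec_eq_iff forall_2 axis_def)
      then have "?line s = ?g2 ?p" using s by simp
      then show ?thesis using lhs True \<epsilon>[OF mem] by simp
    qed
  next
    case False
    have "?line s = 0"
    proof (cases "s \<in> {a$1..b$1}")
      case s: True
      have mem: "vector [s, a$2] \<in> cbox a b" using s ab by (simp add: mem_box_cart forall_2)
      have "a $ 2 \<noteq> 0"
      proof
        assume "a $ 2 = 0"
        then have "(vector [s, a$2] :: real^2) = axis 1 s" by (simp add: vec_eq_iff forall_2 axis_def)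
        then show False using mem box False by auto
      qed
      then show ?thesis using side3[OF iU(1)[OF mem]] iU(2)[OF mem] by simp
    qed simp
    then show ?thesis using False by simp
  qed
  have B0: "V p \<bullet> con p = 0" if "p \<in> bd - U" for p
    using that supp[of p] bd_subset by (cases "V p = 0") auto
  have "(\<integral>p. V p \<bullet> con p \<partial>ds) =
      (\<integral>s. indicator (bline \<phi> U) s * (bspeed U \<phi> s * (V (bpt U \<phi> s) \<bullet> con (bpt U \<phi> s))) \<partial>lborel)"
    by (rule integral_boundary_measure[OF U conormal_measurable[OF V] B0])
  also have "\<dots> = (\<integral>s. - \<epsilon> * ?line s \<partial>lborel)"
    by (rule Bochner_Integration.integral_cong[OF refl bdl])
  finally show "(\<integral>p. 2 * (N p \<bullet> rel_wedge R V p) + 2 * (?H p * (V p \<bullet> N p)) \<partial>dA) = (\<integral>p. V p \<bullet> con p \<partial>ds)"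
    unfolding I by simp
  have "continuous_on {a$1..b$1} (\<lambda>s. ?g2 (?i (vector [s, a$2])))"
  proof (rule continuous_on_compose2[OF C1_on_imp_continuous_on[OF g(2)]])
    show "continuous_on {a$1..b$1} (\<lambda>s. ?i (vector [s, a$2]))"
      by (rule continuous_on_compose2[OF ic])
         (use ab in \<open>auto simp: vec2_alt[symmetric] mem_box_cart forall_2 intro!: continuous_on_eq[OF continuous_on_add[OF continuous_on_scaleR[OF continuous_on_id continuous_on_const] continuous_on_const] vec2_alt[symmetric]]\<close>)
    show "(\<lambda>s. ?i (vector [s, a$2])) ` {a$1..b$1} \<subseteq> U"
      using ab by (auto intro!: iU(1) simp: mem_box_cart forall_2)
  qed
  from borel_integrable_compact[OF compact_Icc this]
  have "integrable lborel ?line" by (simp add: indicator_def if_distrib cong: if_cong)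
  then have "integrable lborel (\<lambda>s. - \<epsilon> * ?line s)" by (intro integrable_mult_right)
  then have "integrable lborel (\<lambda>s. indicator (bline \<phi> U) s * (bspeed U \<phi> s * (V (bpt U \<phi> s) \<bullet> con (bpt U \<phi> s))))"
    by (simp only: bdl)
  then show "integrable ds (\<lambda>p. V p \<bullet> con p)"
    using integrable_boundary_measure[OF U conormal_measurable[OF V] B0] by (simp only:)
qed

end

subsection \<open>Partition of unity\<close>

text \<open>Squaring removes the corner of \<open>max 0\<close> and leaves a C^1 function with
  derivative \<open>2 * max 0 x\<close>; second derivatives of cut-off functions are never
  taken.\<close>

definition square_pos :: "real \<Rightarrow> real" where
  "square_pos x = (max 0 x)\<^sup>2"

lemma square_pos_derivative: "(square_pos has_real_derivative 2 * max 0 x) (at x)"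
proof -
  consider "x < 0" | "x = 0" | "x > 0" by linarith
  then show ?thesis
  proof cases
    case 1
    have "(square_pos has_real_derivative 0) (at x)"
      by (rule has_field_derivative_transform_within_open[OF DERIV_const[of 0] open_lessThan[of 0]])
         (use 1 in \<open>auto simp: square_pos_def\<close>)
    then show ?thesis using 1 by simp
  next
    case 2
    have "(square_pos has_real_derivative 0) (at 0)"
      by (rule has_real_derivative_quadratic_remainder[where C = 1])
         (auto simp: square_pos_def max_def)
    then show ?thesis using 2 by simp
  next
    case 3
    have "((\<lambda>x. x\<^sup>2) has_real_derivative 2 * x) (at x)" by (auto intro!: derivative_eq_intros)
    then have "(square_pos has_real_derivative 2 * x) (at x)"
      by (rule has_field_derivative_transform_within_open[OF _ open_greaterThan[of 0]])
         (use 3 in \<open>auto simp: square_pos_def\<close>)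
    then show ?thesis using 3 by simp
  qed
qed

text \<open>For positive \<open>e\<close> this is positive exactly at distance less than
  \<open>e\<close> from \<open>x0\<close>.\<close>

definition bump :: "real \<Rightarrow> real \<Rightarrow> real \<Rightarrow> real" where
  "bump x0 e x = square_pos (1 - ((x - x0) / e)\<^sup>2)"

lemma bump_derivative:
  "(bump x0 e has_real_derivative 2 * max 0 (1 - ((x - x0) / e)\<^sup>2) * - (2 * ((x - x0) / e) * (1 / e))) (at x)"
proof -
  have "((\<lambda>x. 1 - ((x - x0) / e)\<^sup>2) has_real_derivative - (2 * ((x - x0) / e) * (1 / e))) (at x)"
    by (auto intro!: derivative_eq_intros simp: divide_inverse)
  from DERIV_chain2[OF square_pos_derivative this] show ?thesis unfolding bump_def[abs_def] .
qed

lemma bump_nonneg: "0 \<le> bump x0 e x"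
  by (simp add: bump_def square_pos_def)

lemma bump_center: "bump x0 e x0 = 1"
  by (simp add: bump_def square_pos_def)

lemma bump_nonzero:
  assumes "e > 0" "bump x0 e x \<noteq> 0" shows "\<bar>x - x0\<bar> < e"
proof (rule ccontr)
  assume "\<not> \<bar>x - x0\<bar> < e"
  then have "1 \<le> \<bar>(x - x0) / e\<bar>" using assms(1) by (simp add: abs_divide)
  then have "1\<^sup>2 \<le> \<bar>(x - x0) / e\<bar>\<^sup>2" by (intro power_mono) auto
  then have "1 \<le> ((x - x0) / e)\<^sup>2" by (simp only: power2_abs one_power2)
  then have "max 0 (1 - ((x - x0) / e)\<^sup>2) = 0" by simp
  then show False using assms(2) by (simp add: bump_def square_pos_def)
qed

context surface_immersion begin

lemma C1_on_bump_coordinate: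
  assumes c: "LC U c"
  shows "C1_on U (\<lambda>q. bump x0 e (c q $ i))"
proof -
  have "C1_on U (\<lambda>q. c q \<bullet> axis i 1)"
    by (rule C1_on_bilinear[OF bounded_bilinear_inner C1_on_coordinates[OF c] C1_on_const[OF LC_open[OF c]]])
  then have "C1_on U (\<lambda>q. bump x0 e (c q \<bullet> axis i 1))"
    by (rule C1_on_compose_real[OF _ bump_derivative]) (cases "e = 0"; auto intro!: continuous_intros)
  then show ?thesis by (simp add: inner_axis)
qed

text \<open>A box either has its centre on the boundary line or does not meet that line; this
  dichotomy decides whether its bottom edge contributes to the boundary integral.\<close>

lemma chart_box_at:
  assumes "p \<in> M"
  shows "\<exists>U \<phi> e. (U, \<phi>) \<in> A \<and> p \<in> U \<and> e > 0 \<and> (\<phi> p $ 2 = 0 \<or> e < \<phi> p $ 2) \<and>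
    {x. \<bar>x $ 1 - \<phi> p $ 1\<bar> \<le> e \<and> \<bar>x $ 2 - \<phi> p $ 2\<bar> \<le> e \<and> 0 \<le> x $ 2} \<subseteq> \<phi> ` U"
proof -
  obtain U \<phi> where U: "(U, \<phi>) \<in> A" "p \<in> U" using assms by (rule chart_at)
  have pp: "p \<in> U \<inter> U" using U(2) by blast
  obtain d where d: "d > 0" "ball (\<phi> p) d \<inter> half_plane \<subseteq> \<phi> ` (U \<inter> U)"
    using chart_overlap_open[OF U(1) U(1) pp] by blast
  have nn: "0 \<le> \<phi> p $ 2" by (rule chart_half_plane[OF U])
  \<comment> \<open>A third of \<open>d\<close> keeps the sum of the two coordinate deviations, at
    most \<open>2 * e\<close>, below \<open>d\<close>; half the height keeps a box around an
    interior point strictly above the boundary line.\<close>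
  define e where "e = (if \<phi> p $ 2 = 0 then d / 3 else min (d / 3) (\<phi> p $ 2 / 2))"
  have e: "e > 0" "e \<le> d / 3" "\<phi> p $ 2 = 0 \<or> e < \<phi> p $ 2" using d(1) nn by (auto simp: e_def)
  have "x \<in> \<phi> ` U" if x: "\<bar>x $ 1 - \<phi> p $ 1\<bar> \<le> e" "\<bar>x $ 2 - \<phi> p $ 2\<bar> \<le> e" "0 \<le> x $ 2" for x
  proof -
    have "norm (x - \<phi> p) \<le> (\<Sum>i\<in>UNIV. \<bar>(x - \<phi> p) $ i\<bar>)" by (rule norm_le_l1_cart)
    also have "\<dots> \<le> 2 * e" using x by (simp add: sum_2)
    also have "\<dots> < d" using e(2) d(1) by simp
    finally have "x \<in> ball (\<phi> p) d" by (simp add: dist_norm norm_minus_commute)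
    then show ?thesis using d(2) x(3) by (auto simp: half_plane_def)
  qed
  then show ?thesis using U e(1,3) by (intro exI[of _ U] exI[of _ \<phi>] exI[of _ e]) auto
qed

text \<open>The properties of a vector field that make the first variation formula hold for it are
  additive, so that a partition of unity reduces the formula to chart boxes.\<close>

definition first_variation_identity :: "('a \<Rightarrow> real^3) \<Rightarrow> bool" where
  "first_variation_identity V \<longleftrightarrow> C1_on M V \<and>
     integrable dA (\<lambda>p. N p \<bullet> rel_wedge R V p) \<and>
     integrable dA (\<lambda>p. mean_curvature M A R N p * (V p \<bullet> N p)) \<and>
     integrable ds (\<lambda>p. V p \<bullet> con p) \<and>
     (\<integral>p. 2 * (N p \<bullet> rel_wedge R V p) \<partial>dA) + 2 * (\<integral>p. mean_curvature M A R N p * (V p \<bullet> N p) \<partial>dA)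
       = (\<integral>p. V p \<bullet> con p \<partial>ds)"

lemma rel_wedge_add:
  assumes V: "C1_on M V" and W: "C1_on M W" and p: "p \<in> M"
  shows "rel_wedge R (\<lambda>p. V p + W p) p = rel_wedge R V p + rel_wedge R W p"
proof -
  obtain U \<phi> where U: "(U, \<phi>) \<in> A" "p \<in> U" using p by (rule chart_at)
  note c = chart_local_coordinates[OF U(1)]
  note D = coord_differential_add(2)[OF c U(2) C1_on_differentiable[OF V c U(2) p] C1_on_differentiable[OF W c U(2) p]]
  show ?thesis
    unfolding rel_wedge_eq[OF R_C1_on C1_on_add[OF V W] c U(2)] rel_wedge_eq[OF R_C1_on V c U(2)]
      rel_wedge_eq[OF R_C1_on W c U(2)] wedge_def D
    by (simp add: cross_add_right scaleR_add_right scaleR_diff_right)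
qed

lemma rel_wedge_cong:
  assumes V: "C1_on M V" and eq: "\<And>p. p \<in> M \<Longrightarrow> V p = W p" and p: "p \<in> M"
  shows "rel_wedge R W p = rel_wedge R V p"
proof -
  obtain U \<phi> where U: "(U, \<phi>) \<in> A" "p \<in> U" using p by (rule chart_at)
  note c = chart_local_coordinates[OF U(1)]
  have "coord_differential U \<phi> W p = coord_differential U \<phi> V p"
    by (rule coord_differential_cong(2)[OF c C1_on_open[OF V] p U(2) _ C1_on_differentiable[OF V c U(2) p]])
       (use eq in auto)
  moreover have W: "C1_on M W" by (rule C1_on_cong[OF V eq])
  ultimately show ?thesis
    unfolding rel_wedge_eq[OF R_C1_on W c U(2)] rel_wedge_eq[OF R_C1_on V c U(2)] by simp
qed

text \<open>Vector fields are total functions on the type, and the partition of unity recovers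
  \<open>V\<close> only on \<open>M\<close>.\<close>

lemma first_variation_identity_cong:
  assumes V: "first_variation_identity V" and eq: "\<And>p. p \<in> M \<Longrightarrow> V p = W p"
  shows "first_variation_identity W"
proof -
  have C: "C1_on M V" using V by (simp add: first_variation_identity_def)
  have sp: "space dA = M" by (rule space_area_measure[OF R_C1_on])
  have rw: "\<And>p. p \<in> M \<Longrightarrow> rel_wedge R W p = rel_wedge R V p" by (rule rel_wedge_cong[OF C eq])
  have Wbd: "W p = V p" if "p \<in> bd" for p using eq bd_subset that by (metis subsetD)
  have 1: "integrable dA (\<lambda>p. N p \<bullet> rel_wedge R W p) = integrable dA (\<lambda>p. N p \<bullet> rel_wedge R V p)"
    "(\<integral>p. 2 * (N p \<bullet> rel_wedge R W p) \<partial>dA) = (\<integral>p. 2 * (N p \<bullet> rel_wedge R V p) \<partial>dA)"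
    by (auto intro!: Bochner_Integration.integrable_cong Bochner_Integration.integral_cong simp: sp rw)
  have 2: "integrable dA (\<lambda>p. mean_curvature M A R N p * (W p \<bullet> N p)) = integrable dA (\<lambda>p. mean_curvature M A R N p * (V p \<bullet> N p))"
    "(\<integral>p. mean_curvature M A R N p * (W p \<bullet> N p) \<partial>dA) = (\<integral>p. mean_curvature M A R N p * (V p \<bullet> N p) \<partial>dA)"
    by (auto intro!: Bochner_Integration.integrable_cong Bochner_Integration.integral_cong simp: sp eq)
  have 3: "integrable ds (\<lambda>p. W p \<bullet> con p) = integrable ds (\<lambda>p. V p \<bullet> con p)"
    "(\<integral>p. W p \<bullet> con p \<partial>ds) = (\<integral>p. V p \<bullet> con p \<partial>ds)"
    by (auto intro!: Bochner_Integration.integrable_cong Bochner_Integration.integral_cong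
        simp: space_boundary_measure Wbd)
  show ?thesis
    using V C1_on_cong[OF C eq] unfolding first_variation_identity_def 1 2 3 by simp
qed

lemma first_variation_identity_zero: "first_variation_identity (\<lambda>_. 0)"
proof -
  have "openin (top_of_set M) M" by simp
  then have C: "C1_on M (\<lambda>_. 0 :: real^3)" by (rule C1_on_const)
  have "rel_wedge R (\<lambda>_. 0) p = 0" if "p \<in> M" for p
    by (rule rel_wedge_outside[of "{}"]) (use C R_C1_on that in auto)
  then have z: "N p \<bullet> rel_wedge R (\<lambda>_. 0) p = 0" if "p \<in> space dA" for p
    using that space_area_measure[OF R_C1_on] by simp
  have "integrable dA (\<lambda>p. N p \<bullet> rel_wedge R (\<lambda>_. 0) p) = integrable dA (\<lambda>p. 0 :: real)"
    "(\<integral>p. 2 * (N p \<bullet> rel_wedge R (\<lambda>_. 0) p) \<partial>dA) = (\<integral>p. (0 :: real) \<partial>dA)"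
    by (rule Bochner_Integration.integrable_cong[OF refl] Bochner_Integration.integral_cong[OF refl], simp add: z)+
  then show ?thesis using C by (simp add: first_variation_identity_def)
qed

lemma first_variation_identity_add:
  assumes V: "first_variation_identity V" and W: "first_variation_identity W"
  shows "first_variation_identity (\<lambda>p. V p + W p)"
proof -
  have C: "C1_on M V" "C1_on M W" using V W by (simp_all add: first_variation_identity_def)
  let ?H = "mean_curvature M A R N"
  have sp: "space dA = M" by (rule space_area_measure[OF R_C1_on])
  have i: "integrable dA (\<lambda>p. N p \<bullet> rel_wedge R V p)" "integrable dA (\<lambda>p. N p \<bullet> rel_wedge R W p)"
    "integrable dA (\<lambda>p. ?H p * (V p \<bullet> N p))" "integrable dA (\<lambda>p. ?H p * (W p \<bullet> N p))"
    "integrable ds (\<lambda>p. V p \<bullet> con p)" "integrable ds (\<lambda>p. W p \<bullet> con p)"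
    using V W by (simp_all add: first_variation_identity_def)
  have 1: "integrable dA (\<lambda>p. N p \<bullet> rel_wedge R (\<lambda>p. V p + W p) p) =
      integrable dA (\<lambda>p. N p \<bullet> rel_wedge R V p + N p \<bullet> rel_wedge R W p)"
    "(\<integral>p. 2 * (N p \<bullet> rel_wedge R (\<lambda>p. V p + W p) p) \<partial>dA) =
      (\<integral>p. 2 * (N p \<bullet> rel_wedge R V p) + 2 * (N p \<bullet> rel_wedge R W p) \<partial>dA)"
    by (rule Bochner_Integration.integrable_cong[OF refl] Bochner_Integration.integral_cong[OF refl],
        simp add: sp rel_wedge_add[OF C] inner_add_right)+
  have 2: "(\<integral>p. 2 * (N p \<bullet> rel_wedge R V p) + 2 * (N p \<bullet> rel_wedge R W p) \<partial>dA) =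
     (\<integral>p. 2 * (N p \<bullet> rel_wedge R V p) \<partial>dA) + (\<integral>p. 2 * (N p \<bullet> rel_wedge R W p) \<partial>dA)"
    using i by (intro Bochner_Integration.integral_add integrable_mult_right)
  have 3: "(\<integral>p. ?H p * ((V p + W p) \<bullet> N p) \<partial>dA) = (\<integral>p. ?H p * (V p \<bullet> N p) \<partial>dA) + (\<integral>p. ?H p * (W p \<bullet> N p) \<partial>dA)"
    "(\<integral>p. (V p + W p) \<bullet> con p \<partial>ds) = (\<integral>p. V p \<bullet> con p \<partial>ds) + (\<integral>p. W p \<bullet> con p \<partial>ds)"
    using i by (simp_all add: inner_add_left distrib_left)
  have 4: "integrable dA (\<lambda>p. ?H p * ((V p + W p) \<bullet> N p))" "integrable ds (\<lambda>p. (V p + W p) \<bullet> con p)"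
    using i by (simp_all add: inner_add_left distrib_left)
  show ?thesis
    unfolding first_variation_identity_def 1 2 3
    using V W i 4 C1_on_add[OF C] by (simp add: first_variation_identity_def)
qed

lemma first_variation_identity_sum:
  "finite P \<Longrightarrow> (\<And>i. i \<in> P \<Longrightarrow> first_variation_identity (W i)) \<Longrightarrow> first_variation_identity (\<lambda>p. \<Sum>i\<in>P. W i p)"
proof (induction P rule: finite_induct)
  case empty
  then show ?case using first_variation_identity_zero by simp
next
  case (insert i P)
  then have "first_variation_identity (\<lambda>p. W i p + (\<Sum>j\<in>P. W j p))"
    by (intro first_variation_identity_add) auto
  then show ?case using insert by simp
qed

text \<open>The strict inequalities in \<open>supp\<close> make \<open>V\<close> vanish on the edges
  off the boundary line, as the divergence theorem asks. The two area integrands are bounded and the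
  area is finite, so the area integral splits into two.\<close>

lemma first_variation_identity_chart_box:
  fixes x0 :: "real^2"
  assumes fin: "emeasure dA M < \<infinity>"
    and U: "(U, \<phi>) \<in> A" and V: "C1_on M V" and e: "e > 0" and x0: "x0 $ 2 = 0 \<or> e < x0 $ 2" "0 \<le> x0 $ 2"
    and box: "{x. \<bar>x $ 1 - x0 $ 1\<bar> \<le> e \<and> \<bar>x $ 2 - x0 $ 2\<bar> \<le> e \<and> 0 \<le> x $ 2} \<subseteq> \<phi> ` U"
    and supp: "\<And>p. p \<in> M \<Longrightarrow> V p \<noteq> 0 \<Longrightarrow> p \<in> U \<and> \<bar>\<phi> p $ 1 - x0 $ 1\<bar> < e \<and> \<bar>\<phi> p $ 2 - x0 $ 2\<bar> < e"
  shows "first_variation_identity V"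
proof -
  note c = chart_local_coordinates[OF U]
  have UM: "U \<subseteq> M" by (rule LC_subset[OF c])
  let ?H = "mean_curvature M A R N"
  \<comment> \<open>The maximum cuts the box at the boundary line: it is 0 for a centre on the line
    and \<open>x0 $ 2 - e\<close> for a centre higher than \<open>e\<close>.\<close>
  define a b where "a = (vector [x0 $ 1 - e, max 0 (x0 $ 2 - e)] :: real^2)"
    and "b = (vector [x0 $ 1 + e, x0 $ 2 + e] :: real^2)"
  have ab: "a $ 1 \<le> b $ 1" "a $ 2 \<le> b $ 2" using e x0(2) by (auto simp: a_def b_def)
  have cb: "cbox a b = {x. \<bar>x $ 1 - x0 $ 1\<bar> \<le> e \<and> \<bar>x $ 2 - x0 $ 2\<bar> \<le> e \<and> 0 \<le> x $ 2}"
    by (auto simp: mem_box_cart forall_2 a_def b_def)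
  have inbox: "p \<in> U \<and> \<phi> p \<in> cbox a b" if "p \<in> M" "V p \<noteq> 0" for p
    using supp[OF that] chart_half_plane[OF U] unfolding cb by auto
  have s1: "V p = 0" if "p \<in> U" "\<phi> p $ 1 = a $ 1 \<or> \<phi> p $ 1 = b $ 1" for p
    by (rule ccontr) (use supp[of p] that UM e in \<open>auto simp: a_def b_def\<close>)
  have s2: "V p = 0" if "p \<in> U" "\<phi> p $ 2 = b $ 2" for p
    using supp[of p] that UM e by (auto simp: b_def)
  have s3: "V p = 0" if "p \<in> U" "\<phi> p $ 2 = a $ 2" "a $ 2 \<noteq> 0" for p
  proof -
    have "a $ 2 = x0 $ 2 - e" using that(3) by (auto simp: a_def max_def split: if_splits)
    then show ?thesis using supp[of p] that UM e by auto
  qed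
  have box': "cbox a b \<subseteq> \<phi> ` U" using box unfolding cb .
  have D: "(\<integral>p. 2 * (N p \<bullet> rel_wedge R V p) + 2 * (?H p * (V p \<bullet> N p)) \<partial>dA) = (\<integral>p. V p \<bullet> con p \<partial>ds)"
    "integrable ds (\<lambda>p. V p \<bullet> con p)"
    by (rule divergence_theorem_chart_box[OF U V ab box']; use inbox s1 s2 s3 in blast)+
  have "finite_measure dA" using fin space_area_measure[OF R_C1_on] by (intro finite_measureI) auto
  then interpret finite_measure dA .
  let ?K = "inv_into U \<phi> ` cbox a b"
  have K: "compact ?K" "?K \<subseteq> M"
    using compact_continuous_image[OF continuous_on_subset[OF LC_continuous_inv[OF c] box'] compact_cbox]
      box' UM inv_into_into[of _ \<phi> U] by auto
  have VK: "V p = 0" if "p \<in> M - ?K" for p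
  proof (rule ccontr)
    assume "V p \<noteq> 0"
    then have "p \<in> U" "\<phi> p \<in> cbox a b" using inbox that by auto
    then have "p \<in> ?K" using LC_inv[OF c, of p] by (metis imageI)
    then show False using that by blast
  qed
  have int: "integrable dA g" if g: "continuous_on M g" "\<And>p. p \<in> M - ?K \<Longrightarrow> g p = 0" for g :: "'a \<Rightarrow> real"
  proof -
    obtain B where B: "\<forall>p\<in>M. norm (g p) \<le> B" using bounded_if_compact_support[OF K g] by blast
    show ?thesis
      by (rule integrable_const_bound[OF _ continuous_on_M_measurable[OF g(1)], of B])
         (use B space_area_measure[OF R_C1_on] in auto)
  qed
  have i1: "integrable dA (\<lambda>p. N p \<bullet> rel_wedge R V p)"
    by (rule int) (use rel_wedge_outside[OF K V VK R_C1_on] in \<open>auto intro!: continuous_intros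
        C1_on_imp_continuous_on[OF N_C1_on] continuous_on_rel_wedge R_C1_on V\<close>)
  have i2: "integrable dA (\<lambda>p. ?H p * (V p \<bullet> N p))"
    by (rule int) (use VK in \<open>auto intro!: continuous_intros continuous_on_mean_curvature
        C1_on_imp_continuous_on[OF N_C1_on] C1_on_imp_continuous_on[OF V]\<close>)
  have "(\<integral>p. 2 * (N p \<bullet> rel_wedge R V p) + 2 * (?H p * (V p \<bullet> N p)) \<partial>dA)
      = (\<integral>p. 2 * (N p \<bullet> rel_wedge R V p) \<partial>dA) + 2 * (\<integral>p. ?H p * (V p \<bullet> N p) \<partial>dA)"
    using i1 i2 by simp
  then show ?thesis
    unfolding first_variation_identity_def using V i1 i2 D by simp
qed

text \<open>A partition of unity on \<open>K\<close> alone suffices: finitely many bumps whose sum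
  \<open>S\<close> is positive on \<open>K\<close>. The quotient of a bump by \<open>S\<close> is
  controlled only where \<open>S\<close> is nonzero, which is a neighbourhood of \<open>K\<close>,
  but multiplied by \<open>V\<close> it continues by zero to all of \<open>M\<close>.\<close>

lemma first_variation_identity_compact_support:
  assumes fin: "emeasure dA M < \<infinity>" and V: "C1_on M V"
    and K: "compact K" "K \<subseteq> M" "\<And>p. p \<in> M - K \<Longrightarrow> V p = 0"
  shows "first_variation_identity V"
proof -
  have "\<forall>p\<in>M. \<exists>U \<phi> e. (U, \<phi>) \<in> A \<and> p \<in> U \<and> e > 0 \<and> (\<phi> p $ 2 = 0 \<or> e < \<phi> p $ 2) \<and>
    {x. \<bar>x $ 1 - \<phi> p $ 1\<bar> \<le> e \<and> \<bar>x $ 2 - \<phi> p $ 2\<bar> \<le> e \<and> 0 \<le> x $ 2} \<subseteq> \<phi> ` U"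
    using chart_box_at by blast
  then obtain U \<phi> e where ch: "\<forall>p\<in>M. (U p, \<phi> p) \<in> A \<and> p \<in> U p \<and> e p > 0 \<and> (\<phi> p p $ 2 = 0 \<or> e p < \<phi> p p $ 2) \<and>
    {x. \<bar>x $ 1 - \<phi> p p $ 1\<bar> \<le> e p \<and> \<bar>x $ 2 - \<phi> p p $ 2\<bar> \<le> e p \<and> 0 \<le> x $ 2} \<subseteq> \<phi> p ` U p"
    unfolding bchoice_iff by (elim exE)
  have U: "(U p, \<phi> p) \<in> A" "p \<in> U p" "e p > 0" "\<phi> p p $ 2 = 0 \<or> e p < \<phi> p p $ 2"
    "{x. \<bar>x $ 1 - \<phi> p p $ 1\<bar> \<le> e p \<and> \<bar>x $ 2 - \<phi> p p $ 2\<bar> \<le> e p \<and> 0 \<le> x $ 2} \<subseteq> \<phi> p ` U p"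
    if "p \<in> M" for p
    using ch that by blast+
  \<comment> \<open>A product of two coordinate bumps, continued by zero outside the chart.\<close>
  define \<beta> where "\<beta> p q = (if q \<in> U p then bump (\<phi> p p $ 1) (e p) (\<phi> p q $ 1) * bump (\<phi> p p $ 2) (e p) (\<phi> p q $ 2) else 0)"
    for p q
  have \<beta>0: "0 \<le> \<beta> p q" for p q by (simp add: \<beta>_def bump_nonneg)
  have \<beta>1: "\<beta> p p = 1" if "p \<in> M" for p using U(2)[OF that] by (simp add: \<beta>_def bump_center)
  have \<beta>s: "q \<in> U p \<and> \<bar>\<phi> p q $ 1 - \<phi> p p $ 1\<bar> < e p \<and> \<bar>\<phi> p q $ 2 - \<phi> p p $ 2\<bar> < e p"
    if "p \<in> M" "\<beta> p q \<noteq> 0" for p q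
    using that(2) bump_nonzero[OF U(3)[OF that(1)]] unfolding \<beta>_def by (auto split: if_splits)
  have \<beta>C: "C1_on M (\<beta> p)" if p: "p \<in> M" for p
  proof (rule C1_on_cover)
    note c = chart_local_coordinates[OF U(1)[OF p]]
    \<comment> \<open>The closed box has a compact, hence closed, preimage in the Hausdorff space,
      and the bump is zero off it. So the chart domain and the complement of this preimage are open
      sets covering \<open>M\<close>, and the bump is C^1 on both.\<close>
    define B :: "(real^2) set" where "B = {x. \<bar>x $ 1 - \<phi> p p $ 1\<bar> \<le> e p \<and> \<bar>x $ 2 - \<phi> p p $ 2\<bar> \<le> e p \<and> 0 \<le> x $ 2}"
    have BU: "B \<subseteq> \<phi> p ` U p" using U(5)[OF p] by (simp add: B_def)
    have "B = cbox (vector [\<phi> p p $ 1 - e p, max 0 (\<phi> p p $ 2 - e p)]) (vector [\<phi> p p $ 1 + e p, \<phi> p p $ 2 + e p])"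
      by (auto simp: B_def mem_box_cart forall_2)
    then have "compact B" by simp
    then have "compact (inv_into (U p) (\<phi> p) ` B)"
      by (rule compact_continuous_image[OF continuous_on_subset[OF LC_continuous_inv[OF c] BU]])
    then have "closed (inv_into (U p) (\<phi> p) ` B)" by (rule compact_imp_closed)
    then have o: "openin (top_of_set M) (M - inv_into (U p) (\<phi> p) ` B)"
      by (auto simp: openin_open intro!: exI[of _ "- inv_into (U p) (\<phi> p) ` B"])
    have 1: "C1_on (U p) (\<beta> p)"
      by (rule C1_on_cong[OF C1_on_bilinear[OF bounded_bilinear_mult C1_on_bump_coordinate[OF c] C1_on_bump_coordinate[OF c]]])
         (simp add: \<beta>_def)
    have 2: "C1_on (M - inv_into (U p) (\<phi> p) ` B) (\<beta> p)"
    proof (rule C1_on_cong[OF C1_on_const[OF o, of 0]])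
      fix q assume q: "q \<in> M - inv_into (U p) (\<phi> p) ` B"
      show "0 = \<beta> p q"
      proof (rule ccontr)
        assume "0 \<noteq> \<beta> p q"
        then have s: "q \<in> U p" "\<phi> p q \<in> B"
          using \<beta>s[OF p, of q] chart_half_plane[OF U(1)[OF p], of q] by (auto simp: B_def)
        then have "q \<in> inv_into (U p) (\<phi> p) ` B" using LC_inv[OF c s(1)] by (metis imageI)
        then show False using q by blast
      qed
    qed
    fix q assume q: "q \<in> M"
    show "\<exists>Y. q \<in> Y \<and> Y \<subseteq> M \<and> C1_on Y (\<beta> p)"
    proof (cases "q \<in> U p")
      case True
      then show ?thesis using 1 LC_subset[OF c] by blast
    next
      case False
      then have "q \<notin> inv_into (U p) (\<phi> p) ` B" using BU inv_into_into[of _ "\<phi> p" "U p"] by blast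
      then show ?thesis using 2 q by blast
    qed
  qed
  have "\<exists>T. open T \<and> {q \<in> M. \<beta> p q \<noteq> 0} = M \<inter> T" if "p \<in> M" for p
  proof -
    have "openin (top_of_set M) (M \<inter> \<beta> p -` (- {0}))"
      by (rule continuous_openin_preimage_gen[OF C1_on_imp_continuous_on[OF \<beta>C[OF that]]]) (simp add: open_Compl)
    moreover have "{q \<in> M. \<beta> p q \<noteq> 0} = M \<inter> \<beta> p -` (- {0})" by auto
    ultimately show ?thesis unfolding openin_open by simp
  qed
  then obtain T where T: "\<And>p. p \<in> M \<Longrightarrow> open (T p)" "\<And>p. p \<in> M \<Longrightarrow> {q \<in> M. \<beta> p q \<noteq> 0} = M \<inter> T p" by metis
  have "K \<subseteq> (\<Union>p\<in>K. T p)" using T(2) \<beta>1 K(2) by fastforce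
  then obtain P where P: "P \<subseteq> K" "finite P" "K \<subseteq> (\<Union>p\<in>P. T p)"
    using compactE_image[OF K(1), of K T] T(1) K(2) by blast
  have PM: "P \<subseteq> M" using P(1) K(2) by blast
  define S where "S q = (\<Sum>p\<in>P. \<beta> p q)" for q
  have S0: "S q \<noteq> 0" if q: "q \<in> K" for q
  proof -
    obtain p where p: "p \<in> P" "q \<in> T p" using P(3) q by blast
    then have "\<beta> p q \<noteq> 0" using T(2)[of p] PM K(2) q by blast
    then show ?thesis unfolding S_def using P(2) p(1) \<beta>0 by (metis sum_nonneg_eq_0_iff)
  qed
  have oM: "openin (top_of_set M) M" by simp
  have SC: "C1_on M S"
    unfolding S_def[abs_def] using P(2) PM
  proof (induction P rule: finite_induct)
    case empty
    then show ?case using C1_on_const[OF oM, of 0] by simp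
  next
    case (insert p P)
    then have "C1_on M (\<lambda>q. \<beta> p q + (\<Sum>p\<in>P. \<beta> p q))" by (intro C1_on_add \<beta>C) auto
    then show ?case using insert by simp
  qed
  \<comment> \<open>On this set \<open>inverse (S q)\<close> is C^1. Elsewhere it takes the default
    value 0, which does no harm because \<open>O'\<close> contains \<open>K\<close> and
    \<open>V\<close> is zero off \<open>K\<close>.\<close>
  define O' where "O' = M \<inter> S -` (- {0})"
  have O': "openin (top_of_set M) O'" "O' \<subseteq> M"
    unfolding O'_def by (rule continuous_openin_preimage_gen[OF C1_on_imp_continuous_on[OF SC]]) (auto simp: open_Compl)
  have inv: "C1_on O' (\<lambda>q. inverse (S q))"
  proof (rule C1_on_compose_real[OF C1_on_subset[OF SC O']])
    show "(inverse has_field_derivative - (inverse x ^ Suc (Suc 0))) (at x)" if "x \<in> S ` O'" for x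
      using that by (intro DERIV_inverse) (auto simp: O'_def)
    show "continuous_on (S ` O') (\<lambda>x. - (inverse x ^ Suc (Suc 0)))"
      by (intro continuous_intros) (auto simp: O'_def)
  qed
  define W where "W p q = (\<beta> p q * inverse (S q)) *\<^sub>R V q" for p q
  have oK: "openin (top_of_set M) (M - K)"
    using compact_imp_closed[OF K(1)] by (auto simp: openin_open intro!: exI[of _ "- K"])
  have WC: "C1_on M (W p)" if p: "p \<in> M" for p
  proof (rule C1_on_cover)
    have 1: "C1_on O' (W p)"
      unfolding W_def[abs_def]
      by (intro C1_on_bilinear[OF bounded_bilinear_scaleR] C1_on_bilinear[OF bounded_bilinear_mult] inv
          C1_on_subset[OF \<beta>C[OF p] O'] C1_on_subset[OF V O'])
    have 2: "C1_on (M - K) (W p)"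
      by (rule C1_on_cong[OF C1_on_const[OF oK, of 0]]) (use K(3) in \<open>simp add: W_def\<close>)
    fix q assume q: "q \<in> M"
    show "\<exists>Y. q \<in> Y \<and> Y \<subseteq> M \<and> C1_on Y (W p)"
    proof (cases "q \<in> K")
      case True
      then have "q \<in> O'" using S0 q by (simp add: O'_def)
      then show ?thesis using 1 O'(2) by blast
    next
      case False
      then show ?thesis using 2 q by blast
    qed
  qed
  have "first_variation_identity (W p)" if "p \<in> P" for p
  proof -
    have p: "p \<in> M" using that PM by blast
    show ?thesis
    proof (rule first_variation_identity_chart_box[OF fin U(1)[OF p] WC[OF p] U(3)[OF p] U(4)[OF p] _ U(5)[OF p]])
      show "0 \<le> \<phi> p p $ 2" by (rule chart_half_plane[OF U(1)[OF p] U(2)[OF p]])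
      show "q \<in> U p \<and> \<bar>\<phi> p q $ 1 - \<phi> p p $ 1\<bar> < e p \<and> \<bar>\<phi> p q $ 2 - \<phi> p p $ 2\<bar> < e p"
        if "q \<in> M" "W p q \<noteq> 0" for q
        using \<beta>s[OF p, of q] that(2) by (auto simp: W_def)
    qed
  qed
  from first_variation_identity_sum[OF P(2) this] have "first_variation_identity (\<lambda>q. \<Sum>p\<in>P. W p q)" .
  then show ?thesis
  proof (rule first_variation_identity_cong)
    fix q assume q: "q \<in> M"
    have "(\<Sum>p\<in>P. W p q) = (S q * inverse (S q)) *\<^sub>R V q"
      unfolding W_def S_def by (simp only: scaleR_left.sum[symmetric] sum_distrib_right)
    \<comment> \<open>On \<open>K\<close> the factor \<open>S q * inverse (S q)\<close> is 1; off
      \<open>K\<close> both sides are zero.\<close>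
    also have "\<dots> = V q" using S0[of q] K(3)[of q] q by (cases "q \<in> K") auto
    finally show "(\<Sum>p\<in>P. W p q) = V q" .
  qed
qed

end

text \<open>Finite area and compact support take the place of compactness of \<open>M\<close>; for
  compact \<open>M\<close> one may take \<open>K = M\<close>. For
  \<open>\<bar>t\<bar> \<le> 1\<close> the deformed area is finite as well, so near 0
  \<open>measure\<close> is the true area and not its default value for infinite measure.\<close>

theorem theorem4p3:
  fixes M K :: "'a::{t2_space,second_countable_topology} set"
    and A :: "'a chart set"
    and R N V \<eta> :: "'a \<Rightarrow> real^3"
    and v\<^sub>n :: "'a \<Rightarrow> real"
  assumes "surface_with_boundary M A"
    and "smooth_immersion A R"
    and "\<And>p. p \<in> M \<Longrightarrow>
          \<exists>U c. p \<in> U \<and> curvature_line_coordinates M A R N U c \<and> unit_normal_in U c R N"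
    and "emeasure (area_measure M A R) M < \<infinity>"
    and "smooth_map A V"
    and "compact K" and "K \<subseteq> M" and "\<And>p. p \<in> M - K \<Longrightarrow> V p = 0"
    and "\<And>p. p \<in> M \<Longrightarrow> V p = \<eta> p + v\<^sub>n p *\<^sub>R N p"
    and "\<And>p. p \<in> M \<Longrightarrow> \<eta> p \<bullet> N p = 0"
    and "\<And>p. p \<in> M \<Longrightarrow> v\<^sub>n p = V p \<bullet> N p"
  shows "((\<lambda>t. measure (area_measure M A (\<lambda>p. R p + t *\<^sub>R V p)) M) has_real_derivative
           (- 2 * (\<integral>p. mean_curvature M A R N p * (V p \<bullet> N p) \<partial>area_measure M A R)
            + (\<integral>p. \<eta> p \<bullet> outward_conormal A R p \<partial>boundary_measure A R))) (at 0)"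
proof -
  interpret surface_immersion M A R N
    by unfold_locales (use assms(1-3) in auto)
  have V: "C1_on M V" by (rule smooth_map_C1_on[OF assms(5)])
  have "first_variation_identity V"
    by (rule first_variation_identity_compact_support[OF assms(4) V assms(6-8)])
  then have "(\<integral>p. 2 * (N p \<bullet> rel_wedge R V p) \<partial>dA)
      = - 2 * (\<integral>p. mean_curvature M A R N p * (V p \<bullet> N p) \<partial>dA) + (\<integral>p. V p \<bullet> con p \<partial>ds)"
    by (simp add: first_variation_identity_def)
  moreover have "(\<integral>p. V p \<bullet> con p \<partial>ds) = (\<integral>p. \<eta> p \<bullet> con p \<partial>ds)"
  proof (rule Bochner_Integration.integral_cong[OF refl])
    fix p assume "p \<in> space ds"
    then have p: "p \<in> bd" by (simp add: space_boundary_measure)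
    then have "V p = \<eta> p + v\<^sub>n p *\<^sub>R N p" using assms(9) bd_subset by blast
    then show "V p \<bullet> con p = \<eta> p \<bullet> con p" using N_inner_conormal[OF p] by (simp add: inner_add_left)
  qed
  ultimately show ?thesis
    using area_derivative[OF assms(4) V assms(6-8)] by simp
qed

end
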